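(* Let $(\Phi,K,\mu,T)$ be a self-conformal system on $\mathbb{R}^d$ with $\dim_{\mathrm H}K=d$, and suppose $\mu$ is a Gibbs measure equivalent to $\mathcal{L}^d|_K$ with density function $h$. Let $\psi:\mathbb{R}\to[0,\infty)$ be a function with $\psi(x)\to0$ as $x\to\infty$. Put $c_d:=\mathcal{L}^d(B(0,1))$, $\Psi_\eta(N):=\sum_{n=1}^N\psi(n)^{(1-\eta)d}$ and $\Psi(N):=\Psi_0(N)=\sum_{n=1}^N\psi(n)^d$, and let $\epsilon_n(x)$ be defined by $$\mu\big(B(x,\psi(n))\big)=\big(h(x)+\epsilon_n(x)\big)\,c_d\,\psi(n)^d,$$ so that $\epsilon_n(x)\to0$ as $n\to\infty$ for $\mu$-almost all $x\in K$. Then: (i) for any $\eta>0$ and $\epsilon>0$, for $\mu$-almost all $x\in K$, $$\sum_{n=1}^N\mathbf{1}_{B(x,\psi(n))}(T^nx)=c_d\,h(x)\Psi(N)+c_d\sum_{n=1}^N\epsilon_n(x)\psi(n)^d+O\Big(\Psi_\eta(N)^{1/2}\big(\log(\Psi_\eta(N)+1)\big)^{\frac32+\epsilon}\Big),$$ where $N\in\mathbb{N}$ and the implied constant may depend on $x,\eta,\epsilon$ but not on $N$; (ii) if $\sum_{n=1}^\infty\psi(n)^d=\infty$, then for $\mu$-almost all $x\in K$ $$\lim_{N\to\infty}\frac{\sum_{n=1}^N\mathbf{1}_{B(x,\psi(n))}(T^nx)}{\Psi(N)}=c_d\,h(x).$$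
   Context: Self-conformal system. $|\cdot|$ is the Euclidean norm on $\mathbb{R}^d$; for a $d\times d$ matrix $A$, $|A|=\sup\{|Ax|:|x|=1\}$; $f'(x)$ is the Jacobian matrix. A $C^1$ map $f:\Omega\to\mathbb{R}^d$ on an open set $\Omega\subseteq\mathbb{R}^d$ is conformal if it is injective, $f'(x)\ne0$ and $|f'(x)y|=|f'(x)|\,|y|$ for all $x\in\Omega$, $y\in\mathbb{R}^d$. A $C^{1+\alpha}$ conformal IFS ($\alpha>0$) is a finite family $\Phi=\{\varphi_j\}_{1\le j\le m}$, $m\ge2$, for which there is a bounded connected open set $\Omega\subseteq\mathbb{R}^d$ such that each $\varphi_j:\Omega\to\Omega$ is an injective contractive conformal map with $\overline{\varphi_j(\Omega)}\subseteq\Omega$, $0<\inf_\Omega|\varphi_j'|\le\sup_\Omega|\varphi_j'|<1$, and $\big||\varphi_j'(x)|-|\varphi_j'(y)|\big|\le C|x-y|^\alpha$ on $\Omega$ for some constant $C$. $K\subseteq\Omega$ is the unique nonempty compact set with $K=\bigcup_{j}\varphi_j(K)$ (the self-conformal set). The open set condition (OSC): there is a nonempty open $V\subseteq\Omega$ with $\varphi_j(V)\subseteq V$ for all $j$ and $\varphi_i(V)\cap\varphi_j(V)=\emptyset$ for $i\ne j$. Gibbs measure on $K$: given $\alpha'>0$ and positive $\alpha'$-Hölder functions $g_j:\varphi_j(\Omega)\to(0,\infty)$ ($1\le j\le m$), let $\mathcal{L}:C(K)\to C(K)$, $(\mathcal{L}f)(x)=\sum_{j=1}^m g_j(\varphi_j(x))f(\varphi_j(x))$,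 with spectral radius $R$ and dual $\mathcal{L}^*$ acting on finite signed Borel measures on $K$. There are a unique positive $u\in C(K)$ and a unique Borel probability measure $\nu$ on $K$ with $\mathcal{L}u=Ru$, $\mathcal{L}^*\nu=R\nu$, $\int_K u\,d\nu=1$. The Gibbs measure is $d\mu=u\,d\nu$. The map $T$: let $\pi:\{1,\dots,m\}^{\mathbb{N}}\to K$, $\pi(i_1i_2\cdots)=\lim_{n}\varphi_{i_1}\circ\cdots\circ\varphi_{i_n}(x_0)$ (any $x_0\in K$), let $\sigma$ be the left shift and $\widetilde K=\{x\in K:\#\pi^{-1}(x)=1\}$. Define $T:\mathbb{R}^d\to\mathbb{R}^d$ by $T(x)=\pi(\sigma(\pi^{-1}(x)))$ if $x\in\widetilde K$ and $T(x)=x$ otherwise. A self-conformal system on $\mathbb{R}^d$ is a quadruple $(\Phi,K,\mu,T)$ with $\Phi$ a $C^{1+\alpha}$ conformal IFS (some $\alpha>0$) satisfying the OSC, $K$ its self-conformal set, $\mu$ a Gibbs measure on $K$ (with respect to some such potentials; viewed as a measure on $\mathbb{R}^d$; it is $T$-invariant), and $T:\mathbb{R}^d\to\mathbb{R}^d$ the map given by $T(x)=\pi(\sigma(\pi^{-1}(x)))$ for $x\in\widetilde K$ and $T(x)=x$ for $x\notin\widetilde K$. $\mathcal{L}^d$ (with superscript $d$) is $d$-dimensional Lebesgue measure and $\mathcal{L}^d|_K$ its restriction to $K$; the density $h$ is the Radon–Nikodym derivative of $\mu$ with respect to $\mathcal{L}^d|_K$; $\dim_{\mathrm H}$ is Hausdorff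 dimension. Two Borel measures $\mu,\nu$ are equivalent if there is $C\ge1$ with $C^{-1}\nu(E)\le\mu(E)\le C\nu(E)$ for all Borel $E$. $B(x,r)$ is the open Euclidean ball with centre $x$ and radius $r$ (empty if $r=0$); $\mathbf{1}_A$ is the indicator function of $A$. If $\psi(n)=0$, put $\epsilon_n(x)=0$. *)

theory Defs
  imports "HOL-Analysis.Analysis"
begin

section \<open>Hausdorff dimension\<close>

text \<open>
  The cases of the cost function give the usual conventions: the empty set costs 0 for every
  exponent, and a nonempty set of diameter 0 costs 1 for exponent 0 (whereas 0 powr 0 = 0).
  Boundedness is required because the library's \<open>diameter\<close> is only meaningful for bounded sets.
\<close>

definition hausdorff_cost :: "real \<Rightarrow> 'a::metric_space set \<Rightarrow> real" where
  "hausdorff_cost s U = (if U = {} then 0 else if s = 0 then 1 else diameter U powr s)"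

definition hausdorff_premeasure :: "real \<Rightarrow> real \<Rightarrow> 'a::metric_space set \<Rightarrow> ennreal" where
  "hausdorff_premeasure s \<delta> A =
     (INF U \<in> {U :: nat \<Rightarrow> 'a set. A \<subseteq> (\<Union>i. U i) \<and> (\<forall>i. bounded (U i) \<and> diameter (U i) \<le> \<delta>)}.
        \<Sum>i. ennreal (hausdorff_cost s (U i)))"

definition hausdorff_measure :: "real \<Rightarrow> 'a::metric_space set \<Rightarrow> ennreal" where
  "hausdorff_measure s A = (SUP \<delta>\<in>{0<..}. hausdorff_premeasure s \<delta> A)"

definition hausdorff_dim :: "'a::metric_space set \<Rightarrow> ereal" where
  "hausdorff_dim A = Inf {ereal s |s. 0 \<le> s \<and> hausdorff_measure s A = 0}"

section \<open>Conformal iterated function systems\<close>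

text \<open>
  Maps on an open set \<open>\<Omega>\<close> are represented by total functions of which only the values on \<open>\<Omega>\<close>
  matter. The families are indexed by \<open>{1..m}\<close>.
\<close>

abbreviation jacobian_norm :: "(real^'n \<Rightarrow> real^'n) \<Rightarrow> real^'n \<Rightarrow> real" where
  "jacobian_norm f x \<equiv> onorm ((*v) (jacobian f (at x)))"

definition conformal_on :: "(real^'n) set \<Rightarrow> (real^'n \<Rightarrow> real^'n) \<Rightarrow> bool" where
  "conformal_on \<Omega> f \<longleftrightarrow>
     (\<forall>x\<in>\<Omega>. f differentiable (at x)) \<and>
     continuous_on \<Omega> (\<lambda>x. jacobian f (at x)) \<and>
     inj_on f \<Omega> \<and>
     (\<forall>x\<in>\<Omega>. jacobian f (at x) \<noteq> 0) \<and>
     (\<forall>x\<in>\<Omega>. \<forall>y. norm (jacobian f (at x) *v y) = jacobian_norm f x * norm y)"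

definition holder_on :: "real \<Rightarrow> 'a::metric_space set \<Rightarrow> ('a \<Rightarrow> real) \<Rightarrow> bool" where
  "holder_on \<alpha> S f \<longleftrightarrow> (\<exists>C. \<forall>x\<in>S. \<forall>y\<in>S. \<bar>f x - f y\<bar> \<le> C * dist x y powr \<alpha>)"

definition conformal_ifs ::
  "real \<Rightarrow> (real^'n) set \<Rightarrow> nat \<Rightarrow> (nat \<Rightarrow> real^'n \<Rightarrow> real^'n) \<Rightarrow> bool" where
  "conformal_ifs \<alpha> \<Omega> m \<phi> \<longleftrightarrow>
     0 < \<alpha> \<and> 2 \<le> m \<and> bounded \<Omega> \<and> connected \<Omega> \<and> open \<Omega> \<and>
     (\<forall>j\<in>{1..m}.
        conformal_on \<Omega> (\<phi> j) \<and>
        closure (\<phi> j ` \<Omega>) \<subseteq> \<Omega> \<and>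
        (\<exists>\<rho><1. \<forall>x\<in>\<Omega>. \<forall>y\<in>\<Omega>. dist (\<phi> j x) (\<phi> j y) \<le> \<rho> * dist x y) \<and>
        (\<exists>a b. 0 < a \<and> b < 1 \<and> (\<forall>x\<in>\<Omega>. a \<le> jacobian_norm (\<phi> j) x \<and> jacobian_norm (\<phi> j) x \<le> b)) \<and>
        holder_on \<alpha> \<Omega> (jacobian_norm (\<phi> j)))"

definition open_set_condition ::
  "'a::topological_space set \<Rightarrow> nat \<Rightarrow> (nat \<Rightarrow> 'a \<Rightarrow> 'a) \<Rightarrow> bool" where
  "open_set_condition \<Omega> m \<phi> \<longleftrightarrow>
     (\<exists>V. V \<noteq> {} \<and> open V \<and> V \<subseteq> \<Omega> \<and>
          (\<forall>j\<in>{1..m}. \<phi> j ` V \<subseteq> V) \<and>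
          (\<forall>i\<in>{1..m}. \<forall>j\<in>{1..m}. i \<noteq> j \<longrightarrow> \<phi> i ` V \<inter> \<phi> j ` V = {}))"

definition attractor ::
  "'a::topological_space set \<Rightarrow> nat \<Rightarrow> (nat \<Rightarrow> 'a \<Rightarrow> 'a) \<Rightarrow> 'a set \<Rightarrow> bool" where
  "attractor \<Omega> m \<phi> K \<longleftrightarrow> K \<noteq> {} \<and> compact K \<and> K \<subseteq> \<Omega> \<and> K = (\<Union>j\<in>{1..m}. \<phi> j ` K)"

section \<open>Gibbs measures\<close>

text \<open>
  Elements of \<open>C(K)\<close> are represented by functions continuous on \<open>K\<close>, identified when they agree
  on \<open>K\<close>. The operator is defined for real and for complex functions, since its spectrum is that of
  its action on the complex space \<open>C(K)\<close>.
\<close>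

definition transfer_operator ::
  "nat \<Rightarrow> (nat \<Rightarrow> 'a \<Rightarrow> 'a) \<Rightarrow> (nat \<Rightarrow> 'a \<Rightarrow> real) \<Rightarrow> ('a \<Rightarrow> 'b::real_vector) \<Rightarrow> 'a \<Rightarrow> 'b" where
  "transfer_operator m \<phi> g f x = (\<Sum>j=1..m. g j (\<phi> j x) *\<^sub>R f (\<phi> j x))"

text \<open>
  For an operator \<open>A\<close> on \<open>C(K)\<close> that is linear: \<open>A\<close> is onto, and it is one-to-one with an
  inverse bounded by \<open>C\<close> in the supremum norm.
\<close>

definition invertible_on_C ::
  "'a::topological_space set \<Rightarrow> (('a \<Rightarrow> complex) \<Rightarrow> 'a \<Rightarrow> complex) \<Rightarrow> bool" where
  "invertible_on_C K A \<longleftrightarrow>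
     (\<forall>g. continuous_on K g \<longrightarrow> (\<exists>f. continuous_on K f \<and> (\<forall>x\<in>K. A f x = g x))) \<and>
     (\<exists>C. \<forall>f. continuous_on K f \<longrightarrow> (\<forall>x\<in>K. norm (f x) \<le> C * (SUP y\<in>K. norm (A f y))))"

definition spectrum_on_C ::
  "'a::topological_space set \<Rightarrow> (('a \<Rightarrow> complex) \<Rightarrow> 'a \<Rightarrow> complex) \<Rightarrow> complex set" where
  "spectrum_on_C K A = {l. \<not> invertible_on_C K (\<lambda>f x. l * f x - A f x)}"

definition spectral_radius_on_C ::
  "'a::topological_space set \<Rightarrow> (('a \<Rightarrow> complex) \<Rightarrow> 'a \<Rightarrow> complex) \<Rightarrow> real" where
  "spectral_radius_on_C K A = (SUP l\<in>spectrum_on_C K A. cmod l)"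

text \<open>
  The equation for the dual operator is expressed by integration against test functions, and the
  final \<open>distr\<close> views the measure on \<open>K\<close> as a Borel measure on the ambient space.
\<close>

definition gibbs_measure ::
  "'a::metric_space set \<Rightarrow> nat \<Rightarrow> (nat \<Rightarrow> 'a \<Rightarrow> 'a) \<Rightarrow> 'a set \<Rightarrow> 'a measure \<Rightarrow> bool" where
  "gibbs_measure \<Omega> m \<phi> K \<mu> \<longleftrightarrow>
     (\<exists>\<alpha> g R u \<nu>.
        0 < \<alpha> \<and>
        (\<forall>j\<in>{1..m}. (\<forall>x\<in>\<phi> j ` \<Omega>. 0 < g j x) \<and> holder_on \<alpha> (\<phi> j ` \<Omega>) (g j)) \<and>
        R = spectral_radius_on_C K (transfer_operator m \<phi> g) \<and>
        continuous_on K u \<and> (\<forall>x\<in>K. 0 < u x) \<and>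
        sets \<nu> = sets (restrict_space borel K) \<and> emeasure \<nu> K = 1 \<and>
        (\<forall>x\<in>K. transfer_operator m \<phi> g u x = R * u x) \<and>
        (\<forall>f::'a \<Rightarrow> real. continuous_on K f \<longrightarrow>
           (\<integral>x. transfer_operator m \<phi> g f x \<partial>\<nu>) = R * (\<integral>x. f x \<partial>\<nu>)) \<and>
        (\<integral>x. u x \<partial>\<nu>) = 1 \<and>
        \<mu> = distr (density \<nu> (\<lambda>x. ennreal (u x))) borel (\<lambda>x. x))"

definition equivalent_measures ::
  "'a::topological_space measure \<Rightarrow> 'a measure \<Rightarrow> bool" where
  "equivalent_measures \<mu> \<nu> \<longleftrightarrow>
     (\<exists>C\<ge>1. \<forall>E\<in>sets borel.
        ennreal (1 / C) * emeasure \<nu> E \<le> emeasure \<mu> E \<and>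
        emeasure \<mu> E \<le> ennreal C * emeasure \<nu> E)"

section \<open>The induced map and self-conformal systems\<close>

definition symbolic_space :: "nat \<Rightarrow> (nat \<Rightarrow> nat) set" where
  "symbolic_space m = {\<omega>. \<forall>n. \<omega> n \<in> {1..m}}"

primrec word_map :: "(nat \<Rightarrow> 'a \<Rightarrow> 'a) \<Rightarrow> (nat \<Rightarrow> nat) \<Rightarrow> nat \<Rightarrow> 'a \<Rightarrow> 'a" where
  "word_map \<phi> \<omega> 0 = id"
| "word_map \<phi> \<omega> (Suc n) = word_map \<phi> \<omega> n \<circ> \<phi> (\<omega> n)"

definition coding_map ::
  "(nat \<Rightarrow> 'a \<Rightarrow> 'a) \<Rightarrow> 'a::topological_space set \<Rightarrow> (nat \<Rightarrow> nat) \<Rightarrow> 'a" where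
  "coding_map \<phi> K \<omega> = (THE y. \<forall>x0\<in>K. (\<lambda>n. word_map \<phi> \<omega> n x0) \<longlonglongrightarrow> y)"

definition induced_map ::
  "nat \<Rightarrow> (nat \<Rightarrow> 'a \<Rightarrow> 'a) \<Rightarrow> 'a::topological_space set \<Rightarrow> 'a \<Rightarrow> 'a" where
  "induced_map m \<phi> K x =
     (if x \<in> K \<and> (\<exists>!\<omega>. \<omega> \<in> symbolic_space m \<and> coding_map \<phi> K \<omega> = x)
      then coding_map \<phi> K (\<lambda>n. (THE \<omega>. \<omega> \<in> symbolic_space m \<and> coding_map \<phi> K \<omega> = x) (Suc n))
      else x)"

text \<open>
  The domain \<open>\<Omega>\<close> is shared by the maps, the open set condition and the potentials of the
  Gibbs measure.
\<close>

definition self_conformal_system ::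
  "nat \<Rightarrow> (nat \<Rightarrow> real^'n \<Rightarrow> real^'n) \<Rightarrow> (real^'n) set \<Rightarrow> (real^'n) measure \<Rightarrow>
     (real^'n \<Rightarrow> real^'n) \<Rightarrow> bool" where
  "self_conformal_system m \<phi> K \<mu> T \<longleftrightarrow>
     (\<exists>\<alpha> \<Omega>. conformal_ifs \<alpha> \<Omega> m \<phi> \<and> open_set_condition \<Omega> m \<phi> \<and> attractor \<Omega> m \<phi> K \<and>
            gibbs_measure \<Omega> m \<phi> K \<mu>) \<and>
     T = induced_map m \<phi> K"

section \<open>Counting function and error terms\<close>

definition recurrence_count ::
  "('a::metric_space \<Rightarrow> 'a) \<Rightarrow> (real \<Rightarrow> real) \<Rightarrow> nat \<Rightarrow> 'a \<Rightarrow> real" where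
  "recurrence_count T \<psi> N x = (\<Sum>n=1..N. indicator (ball x (\<psi> (real n))) ((T ^^ n) x))"

text \<open>
  For \<open>\<eta> \<ge> 1\<close> the exponent is not positive; a term with \<open>\<psi> n = 0\<close> contributes 0 for every \<open>\<eta>\<close>,
  because 0 powr a = 0 for all \<open>a\<close>.
\<close>

definition Psi_sum :: "nat \<Rightarrow> (real \<Rightarrow> real) \<Rightarrow> real \<Rightarrow> nat \<Rightarrow> real" where
  "Psi_sum d \<psi> \<eta> N = (\<Sum>n=1..N. \<psi> (real n) powr ((1 - \<eta>) * real d))"

end

theory Submission
  imports Defs "HOL-Probability.Probability_Measure" "HOL-Real_Asymp.Real_Asymp"
begin

text \<open>
  Choosing the inverse branch \<open>\<phi> j\<close> at a point \<open>x\<close> with probability proportional to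
  \<open>g j (\<phi> j x) * u (\<phi> j x)\<close> gives a Markov chain on \<open>K\<close> for which the Gibbs measure \<open>\<mu>\<close> is stationary
  (\<open>gibbs_normalised_weights\<close>), and \<open>T\<close> undoes the last step of the chain. Products of the transition
  probabilities along words of any length have bounded distortion, so the chain forgets its past
  exponentially fast in a norm that combines oscillation and Hoelder constant
  (\<open>exponential_contraction\<close>). Because \<open>T ^^ n\<close> merely reads off an earlier state, this smoothing acts
  on cylinder weights and not on the target sets: the mass of a cylinder that enters an arbitrary
  Borel set \<open>l\<close> steps later is the product of the two masses up to a relative error \<open>\<gamma> ^ l\<close>
  (\<open>exponential_mixing\<close>).

  The event \<open>dist x ((T ^^ n) x) < r\<close> has a moving target \<open>ball x r\<close>, but on a cylinder of generation
  \<open>N\<close> the centre moves by at most \<open>\<rho> ^ N * D\<close>. Freezing it costs the mass of a thin spherical shell,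
  which is controlled because \<open>\<mu>\<close> is dominated by Lebesgue measure. Splitting the time between two
  returns into a half for freezing and a half for mixing shows that the deviations
  \<open>hit n r - ball_mass r\<close> from the expected frequency \<open>\<mu> (ball x r)\<close> have covariances that decay
  exponentially (\<open>covariance_bound\<close>). Hence the variance of a block of deviations is at most a constant times the sum
  of \<open>r n ^ d + (n + 1) * \<tau> ^ n\<close> over the block (\<open>return_variance\<close>), and a dyadic maximal inequality in
  the style of Rademacher, Menshov, Gal and Koksma gives the almost sure error
  \<open>sqrt \<Psi> * ln \<Psi> powr (3/2 + \<epsilon>)\<close> with \<open>\<Psi>\<close> the sum of the \<open>\<psi> n ^ d\<close> (\<open>counting_error_AE\<close>). The
  exponential terms only contribute a constant, so this bound holds with \<open>\<eta> = 0\<close> up to additive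
  constants and implies the statements for every \<open>\<eta> > 0\<close> as well as the limit law.

  That \<open>T\<close> inverts the branches almost everywhere rests on the fact that \<open>\<phi> i ` K\<close> and \<open>\<phi> j ` K\<close>
  overlap in a null set (\<open>overlap_null\<close>): the total volume of the pieces of generation \<open>n\<close> is bounded by
  the open set condition and bounded distortion, while a fat overlap would reappear in every piece
  and make it grow linearly. Finally, the masses \<open>\<mu> (ball x (\<psi> n))\<close> are turned into
  \<open>c * (h x + err n x) * \<psi> n ^ d\<close> with \<open>err n x\<close> tending to 0 by Lebesgue's differentiation theorem
  for balls (\<open>lebesgue_differentiation_balls\<close>).
\<close>

section \<open>Lebesgue differentiation along balls\<close>

text \<open>
  Small balls around the points of \<open>S\<close> have at least as much \<open>\<alpha>\<close>-mass as \<open>\<beta>\<close>-mass, although inside \<open>E\<close>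
  the measure \<open>\<alpha>\<close> is smaller by a factor \<open>\<kappa>\<close>. A disjoint Vitali family of such balls inside an open set
  \<open>U\<close> that barely exceeds \<open>S\<close> covers almost all of \<open>S\<close>; the surplus of \<open>\<alpha>\<close>-mass would have to lie in
  \<open>U - E\<close>, whose volume is arbitrarily small. Applied with \<open>\<beta>\<close> or with \<open>\<alpha>\<close> a multiple of Lebesgue
  measure, this covers upper and lower densities alike.
\<close>

lemma negligible_if_fine_balls_favour:
  fixes \<alpha> \<beta> :: "'a::euclidean_space measure"
  assumes sets [measurable_cong]: "sets \<alpha> = sets borel" "sets \<beta> = sets borel" and E [measurable]: "E \<in> sets borel"
    and M: "0 \<le> M" "\<And>X. X \<in> sets borel \<Longrightarrow> emeasure \<alpha> X \<le> ennreal M * emeasure lborel X"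
    and \<kappa>: "0 \<le> \<kappa>" "\<kappa> < 1" "\<And>X. X \<in> sets borel \<Longrightarrow> X \<subseteq> E \<Longrightarrow> emeasure \<alpha> X \<le> ennreal \<kappa> * emeasure \<beta> X"
    and c: "0 < c" "\<And>X. X \<in> sets borel \<Longrightarrow> X \<subseteq> E \<Longrightarrow> ennreal c * emeasure lborel X \<le> emeasure \<beta> X"
    and fine: "\<And>x \<delta>. x \<in> S \<Longrightarrow> 0 < \<delta> \<Longrightarrow> \<exists>r. 0 < r \<and> r < \<delta> \<and> emeasure \<beta> (ball x r) \<le> emeasure \<alpha> (ball x r)"
    and S: "S \<subseteq> E" "S \<subseteq> ball 0 k"
  shows "negligible S"
proof -
  have lm: "X \<in> lmeasurable" if "X \<in> sets lebesgue" "X \<subseteq> ball 0 k" for X :: "'a set"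
    by (rule bounded_set_imp_lmeasurable[OF bounded_subset[OF bounded_ball that(2)] that(1)])
  define Om where "Om = measure lebesgue ` {U. open U \<and> S \<subseteq> U \<and> U \<subseteq> ball 0 k}"
  define t where "t = Inf Om"
  have One: "Om \<noteq> {}" using S by (auto simp: Om_def)
  have Obd: "bdd_below Om" by (auto simp: Om_def intro!: bdd_belowI[where m=0])
  \<comment> \<open>\<open>t\<close> is the outer measure of \<open>S\<close>\<close>
  have outer: "t \<le> measure lebesgue G" if G: "G \<in> sets lebesgue" "G \<subseteq> ball 0 k" "S \<subseteq> G" for G
  proof (rule field_le_epsilon)
    fix e :: real assume "0 < e"
    obtain V where V: "open V" "G \<subseteq> V" "(V - G) \<in> lmeasurable" "emeasure lebesgue (V - G) < ennreal e"
      using sets_lebesgue_outer_open[OF G(1) \<open>0 < e\<close>] .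
    let ?V = "V \<inter> ball 0 k"
    have "t \<le> measure lebesgue ?V"
      unfolding t_def by (rule cInf_lower[OF _ Obd]) (use V G in \<open>auto simp: Om_def\<close>)
    also have "\<dots> \<le> measure lebesgue (G \<union> (V - G))"
    proof (rule measure_mono_fmeasurable)
      show "G \<union> (V - G) \<in> lmeasurable" by (rule fmeasurable.Un[OF lm[OF G(1,2)] V(3)])
      show "?V \<in> sets lebesgue" using V(1) by simp
    qed auto
    also have "\<dots> \<le> measure lebesgue G + measure lebesgue (V - G)"
      by (rule measure_Un_le) (use V(3) G(1) in \<open>auto simp: fmeasurable_def\<close>)
    also have "measure lebesgue (V - G) \<le> e"
      using V(3,4) \<open>0 < e\<close> by (simp add: emeasure_eq_measure2 ennreal_less_iff less_imp_le)
    finally show "t \<le> measure lebesgue G + e" by simp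
  qed
  have t0: "0 \<le> t" unfolding t_def by (rule cInf_greatest[OF One]) (auto simp: Om_def)
  have key: "t * c * (1 - \<kappa>) \<le> M * e" if e: "0 < e" for e
  proof -
    obtain U where U: "open U" "S \<subseteq> U" "U \<subseteq> ball 0 k" "measure lebesgue U < t + e"
    proof -
      have "Inf Om < t + e" using e by (simp add: t_def)
      then obtain y where "y \<in> Om" "y < t + e" using cInf_lessD[OF One] by blast
      then show ?thesis using that by (auto simp: Om_def)
    qed
    define I where "I = {(x, r). x \<in> S \<and> 0 < r \<and> ball x r \<subseteq> U \<and> emeasure \<beta> (ball x r) \<le> emeasure \<alpha> (ball x r)}"
    have "\<exists>i. i \<in> I \<and> x \<in> ball (fst i) (snd i) \<and> snd i < \<delta>" if x: "x \<in> S" and \<delta>: "0 < \<delta>" for x \<delta>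
    proof -
      obtain \<delta>' where "0 < \<delta>'" "ball x \<delta>' \<subseteq> U" using U x by (meson open_contains_ball subsetD)
      moreover obtain r where "0 < r" "r < min \<delta> \<delta>'" "emeasure \<beta> (ball x r) \<le> emeasure \<alpha> (ball x r)"
        using fine[OF x, of "min \<delta> \<delta>'"] \<delta> \<open>0 < \<delta>'\<close> by auto
      moreover have "ball x r \<subseteq> ball x \<delta>'" using \<open>r < min \<delta> \<delta>'\<close> by (intro subset_ball) auto
      ultimately show ?thesis using x by (intro exI[of _ "(x, r)"]) (auto simp: I_def)
    qed
    then obtain C where C: "countable C" "C \<subseteq> I"
       "pairwise (\<lambda>i j. disjnt (ball (fst i) (snd i)) (ball (fst j) (snd j))) C"
       "negligible (S - (\<Union>i\<in>C. ball (fst i) (snd i)))"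
      by (rule Vitali_covering_theorem_balls[of S I fst snd])
    define W where "W = (\<Union>i\<in>C. ball (fst i) (snd i))"
    have W: "open W" "W \<subseteq> U" using C(2) by (fastforce simp: W_def I_def)+
    then have [measurable]: "W \<in> sets borel" by simp
    have disj: "disjoint_family_on (\<lambda>i. ball (fst i) (snd i)) C"
      using C(3) by (auto simp: disjoint_family_on_def pairwise_def disjnt_def)
    have sum: "emeasure \<nu> W = (\<integral>\<^sup>+i. emeasure \<nu> (ball (fst i) (snd i)) \<partial>count_space C)" if "sets \<nu> = sets borel" for \<nu>
      unfolding W_def by (rule emeasure_UN_countable[OF _ C(1) disj]) (use that in auto)
    have "emeasure \<beta> W \<le> emeasure \<alpha> W"
      unfolding sum[OF sets(1)] sum[OF sets(2)]
      by (rule nn_integral_mono) (use C(2) in \<open>auto simp: I_def\<close>)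
    moreover have "emeasure \<beta> (W \<inter> E) \<le> emeasure \<beta> W" by (rule emeasure_mono) (auto simp: sets)
    moreover have "emeasure \<alpha> W = emeasure \<alpha> (W \<inter> E) + emeasure \<alpha> (W - E)"
      by (subst plus_emeasure) (auto simp: sets Int_Diff_Un)
    moreover have "emeasure \<alpha> (W \<inter> E) \<le> ennreal \<kappa> * emeasure \<beta> (W \<inter> E)" by (rule \<kappa>) auto
    moreover have "emeasure \<alpha> (W - E) \<le> ennreal M * emeasure lborel (W - E)" by (rule M) auto
    ultimately have le: "emeasure \<beta> (W \<inter> E) \<le> ennreal \<kappa> * emeasure \<beta> (W \<inter> E) + ennreal M * emeasure lborel (W - E)"
      by (metis add_mono order_trans)
    have fin: "emeasure \<alpha> W < \<infinity>"
    proof -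
      have "emeasure \<alpha> W \<le> ennreal M * emeasure lborel W" by (rule M) auto
      also have "\<dots> \<le> ennreal M * emeasure lborel (ball (0::'a) k)"
      proof (rule mult_left_mono)
        show "emeasure lborel W \<le> emeasure lborel (ball (0::'a) k)"
          by (rule emeasure_mono) (use W(2) U(3) in auto)
      qed simp
      also have "\<dots> < \<infinity>" using emeasure_bounded_finite[of "ball (0::'a) k"] by (simp add: ennreal_mult_less_top)
      finally show ?thesis .
    qed
    have fin2: "emeasure \<beta> (W \<inter> E) < \<infinity>"
      using \<open>emeasure \<beta> W \<le> emeasure \<alpha> W\<close> \<open>emeasure \<beta> (W \<inter> E) \<le> emeasure \<beta> W\<close> fin by (meson le_less_trans)
    then obtain y where y: "emeasure \<beta> (W \<inter> E) = ennreal y" "0 \<le> y"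
      by (metis enn2real_nonneg ennreal_enn2real infinity_ennreal_def)
    have UE: "measure lebesgue (U - E) \<le> e"
    proof -
      have "measure lebesgue U = measure lebesgue (U \<inter> E) + measure lebesgue (U - E)"
      proof -
        have "U \<inter> E \<in> lmeasurable" "U \<in> lmeasurable" using U(1,3) E by (auto intro!: lm)
        from measure_Un2[OF this] show ?thesis by (simp add: Un_absorb1 Diff_Int)
      qed
      moreover have "t \<le> measure lebesgue (U \<inter> E)" by (rule outer) (use U E S in auto)
      ultimately show ?thesis using U(4) by linarith
    qed
    have WE: "emeasure lborel (W - E) \<le> ennreal e"
    proof -
      have "emeasure lborel (W - E) \<le> emeasure lebesgue (U - E)"
      proof -
        have "emeasure lborel (W - E) = emeasure lebesgue (W - E)" by simp
        also have "\<dots> \<le> emeasure lebesgue (U - E)"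
          by (rule emeasure_mono) (use W U(1) E in auto)
        finally show ?thesis .
      qed
      also have "\<dots> = ennreal (measure lebesgue (U - E))"
        by (rule emeasure_eq_measure2) (use U E in \<open>auto intro!: lm\<close>)
      also have "\<dots> \<le> ennreal e" using UE by (rule ennreal_leI)
      finally show ?thesis .
    qed
    have "ennreal y \<le> ennreal \<kappa> * ennreal y + ennreal M * ennreal e"
      using le unfolding y(1) by (rule order_trans) (intro add_left_mono mult_left_mono WE, auto)
    then have "ennreal y \<le> ennreal (\<kappa> * y + M * e)"
      using y \<kappa> M e by (simp add: ennreal_mult ennreal_plus)
    then have ye: "y \<le> \<kappa> * y + M * e" using y(2) \<kappa>(1) M(1) e by (subst (asm) ennreal_le_iff) auto
    have negl: "negligible (S - W)" using C(4) by (simp add: W_def)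
    have WEs: "W \<inter> E \<in> sets lebesgue" "S - W \<in> sets lebesgue"
      using W(1) E negligible_imp_sets[OF negl] by auto
    have "t \<le> measure lebesgue ((W \<inter> E) \<union> (S - W))"
      by (rule outer[OF sets.Un[OF WEs]]) (use W(2) U(3) S in auto)
    also have "\<dots> \<le> measure lebesgue (W \<inter> E) + measure lebesgue (S - W)"
      by (rule measure_Un_le[OF WEs])
    also have "measure lebesgue (S - W) = 0" using negl by (rule negligible_imp_measure0)
    finally have tW: "t \<le> measure lebesgue (W \<inter> E)" by simp
    have "ennreal (c * measure lebesgue (W \<inter> E)) = ennreal c * emeasure lborel (W \<inter> E)"
    proof -
      have "emeasure lborel (W \<inter> E) = emeasure lebesgue (W \<inter> E)" by simp
      also have "\<dots> = ennreal (measure lebesgue (W \<inter> E))"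
        by (rule emeasure_eq_measure2) (use W U E in \<open>auto intro!: lm\<close>)
      finally show ?thesis using c(1) by (simp add: ennreal_mult)
    qed
    also have "\<dots> \<le> ennreal y" unfolding y(1)[symmetric] by (rule c) auto
    finally have "c * measure lebesgue (W \<inter> E) \<le> y" using y(2) by (subst (asm) ennreal_le_iff) auto
    then have "t * c \<le> y" using tW c(1) by (simp add: mult.commute) (meson mult_left_mono less_imp_le order_trans)
    then have "t * c * (1 - \<kappa>) \<le> y * (1 - \<kappa>)" using \<kappa> by (intro mult_right_mono) auto
    also have "\<dots> \<le> M * e" using ye by (simp add: algebra_simps)
    finally show ?thesis .
  qed
  have "t * c * (1 - \<kappa>) \<le> 0"
  proof (rule field_le_epsilon)
    fix e :: real assume e: "0 < e"
    have "t * c * (1 - \<kappa>) \<le> M * (e / (M + 1))" using e M by (intro key) auto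
    also have "\<dots> \<le> e" using e M by (simp add: field_simps)
    finally show "t * c * (1 - \<kappa>) \<le> 0 + e" by simp
  qed
  then have t: "t = 0" using t0 c \<kappa> by (simp add: mult_le_0_iff zero_le_mult_iff)
  show ?thesis
  proof (subst negligible_outer, intro allI impI)
    fix e :: real assume "0 < e"
    then have "Inf Om < e" using t by (simp add: t_def)
    then obtain y where "y \<in> Om" "y < e" using cInf_lessD[OF One] by blast
    then obtain U where U: "open U" "S \<subseteq> U" "U \<subseteq> ball 0 k" "measure lebesgue U < e"
      by (auto simp: Om_def)
    then have "U \<in> lmeasurable" by (intro lm) auto
    with U show "\<exists>T. S \<subseteq> T \<and> T \<in> lmeasurable \<and> measure lebesgue T < e" by blast
  qed
qed

text \<open>
  Lebesgue's differentiation theorem for balls. Where the averages fail to converge to \<open>f x\<close> they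
  exceed some \<open>b\<close> infinitely often although \<open>f x < a < b\<close>, or symmetrically; the Vitali covering
  theorem shows that each of these countably many sets is negligible.
\<close>

theorem lebesgue_differentiation_balls:
  fixes f :: "'a::euclidean_space \<Rightarrow> real"
  assumes f [measurable]: "f \<in> borel_measurable borel" and f0: "\<And>x. 0 \<le> f x" and fM: "\<And>x. f x \<le> M"
  shows "AE x in lborel. ((\<lambda>r. measure (density lborel (\<lambda>x. ennreal (f x))) (ball x r) / measure lborel (ball x r))
           \<longlongrightarrow> f x) (at_right 0)"
proof -
  define \<nu> where "\<nu> = density lborel (\<lambda>x. ennreal (f x))"
  have s\<nu>: "sets \<nu> = sets borel" by (simp add: \<nu>_def)
  have M0: "0 \<le> M" using f0 fM by (meson order_trans)
  have \<nu>e: "emeasure \<nu> X = (\<integral>\<^sup>+x. ennreal (f x) * indicator X x \<partial>lborel)" if "X \<in> sets borel" for X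
    unfolding \<nu>_def using that by (intro emeasure_density) auto
  have up: "emeasure \<nu> X \<le> ennreal a * emeasure lborel X"
    if "X \<in> sets borel" "\<And>x. x \<in> X \<Longrightarrow> f x \<le> a" for X a
  proof -
    have "emeasure \<nu> X \<le> (\<integral>\<^sup>+x. ennreal a * indicator X x \<partial>lborel)"
      unfolding \<nu>e[OF that(1)] by (rule nn_integral_mono) (use that in \<open>auto simp: indicator_def intro: ennreal_leI\<close>)
    also have "\<dots> = ennreal a * emeasure lborel X" using that by (intro nn_integral_cmult_indicator) auto
    finally show ?thesis .
  qed
  have lo: "ennreal a * emeasure lborel X \<le> emeasure \<nu> X"
    if "X \<in> sets borel" "\<And>x. x \<in> X \<Longrightarrow> a \<le> f x" for X a
  proof -
    have "ennreal a * emeasure lborel X = (\<integral>\<^sup>+x. ennreal a * indicator X x \<partial>lborel)"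
      using that by (intro nn_integral_cmult_indicator[symmetric]) auto
    also have "\<dots> \<le> emeasure \<nu> X"
      unfolding \<nu>e[OF that(1)] by (rule nn_integral_mono) (use that in \<open>auto simp: indicator_def intro: ennreal_leI\<close>)
    finally show ?thesis .
  qed
  have const: "emeasure (density lborel (\<lambda>_. ennreal a)) X = ennreal a * emeasure lborel X"
    if "X \<in> sets borel" for X :: "'a set" and a
    using that by (subst emeasure_density) (auto intro!: nn_integral_cmult_indicator)
  define S1 where "S1 a b k = {x \<in> ball 0 (real k). f x < a \<and>
     (\<forall>\<delta>>0. \<exists>r. 0 < r \<and> r < \<delta> \<and> ennreal b * emeasure lborel (ball x r) \<le> emeasure \<nu> (ball x r))}" for a b :: real and k :: nat
  define S2 where "S2 a b k = {x \<in> ball 0 (real k). b < f x \<and>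
     (\<forall>\<delta>>0. \<exists>r. 0 < r \<and> r < \<delta> \<and> emeasure \<nu> (ball x r) \<le> ennreal a * emeasure lborel (ball x r))}" for a b :: real and k :: nat
  have n1: "negligible (S1 a b k)" if ab: "0 < a" "a < b" for a b k
  proof (rule negligible_if_fine_balls_favour[where \<alpha>=\<nu> and \<beta>="density lborel (\<lambda>_. ennreal b)" and E="{x. f x < a}" and M=M and \<kappa>="a / b" and c=b and k="real k"])
    show "emeasure \<nu> X \<le> ennreal (a / b) * emeasure (density lborel (\<lambda>_. ennreal b)) X"
      if "X \<in> sets borel" "X \<subseteq> {x. f x < a}" for X
    proof -
      have "emeasure \<nu> X \<le> ennreal a * emeasure lborel X" by (rule up) (use that in \<open>auto intro: less_imp_le\<close>)
      also have "ennreal a = ennreal (a / b) * ennreal b" using ab by (simp flip: ennreal_mult)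
      finally show ?thesis using that by (simp add: const mult.assoc)
    qed
  qed (use ab M0 s\<nu> up fM const in \<open>auto simp: S1_def\<close>)
  have n2: "negligible (S2 a b k)" if ab: "0 < a" "a < b" for a b k
  proof (rule negligible_if_fine_balls_favour[where \<beta>=\<nu> and \<alpha>="density lborel (\<lambda>_. ennreal a)" and E="{x. b < f x}" and M=a and \<kappa>="a / b" and c=b and k="real k"])
    show "emeasure (density lborel (\<lambda>_. ennreal a)) X \<le> ennreal (a / b) * emeasure \<nu> X"
      if "X \<in> sets borel" "X \<subseteq> {x. b < f x}" for X
    proof -
      have "ennreal b * emeasure lborel X \<le> emeasure \<nu> X" by (rule lo) (use that in \<open>auto intro: less_imp_le\<close>)
      then have "ennreal (a / b) * (ennreal b * emeasure lborel X) \<le> ennreal (a / b) * emeasure \<nu> X"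
        by (rule mult_left_mono) simp
      moreover have "ennreal (a / b) * ennreal b = ennreal a" using ab by (simp flip: ennreal_mult)
      ultimately show ?thesis using that by (simp add: const flip: mult.assoc)
    qed
    show "ennreal b * emeasure lborel X \<le> emeasure \<nu> X" if "X \<in> sets borel" "X \<subseteq> {x. b < f x}" for X
      by (rule lo) (use that in \<open>auto intro: less_imp_le\<close>)
  qed (use ab s\<nu> const in \<open>auto simp: S2_def\<close>)
  have AEn: "AE x in lborel. x \<notin> N" if "negligible N" for N :: "'a set"
  proof -
    have "AE x in lebesgue. x \<notin> N" using that by (intro AE_not_in) (simp add: negligible_iff_null_sets)
    then show ?thesis by (simp add: AE_completion_iff)
  qed
  have "AE x in lborel. \<forall>a b :: rat. \<forall>k. 0 < a \<longrightarrow> a < b \<longrightarrow>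
      x \<notin> S1 (of_rat a) (of_rat b) k \<and> x \<notin> S2 (of_rat a) (of_rat b) k"
    unfolding AE_all_countable by (auto intro!: AEn n1 n2 simp: of_rat_less)
  then show ?thesis
  proof eventually_elim
    case (elim x)
    obtain k :: nat where k: "norm x < real k" using reals_Archimedean2 by blast
    have pos: "0 < measure lborel (ball x r)" if "0 < r" for r using that by simp
    have fin: "emeasure lborel (ball x r) = ennreal (measure lborel (ball x r))" for r
      using emeasure_bounded_finite[of "ball x r"] by (intro emeasure_eq_ennreal_measure) auto
    have fin\<nu>: "emeasure \<nu> (ball x r) = ennreal (measure \<nu> (ball x r))" for r
    proof (rule emeasure_eq_ennreal_measure)
      have "emeasure \<nu> (ball x r) \<le> ennreal M * emeasure lborel (ball x r)" by (rule up) (use fM in auto)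
      also have "\<dots> < \<infinity>" unfolding fin by (simp add: ennreal_mult_less_top)
      finally show "emeasure \<nu> (ball x r) \<noteq> top" by auto
    qed
    have "((\<lambda>r. measure \<nu> (ball x r) / measure lborel (ball x r)) \<longlongrightarrow> f x) (at_right 0)"
    proof (rule order_tendstoI)
      fix a' assume a': "a' < f x"
      show "\<forall>\<^sub>F r in at_right 0. a' < measure \<nu> (ball x r) / measure lborel (ball x r)"
      proof (cases "a' < 0")
        case True
        show ?thesis using eventually_at_right_less[of 0]
        proof eventually_elim
          case (elim r)
          have "0 \<le> measure \<nu> (ball x r) / measure lborel (ball x r)" by simp
          with True show ?case by linarith
        qed
      next
        case False
        obtain a where a: "a' < real_of_rat a" "real_of_rat a < f x" using of_rat_dense[OF a'] by blast
        obtain b where b: "real_of_rat a < real_of_rat b" "real_of_rat b < f x" using of_rat_dense[OF a(2)] by blast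
        have ab: "0 < a" "a < b" using a b False by (auto simp: of_rat_less) (metis of_rat_less le_less_trans not_less of_rat_0)
        then have "x \<notin> S2 (of_rat a) (of_rat b) k" using elim by blast
        then obtain \<delta> where "0 < \<delta>" and \<delta>: "\<And>r. 0 < r \<Longrightarrow> r < \<delta> \<Longrightarrow> \<not> emeasure \<nu> (ball x r) \<le> ennreal (of_rat a) * emeasure lborel (ball x r)"
          using k b by (auto simp: S2_def)
        have "\<forall>\<^sub>F r in at_right 0. r < \<delta>" "\<forall>\<^sub>F r::real in at_right 0. 0 < r"
          using \<open>0 < \<delta>\<close> by (auto intro: eventually_at_right_less order_tendstoD(2)[OF tendsto_ident_at])
        then show ?thesis
        proof eventually_elim
          case (elim r)
          have "ennreal (of_rat a * measure lborel (ball x r)) < ennreal (measure \<nu> (ball x r))"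
            using \<delta>[OF elim(2,1)] ab(1) unfolding fin fin\<nu> by (simp add: ennreal_mult not_le)
          then have "of_rat a * measure lborel (ball x r) < measure \<nu> (ball x r)"
            using ab(1) by (subst (asm) ennreal_less_iff) auto
          then have "of_rat a < measure \<nu> (ball x r) / measure lborel (ball x r)"
            using pos[OF elim(2)] by (simp add: pos_less_divide_eq)
          then show ?case using a by linarith
        qed
      qed
    next
      fix b' assume b': "f x < b'"
      obtain b where b: "real_of_rat b < b'" "f x < real_of_rat b" using of_rat_dense[OF b'] by blast
      obtain a where a: "real_of_rat a < real_of_rat b" "f x < real_of_rat a" using of_rat_dense[OF b(2)] by blast
      have "0 < real_of_rat a" using f0[of x] a by linarith
      then have ab: "0 < a" "a < b" using a by (auto simp: of_rat_less zero_less_of_rat_iff)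
      then have "x \<notin> S1 (of_rat a) (of_rat b) k" using elim by blast
      then obtain \<delta> where "0 < \<delta>" and \<delta>: "\<And>r. 0 < r \<Longrightarrow> r < \<delta> \<Longrightarrow> \<not> ennreal (of_rat b) * emeasure lborel (ball x r) \<le> emeasure \<nu> (ball x r)"
        using k a by (auto simp: S1_def)
      have "\<forall>\<^sub>F r in at_right 0. r < \<delta>" "\<forall>\<^sub>F r::real in at_right 0. 0 < r"
        using \<open>0 < \<delta>\<close> by (auto intro: eventually_at_right_less order_tendstoD(2)[OF tendsto_ident_at])
      then show "\<forall>\<^sub>F r in at_right 0. measure \<nu> (ball x r) / measure lborel (ball x r) < b'"
      proof eventually_elim
        case (elim r)
        have b0: "0 < real_of_rat b" using \<open>0 < real_of_rat a\<close> a by linarith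
        have "ennreal (measure \<nu> (ball x r)) < ennreal (of_rat b * measure lborel (ball x r))"
          using \<delta>[OF elim(2,1)] b0 unfolding fin fin\<nu> by (simp add: ennreal_mult not_le)
        then have "measure \<nu> (ball x r) < of_rat b * measure lborel (ball x r)"
          by (subst (asm) ennreal_less_iff) auto
        then have "measure \<nu> (ball x r) / measure lborel (ball x r) < of_rat b"
          using pos[OF elim(2)] by (simp add: pos_divide_less_eq)
        then show ?case using b by linarith
      qed
    qed
    then show ?case unfolding \<nu>_def .
  qed
qed

section \<open>Almost sure bounds from variance estimates\<close>

text \<open>
  Cutting \<open>{0..<j}\<close> along the binary digits of \<open>j\<close> uses at most one dyadic block of each length
  \<open>2 ^ s\<close>, so the Cauchy-Schwarz inequality costs only a factor \<open>r\<close>.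
\<close>

lemma dyadic_partial_sum_bound:
  fixes X :: "nat \<Rightarrow> real"
  assumes j: "j < 2 ^ r"
  shows "(\<Sum>i<j. X i)\<^sup>2 \<le> real r * (\<Sum>s<r. \<Sum>t<2^(r-s). (\<Sum>i\<in>{t*2^s..<(t+1)*2^s}. X i)\<^sup>2)"
proof -
  define u where "u s = (j div 2^s) * 2^s" for s :: nat
  have u0: "u 0 = j" by (simp add: u_def)
  have ur: "u r = 0" using j by (simp add: u_def)
  define Y where "Y s = (\<Sum>i\<in>{u (Suc s)..<u s}. X i)" for s
  have step: "j div 2^s = 2 * (j div 2 ^ Suc s) + (j div 2^s) mod 2" for s
    using div_mult2_eq[of j "2^s" 2] by (simp only: power_Suc2) (simp add: mult.commute)
  have le: "u (Suc s) \<le> u s" for s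
  proof -
    have "u s = u (Suc s) + ((j div 2^s) mod 2) * 2^s"
      unfolding u_def by (subst step) (simp add: algebra_simps)
    then show ?thesis by simp
  qed
  have tele: "(\<Sum>i<j. X i) = (\<Sum>i<u k. X i) + (\<Sum>s<k. Y s)" for k
  proof (induction k)
    case 0
    then show ?case by (simp add: u0)
  next
    case (Suc k)
    have "(\<Sum>i<u k. X i) = (\<Sum>i<u (Suc k). X i) + Y k"
      unfolding Y_def lessThan_atLeast0
      by (rule sum.atLeastLessThan_concat[symmetric]) (use le in auto)
    with Suc show ?case by simp
  qed
  have Yb: "(Y s)\<^sup>2 \<le> (\<Sum>t<2^(r-s). (\<Sum>i\<in>{t*2^s..<(t+1)*2^s}. X i)\<^sup>2)" if s: "s < r" for s
  proof (cases "(j div 2^s) mod 2 = 0")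
    case True
    then have "u (Suc s) = u s"
      unfolding u_def by (subst (2) step) simp
    then have "Y s = 0" by (simp add: Y_def)
    then show ?thesis by (simp add: sum_nonneg)
  next
    case False
    then have odd: "(j div 2^s) mod 2 = 1" by simp
    define t where "t = 2 * (j div 2 ^ Suc s)"
    have js: "j div 2^s = t + 1" using step[of s] odd by (simp add: t_def)
    have us: "u s = (t+1) * 2^s" "u (Suc s) = t * 2^s"
      by (simp_all add: u_def js t_def)
    have "t < j div 2^s" using js by simp
    also have "\<dots> < 2^(r-s)"
    proof -
      have "j < 2^(r-s) * 2^s" using j s by (simp flip: power_add)
      then show ?thesis by (simp add: less_mult_imp_div_less)
    qed
    finally have t: "t \<in> {..<2^(r-s)}" by simp
    have "(Y s)\<^sup>2 = (\<Sum>i\<in>{t*2^s..<(t+1)*2^s}. X i)\<^sup>2" by (simp add: Y_def us)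
    also have "\<dots> \<le> (\<Sum>t<2^(r-s). (\<Sum>i\<in>{t*2^s..<(t+1)*2^s}. X i)\<^sup>2)"
      by (rule member_le_sum[OF t]) auto
    finally show ?thesis .
  qed
  have "(\<Sum>i<j. X i)\<^sup>2 = (\<Sum>s<r. Y s)\<^sup>2" using tele[of r] by (simp add: ur)
  also have "\<dots> \<le> (\<Sum>s<r. (Y s)\<^sup>2) * real (card {..<r})"
    by (rule sum_squared_le_sum_of_squares)
  also have "\<dots> \<le> real r * (\<Sum>s<r. \<Sum>t<2^(r-s). (\<Sum>i\<in>{t*2^s..<(t+1)*2^s}. X i)\<^sup>2)"
    by (subst mult.commute, intro mult_mono sum_mono Yb) (auto intro!: sum_nonneg)
  finally show ?thesis .
qed

lemma AE_bounded_of_summable_integral: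
  fixes Z :: "nat \<Rightarrow> 'a \<Rightarrow> real"
  assumes int: "\<And>n. integrable M (Z n)" and nn: "\<And>n x. 0 \<le> Z n x"
    and le: "\<And>n. (\<integral>x. Z n x \<partial>M) \<le> b n" and sb: "summable b"
  shows "AE x in M. summable (\<lambda>n. Z n x)"
proof -
  have [measurable]: "Z n \<in> borel_measurable M" for n using int by auto
  have b0: "0 \<le> b n" for n     using order_trans[OF Bochner_Integration.integral_nonneg[of M "Z n"] le[of n]] nn by simp
  have "(\<integral>\<^sup>+x. (\<Sum>n. ennreal (Z n x)) \<partial>M) = (\<Sum>n. \<integral>\<^sup>+x. ennreal (Z n x) \<partial>M)"
    by (rule nn_integral_suminf) auto
  also have "\<dots> = (\<Sum>n. ennreal (\<integral>x. Z n x \<partial>M))"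
    by (intro suminf_cong nn_integral_eq_integral int) (auto simp: nn)
  also have "\<dots> \<le> (\<Sum>n. ennreal (b n))"
    by (intro suminf_le summableI) (auto intro!: ennreal_leI le)
  also have "\<dots> = ennreal (suminf b)"
    by (rule suminf_ennreal2) (use b0 sb in auto)
  finally have "(\<integral>\<^sup>+x. (\<Sum>n. ennreal (Z n x)) \<partial>M) < \<infinity>"
    using le_less_trans[OF _ ennreal_less_top] by (simp add: infinity_ennreal_def)
  then have "AE x in M. (\<Sum>n. ennreal (Z n x)) \<noteq> \<infinity>"
    by (intro nn_integral_PInf_AE) auto
  then show ?thesis
  proof eventually_elim
    case (elim x)
    then show ?case using nn by (intro summable_suminf_not_top) auto
  qed
qed

text \<open>
  The squares of all dyadic blocks inside \<open>{0..<2^r}\<close> together control every partial sum up to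
  \<open>2 ^ r\<close>, and their total has expectation of order \<open>r * 2 ^ r\<close>. Dividing by
  \<open>r powr (2 + 2 * \<epsilon>) * 2 ^ r\<close> makes the expectations summable in \<open>r\<close>, which bounds the quotients
  almost everywhere. One further factor \<open>r\<close> from \<open>dyadic_partial_sum_bound\<close> and a square root produce
  the exponent \<open>3/2 + \<epsilon>\<close> of the logarithm.
\<close>

lemma dyadic_maximal_AE:
  fixes X :: "nat \<Rightarrow> 'a \<Rightarrow> real" and G :: "nat \<Rightarrow> real"
  assumes int: "\<And>a b. integrable M (\<lambda>x. (\<Sum>i\<in>{a..<b}. X i x)\<^sup>2)"
    and var: "\<And>a b. a \<le> b \<Longrightarrow> (\<integral>x. (\<Sum>i\<in>{a..<b}. X i x)\<^sup>2 \<partial>M) \<le> G b - G a"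
    and G0: "0 \<le> G 0" and Gle: "\<And>j. G j \<le> B * (real j + 1)"
    and e: "\<epsilon> > 0"
  shows "AE x in M. \<exists>C\<ge>0. \<forall>j. \<bar>\<Sum>i<j. X i x\<bar> \<le> C * (sqrt (real j + 1) * ln (real j + 2) powr (3/2 + \<epsilon>))"
proof -
  define Z where "Z r x = (\<Sum>s<r. \<Sum>t<2^(r-s). (\<Sum>i\<in>{t*2^s..<(t+1)*2^s}. X i x)\<^sup>2)" for r x
  have Znn: "0 \<le> Z r x" for r x by (auto simp: Z_def intro!: sum_nonneg)
  have B0: "0 \<le> B" using G0 Gle[of 0] by simp
  have Zint: "integrable M (Z r)" for r unfolding Z_def by (intro Bochner_Integration.integrable_sum int)
  have Zle: "(\<integral>x. Z r x \<partial>M) \<le> real r * (2 * B * 2^r)" for r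
  proof -
    have "(\<integral>x. Z r x \<partial>M) = (\<Sum>s<r. \<Sum>t<2^(r-s). \<integral>x. (\<Sum>i\<in>{t*2^s..<(t+1)*2^s}. X i x)\<^sup>2 \<partial>M)"
      unfolding Z_def by (simp only: Bochner_Integration.integral_sum Bochner_Integration.integrable_sum int)
    also have "\<dots> \<le> (\<Sum>s<r. \<Sum>t<2^(r-s). G ((t+1)*2^s) - G (t*2^s))"
      by (intro sum_mono var) auto
    also have "\<dots> = (\<Sum>s<r. G (2^r) - G 0)"
    proof (rule sum.cong[OF refl])
      fix s assume "s \<in> {..<r}"
      then have "(2::nat)^(r-s) * 2^s = 2^r" by (simp flip: power_add)
      then show "(\<Sum>t<2^(r-s). G ((t+1)*2^s) - G (t*2^s)) = G (2^r) - G 0"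
        using sum_lessThan_telescope[of "\<lambda>t. G (t*2^s)" "2^(r-s)"] by simp
    qed
    also have "\<dots> \<le> real r * (2 * B * 2^r)"
    proof -
      have "G (2^r) - G 0 \<le> B * (2^r + 1)" using G0 Gle[of "2^r"] by simp
      also have "\<dots> \<le> B * (2^r + 2^r)" by (intro mult_left_mono add_left_mono B0) simp
      finally have "real r * (G (2^r) - G 0) \<le> real r * (B * (2^r + 2^r))"
        by (intro mult_left_mono) auto
      then show ?thesis by simp
    qed
    finally show ?thesis .
  qed
  \<comment> \<open>chosen so that the expectations of \<open>Z r / w r\<close> are of order \<open>r powr (-1 - 2 * \<epsilon>)\<close>\<close>
  define w where "w r = (real r powr (2 + 2*\<epsilon>)) * 2^r" for r :: nat
  have "AE x in M. summable (\<lambda>r. Z r x / w r)"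
  proof (rule AE_bounded_of_summable_integral)
    show "integrable M (\<lambda>x. Z r x / w r)" for r using Zint by simp
    show "0 \<le> Z r x / w r" for r x using Znn by (simp add: w_def)
    show "(\<integral>x. Z r x / w r \<partial>M) \<le> 2 * B * real r powr (-1 - 2*\<epsilon>)" for r
    proof (cases "r = 0")
      case True then show ?thesis by (simp add: Z_def)
    next
      case False
      have "(\<integral>x. Z r x / w r \<partial>M) = (\<integral>x. Z r x \<partial>M) / w r" by simp
      also have "\<dots> \<le> real r * (2 * B * 2^r) / w r"
        by (intro divide_right_mono Zle) (simp add: w_def)
      also have "\<dots> = 2 * B * (real r powr 1 / real r powr (2 + 2*\<epsilon>))"
        using False by (simp add: w_def)
      also have "\<dots> = 2 * B * real r powr (-1 - 2*\<epsilon>)"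
        by (simp only: flip: powr_diff) simp
      finally show ?thesis .
    qed
    show "summable (\<lambda>r. 2 * B * real r powr (-1 - 2*\<epsilon>))"
      using e by (intro summable_mult) (simp add: summable_real_powr_iff)
  qed
  then show ?thesis
  proof eventually_elim
    case (elim x)
    then have "Bseq (\<lambda>r. Z r x / w r)"
      by (intro Cauchy_Bseq LIMSEQ_imp_Cauchy) (rule summable_LIMSEQ_zero)
    then obtain D where D: "D > 0" "\<And>r. \<bar>Z r x / w r\<bar> \<le> D" by (auto elim!: BseqE)
    define C where "C = sqrt (2 * D) * (2 / ln 2) powr (3/2 + \<epsilon>)"
    have "\<bar>\<Sum>i<j. X i x\<bar> \<le> C * (sqrt (real j + 1) * ln (real j + 2) powr (3/2 + \<epsilon>))" for j
    proof -
      obtain r where r: "2 ^ r \<le> Suc j" "Suc j < 2 ^ Suc r"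
        using ex_power_ivl1[of 2 "Suc j"] by auto
      have "j < 2 ^ Suc r" using r by simp
      then have "(\<Sum>i<j. X i x)\<^sup>2 \<le> real (Suc r) * Z (Suc r) x"
        unfolding Z_def by (rule dyadic_partial_sum_bound)
      also have "\<dots> \<le> real (Suc r) * (D * w (Suc r))"
      proof -
        have "w (Suc r) > 0" by (simp add: w_def)
        then have "Z (Suc r) x \<le> D * w (Suc r)" using D(2)[of "Suc r"] by (auto simp: abs_le_iff field_simps)
        then show ?thesis by (intro mult_left_mono) auto
      qed
      also have "\<dots> = D * 2 ^ Suc r * (real (Suc r) powr 1 * real (Suc r) powr (2 + 2*\<epsilon>))"
        by (simp add: w_def)
      also have "\<dots> = D * 2 ^ Suc r * real (Suc r) powr (3 + 2*\<epsilon>)"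
        by (simp only: flip: powr_add) simp
      also have "\<dots> \<le> D * (2 * (real j + 1)) * ((2 / ln 2) * ln (real j + 2)) powr (3 + 2*\<epsilon>)"
      proof (rule mult_mono[OF _ powr_mono2])
        have "(2::real) ^ r \<le> real (Suc j)" using r(1) by (metis of_nat_le_iff of_nat_numeral of_nat_power)
        then show "D * 2 ^ Suc r \<le> D * (2 * (real j + 1))" using D(1) by simp
        have "real (Suc r) * ln 2 = ln ((2::real) ^ Suc r)" by (subst ln_realpow) auto
        also have "\<dots> \<le> ln ((real j + 2)\<^sup>2)"
        proof (rule ln_mono)
          have "(2::real) ^ Suc r \<le> 2 * (real j + 1)" using \<open>(2::real) ^ r \<le> real (Suc j)\<close> by simp
          also have "\<dots> \<le> (real j + 2)\<^sup>2" by (simp add: power2_eq_square algebra_simps)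
          finally show "(2::real) ^ Suc r \<le> (real j + 2)\<^sup>2" .
        qed auto
        also have "\<dots> = 2 * ln (real j + 2)" by (subst ln_realpow) auto
        finally show "real (Suc r) \<le> (2 / ln 2) * ln (real j + 2)" by (simp add: field_simps)
      qed (use D e in auto)
      also have "\<dots> = (C * (sqrt (real j + 1) * ln (real j + 2) powr (3/2 + \<epsilon>)))\<^sup>2"
      proof -
        have "(y powr (3/2 + \<epsilon>))\<^sup>2 = y powr (3 + 2*\<epsilon>)" for y :: real
          by (simp add: power2_eq_square flip: powr_add)
        moreover have "((2 / ln 2) * ln (real j + 2)) powr (3 + 2*\<epsilon>)
            = (2 / ln 2) powr (3 + 2*\<epsilon>) * ln (real j + 2) powr (3 + 2*\<epsilon>)"
          by (rule powr_mult)
        ultimately show ?thesis using D(1)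
          by (simp add: C_def power_mult_distrib)
      qed
      finally have "\<bar>\<Sum>i<j. X i x\<bar> \<le> \<bar>C * (sqrt (real j + 1) * ln (real j + 2) powr (3/2 + \<epsilon>))\<bar>"
        by (simp add: abs_le_square_iff)
      also have "\<dots> = C * (sqrt (real j + 1) * ln (real j + 2) powr (3/2 + \<epsilon>))"
        using D(1) by (auto simp: C_def abs_mult)
      finally show ?thesis .
    qed
    moreover have "C \<ge> 0" using D(1) by (simp add: C_def)
    ultimately show ?case by blast
  qed
qed


text \<open>
  A lemma of Gal-Koksma type in which \<open>a\<close> counts events and \<open>p\<close> is its compensator. The partial sums
  are first controlled at the times \<open>\<nu> j\<close> at which the accumulated weight passes the integer \<open>j\<close>, where
  the variance grows linearly in \<open>j\<close> and the dyadic maximal inequality applies. Between two such times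
  the counts are monotone and the compensator grows by a bounded amount. When the weights are
  summable, the expected number of events is finite and the error is bounded.
\<close>

lemma counting_error_AE:
  fixes a p :: "nat \<Rightarrow> 'a \<Rightarrow> real" and c :: "nat \<Rightarrow> real"
  assumes meas: "\<And>n. a n \<in> borel_measurable M" "\<And>n. p n \<in> borel_measurable M"
    and fin: "finite_measure M"
    and a01: "\<And>n x. 0 \<le> a n x \<and> a n x \<le> 1" and p01: "\<And>n x. 0 \<le> p n x \<and> p n x \<le> 1"
    and c0: "\<And>n. 0 \<le> c n" and cb: "\<And>n. c n \<le> B"
    and pc: "\<And>n x. p n x \<le> D * c n"
    and mean: "\<And>n. (\<integral>x. a n x \<partial>M) \<le> D * c n" "\<And>n. (\<integral>x. p n x \<partial>M) \<le> D * c n"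
    and var: "\<And>l k. l \<le> k \<Longrightarrow> (\<integral>x. (\<Sum>n\<in>{l..<k}. a n x - p n x)\<^sup>2 \<partial>M) \<le> D * (\<Sum>n\<in>{l..<k}. c n)"
    and e: "\<epsilon> > 0"
  shows "AE x in M. \<exists>C\<ge>0. \<forall>N. \<bar>\<Sum>n<N. a n x - p n x\<bar>
     \<le> C * (sqrt (1 + (\<Sum>n<N. c n)) * ln (2 + (\<Sum>n<N. c n)) powr (3/2 + \<epsilon>))"
proof -
  interpret finite_measure M by fact
  note [measurable] = meas
  define F where "F N = (\<Sum>n<N. c n)" for N
  have Fmono: "F i \<le> F j" if "i \<le> j" for i j
    unfolding F_def by (rule sum_mono2) (use that c0 in auto)
  have F0: "0 \<le> F N" for N unfolding F_def by (simp add: sum_nonneg c0)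
  have B0: "0 \<le> B" using c0[of 0] cb[of 0] by simp
  have inta: "integrable M (a n)" for n
    by (rule integrable_const_bound[where B=1]) (use a01[of n] in auto)
  have intp: "integrable M (p n)" for n
    by (rule integrable_const_bound[where B=1]) (use p01[of n] in auto)
  have f1: "\<bar>a n x - p n x\<bar> \<le> 1" for n x using a01[of n x] p01[of n x] by auto
  show ?thesis
  proof (cases "summable c")
    case True
    have "AE x in M. summable (\<lambda>n. a n x)"
      by (rule AE_bounded_of_summable_integral[OF inta _ mean(1)])
         (use a01 True summable_mult in auto)
    moreover have "AE x in M. summable (\<lambda>n. p n x)"
      by (rule AE_bounded_of_summable_integral[OF intp _ mean(2)])
         (use p01 True summable_mult in auto)
    ultimately show ?thesis
    proof eventually_elim
      case (elim x)
      then have "summable (\<lambda>n. a n x + p n x)" by (intro summable_add)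
      define E where "E = (\<Sum>n. a n x + p n x)"
      have le: "\<bar>\<Sum>n<N. a n x - p n x\<bar> \<le> E" for N
      proof -
        have "\<bar>\<Sum>n<N. a n x - p n x\<bar> \<le> (\<Sum>n<N. \<bar>a n x - p n x\<bar>)" by (rule sum_abs)
        also have "\<dots> \<le> (\<Sum>n<N. a n x + p n x)" by (intro sum_mono) (use a01 p01 in \<open>auto simp: abs_le_iff add_nonneg_nonneg\<close>)
        also have "\<dots> \<le> E" unfolding E_def
          by (rule sum_le_suminf) (use a01 p01 \<open>summable (\<lambda>n. a n x + p n x)\<close> in \<open>auto simp: add_nonneg_nonneg\<close>)
        finally show ?thesis .
      qed
      define C where "C = E / ln 2 powr (3/2 + \<epsilon>)"
      have E0: "0 \<le> E" using le[of 0] by simp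
      have "\<bar>\<Sum>n<N. a n x - p n x\<bar> \<le> C * (sqrt (1 + (\<Sum>n<N. c n)) * ln (2 + (\<Sum>n<N. c n)) powr (3/2 + \<epsilon>))" for N
      proof -
        have "E = C * (1 * ln 2 powr (3/2 + \<epsilon>))" by (simp add: C_def)
        also have "\<dots> \<le> C * (sqrt (1 + F N) * ln (2 + F N) powr (3/2 + \<epsilon>))"
          using F0[of N] E0 e by (intro mult_left_mono mult_mono powr_mono2) (auto simp: C_def)
        finally show ?thesis using le[of N] by (simp add: F_def)
      qed
      moreover have "0 \<le> C" using E0 by (simp add: C_def)
      ultimately show ?case by blast
    qed
  next
    case False
    have ex: "\<exists>N. real j \<le> F N" for j
    proof (rule ccontr)
      assume "\<nexists>N. real j \<le> F N"
      then have "\<And>N. F N \<le> real j" by (meson le_cases)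
      then have "summable c" using c0 unfolding F_def
        by (intro bounded_imp_summable[of c "real j"]) (auto simp only: lessThan_Suc_atMost[symmetric])
      with False show False by simp
    qed
    \<comment> \<open>the first time at which the accumulated weight reaches the integer \<open>j\<close>\<close>
    define \<nu> where "\<nu> j = (LEAST N. real j \<le> F N)" for j :: nat
    have \<nu>1: "real j \<le> F (\<nu> j)" for j unfolding \<nu>_def by (rule LeastI_ex[OF ex])
    have \<nu>le: "\<nu> j \<le> N" if "real j \<le> F N" for j N unfolding \<nu>_def using that by (rule Least_le)
    have \<nu>0: "\<nu> 0 = 0" using \<nu>le[of 0 0] F0 by simp
    have \<nu>mono: "\<nu> i \<le> \<nu> j" if "i \<le> j" for i j
      by (rule \<nu>le) (use that \<nu>1[of j] in linarith)
    have \<nu>2: "F (\<nu> j) \<le> real j + B" for j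
    proof (cases "\<nu> j")
      case 0
      then show ?thesis using B0 by (simp add: F_def)
    next
      case (Suc k)
      then have "\<not> real j \<le> F k" using \<nu>le[of j k] by auto
      moreover have "F (\<nu> j) = F k + c k" by (simp add: Suc F_def)
      ultimately show ?thesis using cb[of k] by linarith
    qed
    define X where "X i x = (\<Sum>n\<in>{\<nu> i..<\<nu> (Suc i)}. a n x - p n x)" for i x
    have Xsum: "(\<Sum>i\<in>{l..<k}. X i x) = (\<Sum>n\<in>{\<nu> l..<\<nu> k}. a n x - p n x)" if "l \<le> k" for l k x
      using that
    proof (induction k rule: dec_induct)
      case base
      then show ?case by simp
    next
      case (step k)
      then show ?case
        using sum.atLeastLessThan_concat[of "\<nu> l" "\<nu> k" "\<nu> (Suc k)" "\<lambda>n. a n x - p n x"] \<nu>mono[of l k] \<nu>mono[of k "Suc k"]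
        by (simp add: X_def)
    qed
    have D0: "0 \<le> D"
    proof -
      obtain n where "c n > 0"
        using False c0 by (metis antisym_conv2 summable_zero ext)
      have "0 \<le> (\<integral>x. a n x \<partial>M)" using a01 by (intro Bochner_Integration.integral_nonneg) auto
      then have "0 \<le> D * c n" using mean(1)[of n] by linarith
      then show ?thesis using \<open>c n > 0\<close> by (simp add: zero_le_mult_iff)
    qed
    have "AE x in M. \<exists>C\<ge>0. \<forall>j. \<bar>\<Sum>i<j. X i x\<bar> \<le> C * (sqrt (real j + 1) * ln (real j + 2) powr (3/2 + \<epsilon>))"
    proof (rule dyadic_maximal_AE[where G="\<lambda>j. D * F (\<nu> j)" and B="D * (1 + B)"])
      show "integrable M (\<lambda>x. (\<Sum>i\<in>{l..<k}. X i x)\<^sup>2)" for l k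
      proof (cases "l \<le> k")
        case True
        have "(\<Sum>i\<in>{l..<k}. X i x)\<^sup>2 \<le> real (\<nu> k - \<nu> l)^2" for x
        proof -
          have "\<bar>\<Sum>n\<in>{\<nu> l..<\<nu> k}. a n x - p n x\<bar> \<le> (\<Sum>n\<in>{\<nu> l..<\<nu> k}. \<bar>a n x - p n x\<bar>)" by (rule sum_abs)
          also have "\<dots> \<le> (\<Sum>n\<in>{\<nu> l..<\<nu> k}. 1)" by (intro sum_mono f1)
          finally have "\<bar>\<Sum>n\<in>{\<nu> l..<\<nu> k}. a n x - p n x\<bar> \<le> \<bar>real (\<nu> k - \<nu> l)\<bar>" by simp
          then show ?thesis unfolding Xsum[OF True] by (simp only: abs_le_square_iff)
        qed
        then show ?thesis
          by (intro integrable_const_bound[where B="real (\<nu> k - \<nu> l)^2"]) (auto simp: X_def)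
      qed simp
      show "(\<integral>x. (\<Sum>i\<in>{l..<k}. X i x)\<^sup>2 \<partial>M) \<le> D * F (\<nu> k) - D * F (\<nu> l)" if "l \<le> k" for l k
      proof -
        have "F (\<nu> k) - F (\<nu> l) = (\<Sum>n\<in>{\<nu> l..<\<nu> k}. c n)"
          unfolding F_def lessThan_atLeast0
          using sum.atLeastLessThan_concat[of 0 "\<nu> l" "\<nu> k" c] \<nu>mono[OF that] by simp
        then show ?thesis using var[of "\<nu> l" "\<nu> k"] \<nu>mono[OF that]
          by (simp add: Xsum[OF that] right_diff_distrib[symmetric])
      qed
      show "0 \<le> D * F (\<nu> 0)" by (simp add: \<nu>0 F_def)
      show "D * F (\<nu> j) \<le> D * (1 + B) * (real j + 1)" for j
      proof -
        have "F (\<nu> j) \<le> real j + B" by (rule \<nu>2)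
        also have "\<dots> \<le> (1 + B) * (real j + 1)" using B0 by (simp add: algebra_simps)
        finally show ?thesis using D0 by (simp add: mult_left_mono mult.assoc)
      qed
      show "\<epsilon> > 0" by fact
    qed
    then show ?thesis
    proof eventually_elim
      case (elim x)
      then obtain C where C: "C \<ge> 0" "\<And>j. \<bar>\<Sum>i<j. X i x\<bar> \<le> C * (sqrt (real j + 1) * ln (real j + 2) powr (3/2 + \<epsilon>))"
        by blast
      define A where "A = C * (sqrt 2 * 2 powr (3/2+\<epsilon>))"
      define C' where "C' = A + (D * (1 + B)) / ln 2 powr (3/2+\<epsilon>)"
      have A0: "0 \<le> A" using C(1) by (simp add: A_def)
      have S: "(\<Sum>i<j. X i x) = (\<Sum>n<\<nu> j. a n x - p n x)" for j
        using Xsum[of 0 j x] by (simp add: lessThan_atLeast0 \<nu>0)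
      have "\<bar>\<Sum>n<N. a n x - p n x\<bar> \<le> C' * (sqrt (1 + F N) * ln (2 + F N) powr (3/2 + \<epsilon>))" for N
      proof -
        define j where "j = nat \<lfloor>F N\<rfloor>"
        have j: "real j \<le> F N" "F N < real j + 1" using F0[of N] by (auto simp: j_def) 
        let ?g = "sqrt (1 + F N) * ln (2 + F N) powr (3/2 + \<epsilon>)"
        have bd: "\<bar>\<Sum>n<\<nu> i. a n x - p n x\<bar> \<le> A * ?g" if "i \<le> j + 1" for i
        proof -
          have i: "real i \<le> F N + 1" using that j by linarith
          have l: "ln (real i + 2) \<le> 2 * ln (2 + F N)"
          proof -
            have "real i + 2 \<le> (2 + F N)^2" unfolding power2_sum
              by (rule order_trans[OF _ add_right_mono[OF add_left_mono[OF zero_le_power2]]])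
                 (use i F0[of N] in simp)
            then have "ln (real i + 2) \<le> ln ((2 + F N)^2)" using F0[of N] by (intro ln_mono) auto
            then show ?thesis using F0[of N] by (subst (asm) ln_realpow) auto
          qed
          have "\<bar>\<Sum>n<\<nu> i. a n x - p n x\<bar> \<le> C * (sqrt (real i + 1) * ln (real i + 2) powr (3/2 + \<epsilon>))"
            using C(2)[of i] by (simp add: S)
          also have "\<dots> \<le> C * (sqrt (2 * (1 + F N)) * (2 * ln (2 + F N)) powr (3/2 + \<epsilon>))"
            using i F0[of N] e l C(1) by (intro mult_left_mono mult_mono powr_mono2) auto
          also have "\<dots> = A * ?g"
            unfolding A_def real_sqrt_mult[of 2 "1 + F N"] powr_mult by (simp only: mult_ac)
          finally show ?thesis .
        qed
        have psum: "(\<Sum>n\<in>{l..<k}. p n x) \<le> D * (F k - F l)" if "l \<le> k" for l k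
        proof -
          have "(\<Sum>n\<in>{l..<k}. p n x) \<le> (\<Sum>n\<in>{l..<k}. D * c n)" by (intro sum_mono pc)
          also have "\<dots> = D * (F k - F l)"
            unfolding F_def lessThan_atLeast0
            using sum.atLeastLessThan_concat[of 0 l k c] that by (simp flip: sum_distrib_left)
          finally show ?thesis .
        qed
        have asum: "0 \<le> (\<Sum>n\<in>{l..<k}. a n x)" for l k using a01 by (intro sum_nonneg) auto
        have split: "(\<Sum>n<k. a n x - p n x) = (\<Sum>n<l. a n x - p n x) + (\<Sum>n\<in>{l..<k}. a n x) - (\<Sum>n\<in>{l..<k}. p n x)"
          if "l \<le> k" for l k
          unfolding lessThan_atLeast0
          using sum.atLeastLessThan_concat[of 0 l k "\<lambda>n. a n x - p n x"] that by (simp add: sum_subtractf)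
        have up: "(\<Sum>n<N. a n x - p n x) \<le> A * ?g + D * (1 + B)"
        proof -
          have N: "N \<le> \<nu> (j + 1)"
          proof (rule ccontr)
            assume "\<not> N \<le> \<nu> (j + 1)"
            then have "F (\<nu> (j+1)) \<le> F N" by (intro Fmono) simp
            then show False using \<nu>1[of "j+1"] j by simp
          qed
          have "D * (F (\<nu> (j+1)) - F N) \<le> D * (1 + B)"
            using \<nu>2[of "j+1"] j D0 by (intro mult_left_mono) auto
          then show ?thesis
            using split[OF N] asum[of N "\<nu> (j+1)"] psum[OF N] bd[of "j+1"] by (simp add: abs_le_iff)
        qed
        have lo: "- (A * ?g + D * (1 + B)) \<le> (\<Sum>n<N. a n x - p n x)"
        proof -
          have N: "\<nu> j \<le> N" by (rule \<nu>le) (rule j)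
          have "D * (F N - F (\<nu> j)) \<le> D * (1 + B)"
            using \<nu>1[of j] j D0 B0 by (intro mult_left_mono) auto
          then show ?thesis
            using split[OF N] asum[of "\<nu> j" N] psum[OF N] bd[of j] by (simp add: abs_le_iff)
        qed
        have "D * (1 + B) \<le> (D * (1 + B)) / ln 2 powr (3/2+\<epsilon>) * ?g"
        proof -
          have "D * (1 + B) = (D * (1 + B)) / ln 2 powr (3/2+\<epsilon>) * (1 * ln 2 powr (3/2+\<epsilon>))" by simp
          also have "\<dots> \<le> (D * (1 + B)) / ln 2 powr (3/2+\<epsilon>) * ?g"
            using F0[of N] D0 B0 e by (intro mult_left_mono mult_mono powr_mono2) auto
          finally show ?thesis .
        qed
        then have "A * ?g + D * (1 + B) \<le> C' * ?g"
          by (simp add: C'_def distrib_right)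
        then show ?thesis using up lo by linarith
      qed
      moreover have "0 \<le> C'" using A0 D0 B0 by (simp add: C'_def)
      ultimately show ?case unfolding F_def by blast
    qed
  qed
qed

section \<open>Words, product weights and bounded distortion\<close>

definition words :: "nat \<Rightarrow> nat \<Rightarrow> nat list set" where
  "words m n = {w. length w = n \<and> set w \<subseteq> {1..m}}"

text \<open>
  The head of a word is the outermost map, so that \<open>word_comp \<phi> w ` K\<close> is the cylinder of \<open>w\<close> and letters
  appended on the right refine it.
\<close>

primrec word_comp :: "(nat \<Rightarrow> 'a \<Rightarrow> 'a) \<Rightarrow> nat list \<Rightarrow> 'a \<Rightarrow> 'a" where
  "word_comp \<phi> [] x = x"
| "word_comp \<phi> (j # w) x = \<phi> j (word_comp \<phi> w x)"

text \<open>
  When \<open>p j x\<close> is the probability of the step from \<open>x\<close> to \<open>\<phi> j x\<close>, this is the probability that the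
  chain started in \<open>x\<close> follows the letters of \<open>w\<close> from the last to the first.
\<close>

primrec word_weight :: "(nat \<Rightarrow> 'a \<Rightarrow> real) \<Rightarrow> (nat \<Rightarrow> 'a \<Rightarrow> 'a) \<Rightarrow> nat list \<Rightarrow> 'a \<Rightarrow> real" where
  "word_weight p \<phi> [] x = 1"
| "word_weight p \<phi> (j # w) x = p j (word_comp \<phi> w x) * word_weight p \<phi> w x"

definition branch_op :: "nat \<Rightarrow> (nat \<Rightarrow> 'a \<Rightarrow> 'a) \<Rightarrow> (nat \<Rightarrow> 'a \<Rightarrow> real) \<Rightarrow> ('a \<Rightarrow> real) \<Rightarrow> 'a \<Rightarrow> real" where
  "branch_op m \<phi> p F x = (\<Sum>j=1..m. p j x * F (\<phi> j x))"

lemma words_0 [simp]: "words m 0 = {[]}"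
  by (auto simp: words_def)

lemma finite_words [simp]: "finite (words m n)"
  using finite_lists_length_eq[of "{1..m}" n] by (simp add: words_def conj_commute)

lemma words_Suc: "words m (Suc n) = (\<lambda>(j, w). j # w) ` ({1..m} \<times> words m n)"
  by (force simp: words_def length_Suc_conv image_iff)

lemma sum_words_Suc: "(\<Sum>w\<in>words m (Suc n). f w) = (\<Sum>j=1..m. \<Sum>w\<in>words m n. f (j # w))"
proof -
  have "(\<Sum>w\<in>words m (Suc n). f w) = (\<Sum>(j, w)\<in>{1..m} \<times> words m n. f (j # w))"
    unfolding words_Suc by (subst sum.reindex) (auto simp: inj_on_def case_prod_unfold)
  then show ?thesis by (simp add: sum.cartesian_product)
qed

lemma sum_words_add:
  "(\<Sum>w\<in>words m (a + b). f w) = (\<Sum>v\<in>words m a. \<Sum>w\<in>words m b. f (v @ w))"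
proof (induction a arbitrary: f)
  case 0
  then show ?case by simp
next
  case (Suc a)
  then show ?case by (simp add: sum_words_Suc)
qed

lemma word_comp_append: "word_comp \<phi> (v @ w) x = word_comp \<phi> v (word_comp \<phi> w x)"
  by (induction v) auto

lemma word_weight_append:
  "word_weight p \<phi> (v @ w) x = word_weight p \<phi> v (word_comp \<phi> w x) * word_weight p \<phi> w x"
  by (induction v) (auto simp: word_comp_append)

lemma branch_op_funpow:
  "(branch_op m \<phi> p ^^ n) F x = (\<Sum>w\<in>words m n. word_weight p \<phi> w x * F (word_comp \<phi> w x))"
proof (induction n arbitrary: F)
  case 0
  then show ?case by simp
next
  case (Suc n)
  have "(branch_op m \<phi> p ^^ Suc n) F x = (branch_op m \<phi> p ^^ n) (branch_op m \<phi> p F) x"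
    by (simp add: funpow_swap1)
  also have "\<dots> = (\<Sum>w\<in>words m n. \<Sum>j=1..m. word_weight p \<phi> (j # w) x * F (word_comp \<phi> (j # w) x))"
    by (simp add: Suc branch_op_def sum_distrib_left mult_ac)
  also have "\<dots> = (\<Sum>w\<in>words m (Suc n). word_weight p \<phi> w x * F (word_comp \<phi> w x))"
    unfolding sum_words_Suc by (rule sum.swap)
  finally show ?case .
qed

lemma word_comp_in:
  assumes "\<And>j x. j \<in> {1..m} \<Longrightarrow> x \<in> S \<Longrightarrow> \<phi> j x \<in> S" "w \<in> words m n" "x \<in> S"
  shows "word_comp \<phi> w x \<in> S"
proof -
  have "set w \<subseteq> {1..m}" using assms(2) by (simp add: words_def)
  then show ?thesis by (induction w) (use assms in auto)
qed

lemma word_comp_contraction: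
  fixes \<delta> :: "'a \<Rightarrow> 'a \<Rightarrow> real"
  assumes "\<And>j x. j \<in> {1..m} \<Longrightarrow> x \<in> S \<Longrightarrow> \<phi> j x \<in> S"
    and contr: "\<And>j x y. j \<in> {1..m} \<Longrightarrow> x \<in> S \<Longrightarrow> y \<in> S \<Longrightarrow> \<delta> (\<phi> j x) (\<phi> j y) \<le> \<beta> * \<delta> x y"
    and \<beta>: "0 \<le> \<beta>" and w: "w \<in> words m n" and x: "x \<in> S" and y: "y \<in> S"
  shows "\<delta> (word_comp \<phi> w x) (word_comp \<phi> w y) \<le> \<beta> ^ n * \<delta> x y"
  using w
proof (induction n arbitrary: w)
  case 0
  then show ?case by simp
next
  case (Suc n)
  then obtain j v where w: "w = j # v" "j \<in> {1..m}" "v \<in> words m n"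
    by (auto simp: words_Suc)
  have "\<delta> (word_comp \<phi> w x) (word_comp \<phi> w y) \<le> \<beta> * \<delta> (word_comp \<phi> v x) (word_comp \<phi> v y)"
    using w word_comp_in[where S=S and m=m and \<phi>=\<phi>, OF assms(1) w(3)] x y by (auto intro!: contr)
  also have "\<dots> \<le> \<beta> * (\<beta> ^ n * \<delta> x y)" using Suc.IH[OF w(3)] \<beta> by (rule mult_left_mono)
  finally show ?case by simp
qed

lemma word_weight_pos:
  assumes "\<And>j x. j \<in> {1..m} \<Longrightarrow> x \<in> S \<Longrightarrow> \<phi> j x \<in> S"
    and "\<And>j x. j \<in> {1..m} \<Longrightarrow> x \<in> S \<Longrightarrow> 0 < p j x" and w: "w \<in> words m n" and x: "x \<in> S"
  shows "0 < word_weight p \<phi> w x"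
  using w
proof (induction n arbitrary: w)
  case (Suc n)
  then obtain j v where "w = j # v" "j \<in> {1..m}" "v \<in> words m n"
    by (auto simp: words_Suc)
  then show ?case using Suc.IH[of v] word_comp_in[where S=S and m=m and \<phi>=\<phi> and w=v and n=n and x=x, OF assms(1)] x assms(2) by simp
qed simp

text \<open>
  The logarithm of a product weight along an orbit is a sum of logarithms at points whose distances
  form a geometric progression, so its oscillation is bounded independently of the length.
\<close>

lemma bounded_distortion:
  fixes \<delta> :: "'a \<Rightarrow> 'a \<Rightarrow> real"
  assumes inv: "\<And>j x. j \<in> {1..m} \<Longrightarrow> x \<in> S \<Longrightarrow> \<phi> j x \<in> S"
    and contr: "\<And>j x y. j \<in> {1..m} \<Longrightarrow> x \<in> S \<Longrightarrow> y \<in> S \<Longrightarrow> \<delta> (\<phi> j x) (\<phi> j y) \<le> \<beta> * \<delta> x y"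
    and \<delta>0: "\<And>x y. 0 \<le> \<delta> x y"
    and \<beta>: "0 \<le> \<beta>" "\<beta> < 1" and H: "0 \<le> H"
    and pos: "\<And>j x. j \<in> {1..m} \<Longrightarrow> x \<in> S \<Longrightarrow> 0 < p j x"
    and dist: "\<And>j x y. j \<in> {1..m} \<Longrightarrow> x \<in> S \<Longrightarrow> y \<in> S \<Longrightarrow> p j x \<le> p j y * exp (H * \<delta> x y)"
    and w: "w \<in> words m n" and x: "x \<in> S" and y: "y \<in> S"
  shows "word_weight p \<phi> w x \<le> word_weight p \<phi> w y * exp (H / (1 - \<beta>) * \<delta> x y)"
proof -
  have "word_weight p \<phi> w x \<le> word_weight p \<phi> w y * exp (H * (\<Sum>i<n. \<beta>^i) * \<delta> x y)"
    using w
  proof (induction n arbitrary: w)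
    case 0
    then show ?case by simp
  next
    case (Suc n)
    then obtain j v where w: "w = j # v" "j \<in> {1..m}" "v \<in> words m n"
      by (auto simp: words_Suc)
    let ?x = "word_comp \<phi> v x" and ?y = "word_comp \<phi> v y"
    have K: "?x \<in> S" "?y \<in> S" using word_comp_in[where S=S and m=m and \<phi>=\<phi>, OF inv w(3)] x y by auto
    have "p j ?x \<le> p j ?y * exp (H * \<delta> ?x ?y)" by (rule dist) (use w K in auto)
    also have "\<dots> \<le> p j ?y * exp (H * (\<beta>^n * \<delta> x y))"
      using word_comp_contraction[where S=S and m=m and \<phi>=\<phi> and \<delta>=\<delta> and \<beta>=\<beta>, OF inv contr \<beta>(1) w(3) x y] pos[OF w(2) K(2)] H
      by (auto intro!: mult_left_mono)
    finally have 1: "p j ?x \<le> p j ?y * exp (H * (\<beta>^n * \<delta> x y))" .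
    have "word_weight p \<phi> w x \<le> (p j ?y * exp (H * (\<beta>^n * \<delta> x y))) *
        (word_weight p \<phi> v y * exp (H * (\<Sum>i<n. \<beta>^i) * \<delta> x y))"
      unfolding w(1) word_weight.simps
      using 1 Suc.IH[OF w(3)] pos[OF w(2) K(2)] word_weight_pos[where S=S and m=m and \<phi>=\<phi> and p=p, OF inv pos w(3) x]
      by (intro mult_mono) auto
    also have "\<dots> = word_weight p \<phi> w y * exp (H * (\<Sum>i<Suc n. \<beta>^i) * \<delta> x y)"
      by (simp add: w(1) algebra_simps exp_add)
    finally show ?case .
  qed
  also have "\<dots> \<le> word_weight p \<phi> w y * exp (H / (1 - \<beta>) * \<delta> x y)"
  proof -
    have "(\<Sum>i<n. \<beta>^i) \<le> 1 / (1 - \<beta>)"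
      using \<beta> by (simp add: sum_gp_strict divide_right_mono)
    then have "H * (\<Sum>i<n. \<beta>^i) * \<delta> x y \<le> H * (1 / (1 - \<beta>)) * \<delta> x y"
      using H \<delta>0 by (intro mult_right_mono mult_left_mono)
    then show ?thesis using word_weight_pos[where S=S and m=m and \<phi>=\<phi> and p=p, OF inv pos w y] by simp
  qed
  finally show ?thesis .
qed

text \<open>
  The function \<open>\<delta>\<close> stands for a power of the distance: Hoelder continuity becomes Lipschitz continuity
  with respect to \<open>\<delta>\<close>, and the exponent disappears from the estimates.
\<close>

locale contracting_chain =
  fixes m :: nat and \<phi> :: "nat \<Rightarrow> 'a \<Rightarrow> 'a" and p :: "nat \<Rightarrow> 'a \<Rightarrow> real" and K :: "'a set"
    and \<delta> :: "'a \<Rightarrow> 'a \<Rightarrow> real" and \<beta> H \<Delta> :: real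
  assumes K_ne: "K \<noteq> {}"
    and inv: "\<And>j x. j \<in> {1..m} \<Longrightarrow> x \<in> K \<Longrightarrow> \<phi> j x \<in> K"
    and \<delta>_contr: "\<And>j x y. j \<in> {1..m} \<Longrightarrow> x \<in> K \<Longrightarrow> y \<in> K \<Longrightarrow> \<delta> (\<phi> j x) (\<phi> j y) \<le> \<beta> * \<delta> x y"
    and \<delta>_nonneg: "\<And>x y. 0 \<le> \<delta> x y"
    and \<delta>_le: "\<And>x y. x \<in> K \<Longrightarrow> y \<in> K \<Longrightarrow> \<delta> x y \<le> \<Delta>"
    and \<beta>: "0 < \<beta>" "\<beta> < 1" and H: "0 \<le> H"
    and p_pos: "\<And>j x. j \<in> {1..m} \<Longrightarrow> x \<in> K \<Longrightarrow> 0 < p j x"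
    and p_sum: "\<And>x. x \<in> K \<Longrightarrow> (\<Sum>j=1..m. p j x) = 1"
    and p_distort: "\<And>j x y. j \<in> {1..m} \<Longrightarrow> x \<in> K \<Longrightarrow> y \<in> K \<Longrightarrow> p j x \<le> p j y * exp (H * \<delta> x y)"
begin

abbreviation "W \<equiv> words m"
abbreviation "cmp \<equiv> word_comp \<phi>"
abbreviation "wt \<equiv> word_weight p \<phi>"
abbreviation "P \<equiv> branch_op m \<phi> p"

text \<open>
  Weights of words at two points differ at most by the factor \<open>exp (A * \<delta> x y) \<le> E\<close>. The constant
  \<open>M\<close> scales the Lipschitz constant against the oscillation; it is large enough for both to contract
  under iteration.
\<close>

definition "A = H / (1 - \<beta>)"
definition "E = exp (A * \<Delta>)"
definition "M = 2 * A * E + 1"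

lemma A_nonneg: "0 \<le> A" using H \<beta> by (simp add: A_def)

lemma Delta_nonneg: "0 \<le> \<Delta>"
  using K_ne \<delta>_le \<delta>_nonneg by (meson ex_in_conv order_trans)

lemma E_ge_1: "1 \<le> E" using A_nonneg Delta_nonneg by (simp add: E_def)

lemma M_pos: "0 < M" using A_nonneg E_ge_1 by (simp add: M_def add_nonneg_pos)

lemma cmp_in: "w \<in> W n \<Longrightarrow> x \<in> K \<Longrightarrow> cmp w x \<in> K"
  by (rule word_comp_in[where S=K and m=m]) (use inv in auto)

lemma wt_pos: "w \<in> W n \<Longrightarrow> x \<in> K \<Longrightarrow> 0 < wt w x"
  by (rule word_weight_pos[where S=K and m=m]) (use inv p_pos in auto)

lemma wt_distort:
  assumes "w \<in> W n" "x \<in> K" "y \<in> K"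
  shows "wt w x \<le> wt w y * exp (A * \<delta> x y)"
  unfolding A_def
  by (rule bounded_distortion[where S=K and m=m and n=n and \<phi>=\<phi> and \<delta>=\<delta> and \<beta>=\<beta> and p=p and H=H, OF inv \<delta>_contr \<delta>_nonneg _ _ H p_pos p_distort])
     (use assms \<beta> in auto)

lemma wt_le:
  assumes "w \<in> W n" "x \<in> K" "y \<in> K"
  shows "wt w x \<le> E * wt w y"
proof -
  have "wt w y * exp (A * \<delta> x y) \<le> wt w y * E"
    using assms wt_pos[of w n y] A_nonneg \<delta>_le[of x y]
    by (auto simp: E_def intro!: mult_left_mono)
  then show ?thesis using wt_distort[OF assms] by (simp add: mult.commute)
qed

lemma wt_sum:
  assumes "x \<in> K"
  shows "(\<Sum>w\<in>W n. wt w x) = 1"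
proof (induction n)
  case 0
  then show ?case by simp
next
  case (Suc n)
  have "(\<Sum>w\<in>W (Suc n). wt w x) = (\<Sum>w\<in>W n. (\<Sum>j=1..m. p j (cmp w x)) * wt w x)"
    unfolding sum_words_Suc sum_distrib_right by (subst sum.swap) simp
  also have "\<dots> = (\<Sum>w\<in>W n. wt w x)"
    by (intro sum.cong) (use assms cmp_in p_sum in auto)
  finally show ?case using Suc by simp
qed

definition regular :: "real \<Rightarrow> real \<Rightarrow> ('a \<Rightarrow> real) \<Rightarrow> bool" where
  "regular a b F \<longleftrightarrow> (\<forall>x\<in>K. \<forall>y\<in>K. F x - F y \<le> a \<and> F x - F y \<le> b * \<delta> x y)"

lemma regularI:
  "(\<And>x y. x \<in> K \<Longrightarrow> y \<in> K \<Longrightarrow> F x - F y \<le> a) \<Longrightarrow>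
   (\<And>x y. x \<in> K \<Longrightarrow> y \<in> K \<Longrightarrow> F x - F y \<le> b * \<delta> x y) \<Longrightarrow> regular a b F"
  by (simp add: regular_def)

lemma regularD:
  assumes "regular a b F" "x \<in> K" "y \<in> K"
  shows "F x - F y \<le> a" "F x - F y \<le> b * \<delta> x y"
  using assms by (auto simp: regular_def)

lemma regular_nonneg: "regular a b F \<Longrightarrow> 0 \<le> a"
  using K_ne by (fastforce simp: regular_def)

lemma oscillation_lower:
  assumes "\<And>x y. x \<in> K \<Longrightarrow> y \<in> K \<Longrightarrow> F x - F y \<le> a"
  obtains S :: real where "\<And>x. x \<in> K \<Longrightarrow> S \<le> F x" "\<And>x. x \<in> K \<Longrightarrow> F x \<le> S + a"
proof
  obtain x0 where x0: "x0 \<in> K" using K_ne by auto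
  have bdd: "bdd_below (F ` K)"
    by (rule bdd_belowI2[where m="F x0 - a"]) (use assms[OF x0] in force)
  show "Inf (F ` K) \<le> F x" if "x \<in> K" for x by (rule cINF_lower[OF bdd that])
  show "F x \<le> Inf (F ` K) + a" if "x \<in> K" for x
  proof -
    have "F x - a \<le> Inf (F ` K)"
      by (rule cINF_greatest[OF K_ne]) (use assms[OF that] in force)
    then show ?thesis by simp
  qed
qed

text \<open>
  The distributions of the chain after \<open>k\<close> steps from \<open>x\<close> and from \<open>y\<close> have a common part of mass at
  least \<open>1 / E\<close>, namely the minimum of the two weights of each word. On the common part the end points
  are only \<open>\<beta> ^ k * \<delta> x y\<close> apart; the remaining mass sees the full oscillation.
\<close>

lemma branch_op_oscillation:
  assumes F: "regular a b F" and b: "0 \<le> b" and x: "x \<in> K" and y: "y \<in> K"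
  shows "(P ^^ k) F x - (P ^^ k) F y \<le> (1 - 1 / E) * a + b * \<beta>^k * \<Delta>"
    and "(P ^^ k) F x - (P ^^ k) F y \<le> (A * E * a + b * \<beta>^k) * \<delta> x y"
    and "(P ^^ k) F x - (P ^^ k) F y \<le> a"
proof -
  obtain S where S: "\<And>x. x \<in> K \<Longrightarrow> S \<le> F x" "\<And>x. x \<in> K \<Longrightarrow> F x \<le> S + a"
    using oscillation_lower[of F a] regularD(1)[OF F] by metis
  have a0: "0 \<le> a" using F by (rule regular_nonneg)
  have E0: "0 < E" using E_ge_1 by simp
  have dF: "F (cmp w x) - F (cmp w y) \<le> b * (\<beta>^k * \<delta> x y)" if w: "w \<in> W k" for w
  proof -
    have "F (cmp w x) - F (cmp w y) \<le> b * \<delta> (cmp w x) (cmp w y)"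
      by (rule regularD(2)[OF F]) (use cmp_in w x y in auto)
    also have "\<dots> \<le> b * (\<beta>^k * \<delta> x y)"
      by (intro mult_left_mono b word_comp_contraction[where S=K and m=m and \<phi>=\<phi> and \<delta>=\<delta> and \<beta>=\<beta>, OF inv \<delta>_contr _ w x y]) (use \<beta> in auto)
    finally show ?thesis .
  qed
  have PF: "(P ^^ k) F z = S + (\<Sum>w\<in>W k. wt w z * (F (cmp w z) - S))" if "z \<in> K" for z
    unfolding branch_op_funpow right_diff_distrib sum_subtractf sum_distrib_right[symmetric]
    by (simp add: wt_sum[OF that])
  have g: "0 \<le> F (cmp w z) - S \<and> F (cmp w z) - S \<le> a" if "w \<in> W k" "z \<in> K" for w z
    using S cmp_in[OF that(1,2)] by force
  show "(P ^^ k) F x - (P ^^ k) F y \<le> a"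
  proof -
    have "(\<Sum>w\<in>W k. wt w x * (F (cmp w x) - S)) \<le> (\<Sum>w\<in>W k. wt w x * a)"
      using g x wt_pos[OF _ x, of _ k] by (intro sum_mono mult_left_mono) (auto intro: less_imp_le)
    also have "\<dots> = a" by (simp add: wt_sum[OF x] flip: sum_distrib_right)
    finally have 1: "(\<Sum>w\<in>W k. wt w x * (F (cmp w x) - S)) \<le> a" .
    have "0 \<le> (\<Sum>w\<in>W k. wt w y * (F (cmp w y) - S))"
      using g y wt_pos[OF _ y, of _ k] by (intro sum_nonneg mult_nonneg_nonneg) (auto intro: less_imp_le)
    then show ?thesis using 1 PF[OF x] PF[OF y] by linarith
  qed
  show "(P ^^ k) F x - (P ^^ k) F y \<le> (1 - 1 / E) * a + b * \<beta>^k * \<Delta>"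
  proof -
    define n where "n w = min (wt w x) (wt w y)" for w
    have n1: "n w \<ge> 0" "n w \<le> wt w x" "n w \<le> wt w y" "n w \<ge> wt w x / E" if w: "w \<in> W k" for w
      using wt_pos[OF w x] wt_pos[OF w y] wt_le[OF w x y] wt_le[OF w x x] E0 E_ge_1
      by (auto simp: n_def field_simps)
    have ns: "(\<Sum>w\<in>W k. n w) \<ge> 1 / E"
    proof -
      have "(\<Sum>w\<in>W k. wt w x / E) \<le> (\<Sum>w\<in>W k. n w)" using n1 by (intro sum_mono)
      then show ?thesis by (simp add: wt_sum[OF x] flip: sum_divide_distrib)
    qed
    have ns1: "(\<Sum>w\<in>W k. n w) \<le> 1"
      using sum_mono[of "W k" n "\<lambda>w. wt w x"] n1 wt_sum[OF x] by simp
    have "(P ^^ k) F x - (P ^^ k) F y = (\<Sum>w\<in>W k. (wt w x - n w) * (F (cmp w x) - S))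
        - (\<Sum>w\<in>W k. (wt w y - n w) * (F (cmp w y) - S)) + (\<Sum>w\<in>W k. n w * (F (cmp w x) - F (cmp w y)))"
      unfolding PF[OF x] PF[OF y] by (simp add: algebra_simps sum.distrib sum_subtractf)
    also have "\<dots> \<le> (\<Sum>w\<in>W k. (wt w x - n w) * a) - 0 + (\<Sum>w\<in>W k. n w * (b * (\<beta>^k * \<Delta>)))"
    proof (intro add_mono diff_mono sum_mono mult_left_mono sum_nonneg mult_nonneg_nonneg)
      fix w assume w: "w \<in> W k"
      have "b * (\<beta>^k * \<delta> x y) \<le> b * (\<beta>^k * \<Delta>)"
        using \<delta>_le[OF x y] b \<beta> by (intro mult_left_mono) auto
      then show "F (cmp w x) - F (cmp w y) \<le> b * (\<beta>^k * \<Delta>)" using dF[OF w] by linarith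
    qed (use n1 g x y in auto)
    also have "\<dots> = (1 - (\<Sum>w\<in>W k. n w)) * a + (\<Sum>w\<in>W k. n w) * (b * \<beta>^k * \<Delta>)"
      by (simp add: left_diff_distrib sum_subtractf wt_sum[OF x] mult.assoc flip: sum_distrib_right)
    also have "\<dots> \<le> (1 - 1 / E) * a + 1 * (b * \<beta>^k * \<Delta>)"
      using ns ns1 a0 b \<beta> Delta_nonneg by (intro add_mono mult_right_mono) auto
    finally show ?thesis by simp
  qed
  show "(P ^^ k) F x - (P ^^ k) F y \<le> (A * E * a + b * \<beta>^k) * \<delta> x y"
  proof -
    have "(P ^^ k) F x - (P ^^ k) F y = (\<Sum>w\<in>W k. (wt w x - wt w y) * (F (cmp w x) - S))
        + (\<Sum>w\<in>W k. wt w y * (F (cmp w x) - F (cmp w y)))"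
      unfolding PF[OF x] PF[OF y] by (simp add: algebra_simps sum.distrib sum_subtractf)
    also have "\<dots> \<le> (\<Sum>w\<in>W k. wt w y * (A * E * \<delta> x y * a)) + (\<Sum>w\<in>W k. wt w y * (b * (\<beta>^k * \<delta> x y)))"
    proof (intro add_mono sum_mono mult_left_mono)
      fix w assume w: "w \<in> W k"
      have ex: "exp (A * \<delta> x y) - 1 \<le> A * E * \<delta> x y"
      proof -
        have "1 - A * \<delta> x y \<le> exp (- (A * \<delta> x y))" using exp_ge_add_one_self[of "- (A * \<delta> x y)"] by simp
        then have "(1 - A * \<delta> x y) * exp (A * \<delta> x y) \<le> 1"
          by (simp add: exp_minus divide_simps)
        then have "exp (A * \<delta> x y) - 1 \<le> A * \<delta> x y * exp (A * \<delta> x y)" by (simp add: algebra_simps)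
        also have "\<dots> \<le> A * \<delta> x y * E"
          unfolding E_def using \<delta>_le[OF x y] A_nonneg \<delta>_nonneg[of x y] by (intro mult_left_mono) (auto intro: mult_left_mono)
        finally show ?thesis by (simp add: mult_ac)
      qed
      have "wt w x - wt w y \<le> wt w y * (exp (A * \<delta> x y) - 1)"
        using wt_distort[OF w x y] by (simp add: algebra_simps)
      also have "\<dots> \<le> wt w y * (A * E * \<delta> x y)" using ex wt_pos[OF w y] by (intro mult_left_mono) auto
      finally have d: "wt w x - wt w y \<le> wt w y * (A * E * \<delta> x y)" .
      have "(wt w x - wt w y) * (F (cmp w x) - S) \<le> (wt w y * (A * E * \<delta> x y)) * (F (cmp w x) - S)"
        by (rule mult_right_mono[OF d]) (use g[OF w x] in simp)
      also have "\<dots> \<le> (wt w y * (A * E * \<delta> x y)) * a"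
        using g[OF w x] wt_pos[OF w y] A_nonneg E0 \<delta>_nonneg by (intro mult_left_mono) auto
      finally show "(wt w x - wt w y) * (F (cmp w x) - S) \<le> wt w y * (A * E * \<delta> x y * a)"
        by (simp add: mult_ac)
      show "F (cmp w x) - F (cmp w y) \<le> b * (\<beta>^k * \<delta> x y)" by (rule dF[OF w])
      show "0 \<le> wt w y" using wt_pos[OF w y] by simp
    qed
    also have "\<dots> = (A * E * a + b * \<beta>^k) * \<delta> x y"
      unfolding sum_distrib_right[symmetric] wt_sum[OF y] by (simp add: algebra_simps)
    finally show ?thesis .
  qed
qed

text \<open>
  The oscillation contracts by the common mass \<open>1 / E\<close> and the Lipschitz constant by \<open>\<beta> ^ k\<close>, each at
  the price of a multiple of the other; the weight \<open>M\<close> and a large \<open>k\<close> balance these terms.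
\<close>

lemma regular_contraction:
  obtains k \<kappa> where "0 < k" "0 < \<kappa>" "\<kappa> < 1"
    "\<And>F a. regular a (M * a) F \<Longrightarrow> regular (\<kappa> * a) (M * (\<kappa> * a)) ((P ^^ k) F)"
proof -
  have E0: "0 < E" using E_ge_1 by simp
  have "(\<lambda>k. \<beta> ^ k) \<longlonglongrightarrow> 0" using \<beta> by (intro LIMSEQ_realpow_zero) auto
  moreover define e where "e = min (1/4) (1 / (2 * E * M * (\<Delta> + 1)))"
  moreover have "e > 0" using E0 M_pos Delta_nonneg by (simp add: e_def)
  ultimately have "eventually (\<lambda>k. \<beta> ^ k < e) sequentially" by (intro order_tendstoD) auto
  then obtain k0 where k0: "\<And>k. k \<ge> k0 \<Longrightarrow> \<beta> ^ k < e" by (auto simp: eventually_sequentially)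
  define k where "k = Suc k0"
  have k: "\<beta> ^ k < e" using k0[of k] by (simp add: k_def)
  define \<kappa> where "\<kappa> = max (3/4) (1 - 1 / (2 * E))"
  show ?thesis
  proof (rule that[of k \<kappa>])
    show "0 < k" by (simp add: k_def)
    show "0 < \<kappa>" "\<kappa> < 1" using E0 by (auto simp: \<kappa>_def)
    fix F a assume F: "regular a (M * a) F"
    have a0: "0 \<le> a" using F by (rule regular_nonneg)
    have Ma: "0 \<le> M * a" using a0 M_pos by simp
    show "regular (\<kappa> * a) (M * (\<kappa> * a)) ((P ^^ k) F)"
    proof (rule regularI)
      fix x y assume x: "x \<in> K" and y: "y \<in> K"
      note B = branch_op_oscillation[OF F Ma x y, of k]
      have "M * \<beta>^k * \<Delta> \<le> M * (1 / (2 * E * M * (\<Delta> + 1))) * (\<Delta> + 1)"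
        using k M_pos Delta_nonneg \<beta> E0 by (intro mult_mono) (auto simp: e_def)
      also have "\<dots> = 1 / (2 * E)" using E0 M_pos Delta_nonneg by simp
      finally have 1: "M * \<beta>^k * \<Delta> \<le> 1 / (2 * E)" .
      have "(P ^^ k) F x - (P ^^ k) F y \<le> (1 - 1 / E + M * \<beta>^k * \<Delta>) * a"
        using B(1) by (simp add: algebra_simps)
      also have "\<dots> \<le> \<kappa> * a"
      proof (rule mult_right_mono[OF _ a0])
        have "1 - 1 / E + 1 / (2 * E) = 1 - 1 / (2 * E)" using E0 by (simp add: field_simps)
        then show "1 - 1 / E + M * \<beta>^k * \<Delta> \<le> \<kappa>" using 1 by (simp add: \<kappa>_def)
      qed
      finally show "(P ^^ k) F x - (P ^^ k) F y \<le> \<kappa> * a" .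
      have "(A * E * a + M * a * \<beta>^k) * \<delta> x y = (A * E + M * \<beta>^k) * a * \<delta> x y"
        by (simp add: algebra_simps)
      also have "\<dots> \<le> (M * \<kappa>) * a * \<delta> x y"
      proof (intro mult_right_mono a0 \<delta>_nonneg)
        have "M * \<beta>^k \<le> M * (1/4)" using k M_pos by (intro mult_left_mono) (auto simp: e_def)
        moreover have "A * E \<le> M * (1/2)" by (simp add: M_def)
        moreover have "M * (3/4) \<le> M * \<kappa>"
          using M_pos by (intro mult_left_mono) (auto simp: \<kappa>_def)
        ultimately show "A * E + M * \<beta>^k \<le> M * \<kappa>" by simp
      qed
      finally show "(P ^^ k) F x - (P ^^ k) F y \<le> M * (\<kappa> * a) * \<delta> x y"
        using B(2) by (simp add: mult.assoc)
    qed
  qed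
qed

lemma exponential_contraction:
  obtains C \<gamma> where "0 < C" "0 < \<gamma>" "\<gamma> < 1"
    "\<And>F a l x y. regular a (M * a) F \<Longrightarrow> x \<in> K \<Longrightarrow> y \<in> K \<Longrightarrow>
       (P ^^ l) F x - (P ^^ l) F y \<le> C * \<gamma> ^ l * a"
proof -
  obtain k \<kappa> where k: "0 < k" and \<kappa>: "0 < \<kappa>" "\<kappa> < 1"
    and contr: "\<And>F a. regular a (M * a) F \<Longrightarrow> regular (\<kappa> * a) (M * (\<kappa> * a)) ((P ^^ k) F)"
    using regular_contraction by blast
  define \<gamma> where "\<gamma> = root k \<kappa>"
  have \<gamma>: "0 < \<gamma>" "\<gamma> < 1" "\<gamma> ^ k = \<kappa>" using k \<kappa> by (auto simp: \<gamma>_def)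
  show ?thesis
  proof (rule that[of "1 / \<kappa>" \<gamma>])
    fix F a l x y assume F: "regular a (M * a) F" and x: "x \<in> K" and y: "y \<in> K"
    have a0: "0 \<le> a" using F by (rule regular_nonneg)
    define i r where "i = l div k" and "r = l mod k"
    have l: "l = r + k * i" by (simp add: i_def r_def)
    have it: "regular (\<kappa>^i * a) (M * (\<kappa>^i * a)) (((P ^^ k) ^^ i) F)" for i
    proof (induction i)
      case 0 then show ?case using F by simp
    next
      case (Suc i)
      from contr[OF this] show ?case by (simp add: mult.assoc)
    qed
    have "(P ^^ l) F = (P ^^ r) (((P ^^ k) ^^ i) F)"
      unfolding l funpow_add funpow_mult by simp
    then have "(P ^^ l) F x - (P ^^ l) F y \<le> \<kappa>^i * a"
      using branch_op_oscillation(3)[OF it _ x y, of i r] M_pos a0 \<kappa> by simp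
    also have "\<dots> \<le> (1 / \<kappa> * \<gamma>^l) * a"
    proof (rule mult_right_mono[OF _ a0])
      have "\<kappa> \<le> \<gamma>^r"
      proof -
        have "\<gamma>^k \<le> \<gamma>^r" using \<gamma> k by (intro power_decreasing) (auto simp: r_def less_imp_le)
        then show ?thesis by (simp add: \<gamma>)
      qed
      moreover have "\<gamma>^l = \<gamma>^r * \<kappa>^i" unfolding l power_add power_mult \<gamma>(3) ..
      ultimately have "\<kappa> * \<kappa>^i \<le> \<gamma>^l" using \<kappa> by (simp add: mult_right_mono)
      then show "\<kappa>^i \<le> 1 / \<kappa> * \<gamma>^l" using \<kappa> by (simp add: field_simps)
    qed
    finally show "(P ^^ l) F x - (P ^^ l) F y \<le> 1 / \<kappa> * \<gamma>^l * a" .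
  qed (use \<gamma> \<kappa> in auto)
qed

lemma wt_regular:
  assumes w: "w \<in> W n" and q: "\<And>x. x \<in> K \<Longrightarrow> wt w x \<le> Q"
  shows "regular Q (M * Q) (wt w)"
proof -
  obtain x0 where "x0 \<in> K" using K_ne by auto
  then have Q0: "0 \<le> Q" using q wt_pos[OF w] by (meson less_imp_le order_trans)
  show ?thesis
  proof (rule regularI)
    fix x y assume x: "x \<in> K" and y: "y \<in> K"
    show "wt w x - wt w y \<le> Q" using q[OF x] wt_pos[OF w y] by linarith
    have "1 - A * \<delta> x y \<le> exp (- (A * \<delta> x y))" using exp_ge_add_one_self[of "- (A * \<delta> x y)"] by simp
    moreover have "wt w x * exp (- (A * \<delta> x y)) \<le> wt w y"
      using wt_distort[OF w x y] by (simp add: exp_minus divide_simps)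
    ultimately have "wt w x * (1 - A * \<delta> x y) \<le> wt w y"
      using wt_pos[OF w x] by (meson less_imp_le mult_left_mono order_trans)
    then have "wt w x - wt w y \<le> A * wt w x * \<delta> x y" by (simp add: algebra_simps)
    also have "\<dots> \<le> M * Q * \<delta> x y"
    proof (intro mult_right_mono mult_mono \<delta>_nonneg q x Q0)
      have "A \<le> A * E" using mult_left_mono[OF E_ge_1 A_nonneg] by simp
      moreover have "0 \<le> A * E" using A_nonneg E_ge_1 by simp
      ultimately show "A \<le> M" by (simp add: M_def)
    qed (use M_pos wt_pos[OF w x] in \<open>auto intro: less_imp_le\<close>)
    finally show "wt w x - wt w y \<le> M * Q * \<delta> x y" .
  qed
qed

end

section \<open>Decay of correlations for a Markov chain of contractions\<close>

lemma power_diff_le: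
  fixes x y :: real
  assumes "0 \<le> y" "y \<le> x" "1 \<le> d"
  shows "x ^ d - y ^ d \<le> real d * x ^ (d - 1) * (x - y)"
proof -
  obtain k where d: "d = Suc k" using assms(3) by (cases d) auto
  have "x ^ d - y ^ d = (x - y) * (\<Sum>i<d. y^(d - Suc i) * x^i)"
    by (rule power_diff_sumr2)
  also have "\<dots> \<le> (x - y) * (\<Sum>i<d. x ^ (d - 1))"
  proof (intro mult_left_mono sum_mono)
    fix i assume "i \<in> {..<d}"
    then have "d - 1 = (d - Suc i) + i" by auto
    then have "x ^ (d - 1) = x ^ (d - Suc i) * x ^ i" by (simp flip: power_add)
    then show "y ^ (d - Suc i) * x ^ i \<le> x ^ (d - 1)"
      using assms by (simp add: mult_right_mono power_mono)
  qed (use assms in auto)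
  finally show ?thesis by (simp add: mult_ac)
qed

text \<open>
  A stationary probability measure for the chain, and a map \<open>T\<close> that inverts every branch almost
  everywhere. The last assumption says that spherical shells are at most as heavy as for a multiple
  of \<open>d\<close>-dimensional Lebesgue measure.
\<close>

locale measured_chain = contracting_chain m \<phi> p K \<delta> \<beta> H \<Delta> + prob_space \<mu>
  for m :: nat and \<phi> :: "nat \<Rightarrow> 'a \<Rightarrow> 'a::{metric_space, second_countable_topology}"
    and p :: "nat \<Rightarrow> 'a \<Rightarrow> real" and K :: "'a set"
    and \<delta> :: "'a \<Rightarrow> 'a \<Rightarrow> real" and \<beta> H \<Delta> :: real and \<mu> :: "'a measure" +
  fixes T :: "'a \<Rightarrow> 'a" and \<rho> D Cb :: real and d :: nat
  assumes sets_mu [measurable_cong]: "sets \<mu> = sets borel"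
    and AE_K: "AE x in \<mu>. x \<in> K"
    and phi_meas: "\<And>j. j \<in> {1..m} \<Longrightarrow> \<phi> j \<in> borel_measurable borel"
    and p_meas: "\<And>j. j \<in> {1..m} \<Longrightarrow> p j \<in> borel_measurable borel"
    and stationary: "\<And>F B. F \<in> borel_measurable borel \<Longrightarrow> (\<And>x. x \<in> K \<Longrightarrow> \<bar>F x\<bar> \<le> B) \<Longrightarrow>
           (\<integral>x. F x \<partial>\<mu>) = (\<Sum>j=1..m. \<integral>x. p j x * F (\<phi> j x) \<partial>\<mu>)"
    and T_meas [measurable]: "T \<in> borel_measurable borel"
    and T_branch: "\<And>j. j \<in> {1..m} \<Longrightarrow> AE x in \<mu>. T (\<phi> j x) = x"
    and \<rho>: "0 < \<rho>" "\<rho> < 1"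
    and contr: "\<And>j x y. j \<in> {1..m} \<Longrightarrow> x \<in> K \<Longrightarrow> y \<in> K \<Longrightarrow> dist (\<phi> j x) (\<phi> j y) \<le> \<rho> * dist x y"
    and D_pos: "0 < D" and dist_le: "\<And>x y. x \<in> K \<Longrightarrow> y \<in> K \<Longrightarrow> dist x y \<le> D"
    and d: "1 \<le> d"
    and shell: "\<And>x r s. 0 \<le> s \<Longrightarrow> s \<le> r \<Longrightarrow>
           measure \<mu> (ball x r) - measure \<mu> (ball x s) \<le> Cb * (r ^ d - s ^ d)"
begin

lemma measure_ball_le: "0 \<le> r \<Longrightarrow> measure \<mu> (ball x r) \<le> Cb * r ^ d"
  using shell[of 0 r x] d by (simp add: power_0_left)

lemma Cb_nonneg: "0 \<le> Cb"
  using order_trans[OF measure_nonneg measure_ball_le[of 1]] by simp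

lemma space_mu [simp]: "space \<mu> = UNIV"
  using sets_eq_imp_space_eq[OF sets_mu] by simp

lemma prob_UNIV [simp]: "measure \<mu> UNIV = 1"
  using prob_space by simp

lemma AE_borel_null_set:
  assumes "AE x in \<mu>. Q x"
  obtains N where "N \<in> sets borel" "measure \<mu> N = 0" "{x. \<not> Q x} \<subseteq> N"
proof -
  obtain N where "{x \<in> space \<mu>. \<not> Q x} \<subseteq> N" "emeasure \<mu> N = 0" "N \<in> sets \<mu>"
    using assms by (rule AE_E)
  then show thesis using that[of N] sets_mu by (simp add: measure_def)
qed

lemma cmp_meas: "w \<in> W n \<Longrightarrow> cmp w \<in> borel_measurable borel"
proof (induction n arbitrary: w)
  case 0
  then show ?case by (simp add: word_comp.simps(1)[abs_def])
next
  case (Suc n)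
  then obtain j v where "w = j # v" "j \<in> {1..m}" "v \<in> W n" by (auto simp: words_Suc)
  then show ?case using measurable_compose[OF Suc.IH[of v] phi_meas[of j]] by simp
qed

lemma wt_meas: "w \<in> W n \<Longrightarrow> wt w \<in> borel_measurable borel"
proof (induction n arbitrary: w)
  case 0
  then show ?case by (simp add: word_weight.simps(1)[abs_def])
next
  case (Suc n)
  then obtain j v where w: "w = j # v" "j \<in> {1..m}" "v \<in> W n" by (auto simp: words_Suc)
  show ?case
    using measurable_compose[OF cmp_meas[OF w(3)] p_meas[OF w(2)]] Suc.IH[OF w(3)]
    unfolding w(1) by simp
qed

lemma integrable_bounded_on_K:
  fixes F :: "'a \<Rightarrow> real"
  assumes "F \<in> borel_measurable borel" "\<And>x. x \<in> K \<Longrightarrow> \<bar>F x\<bar> \<le> B"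
  shows "integrable \<mu> F"
  using assms AE_K by (intro integrable_const_bound[where B=B]) auto

lemma wt_le_1:
  assumes "w \<in> W n" "x \<in> K"
  shows "wt w x \<le> 1"
  using member_le_sum[of w "W n" "\<lambda>w. wt w x"] assms wt_pos[of _ n x] wt_sum[of x n]
  by (auto intro: less_imp_le)

lemma integral_words:
  assumes "F \<in> borel_measurable borel" "\<And>x. x \<in> K \<Longrightarrow> \<bar>F x\<bar> \<le> B"
  shows "(\<integral>x. F x \<partial>\<mu>) = (\<Sum>w\<in>W n. \<integral>x. wt w x * F (cmp w x) \<partial>\<mu>)"
  using assms
proof (induction n arbitrary: F)
  case 0
  then show ?case by simp
next
  case (Suc n)
  have B0: "0 \<le> B" using Suc.prems(2) K_ne by force
  have "(\<integral>x. F x \<partial>\<mu>) = (\<Sum>j=1..m. \<integral>x. p j x * F (\<phi> j x) \<partial>\<mu>)"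
    by (rule stationary[OF Suc.prems]) auto
  also have "\<dots> = (\<Sum>j=1..m. \<Sum>w\<in>W n. \<integral>x. wt w x * (p j (cmp w x) * F (\<phi> j (cmp w x))) \<partial>\<mu>)"
  proof (intro sum.cong refl)
    fix j assume j: "j \<in> {1..m}"
    show "(\<integral>x. p j x * F (\<phi> j x) \<partial>\<mu>) = (\<Sum>w\<in>W n. \<integral>x. wt w x * (p j (cmp w x) * F (\<phi> j (cmp w x))) \<partial>\<mu>)"
    proof (rule Suc.IH)
      show "(\<lambda>x. p j x * F (\<phi> j x)) \<in> borel_measurable borel"
        using measurable_compose[OF phi_meas[OF j] Suc.prems(1)] p_meas[OF j] by simp
      fix x assume x: "x \<in> K"
      have "[j] \<in> W 1" using j by (simp add: words_def)
      from wt_le_1[OF this x] have "p j x \<le> 1" by simp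
      then have "p j x * \<bar>F (\<phi> j x)\<bar> \<le> 1 * B"
        using p_pos[OF j x] Suc.prems(2)[OF inv[OF j x]] B0 by (intro mult_mono) auto
      then show "\<bar>p j x * F (\<phi> j x)\<bar> \<le> B" using p_pos[OF j x] by (simp add: abs_mult)
    qed
  qed
  also have "\<dots> = (\<Sum>w\<in>W (Suc n). \<integral>x. wt w x * F (cmp w x) \<partial>\<mu>)"
    by (simp add: sum_words_Suc mult_ac)
  finally show ?case .
qed

lemma AE_branch:
  assumes Q: "AE x in \<mu>. Q x" and j: "j \<in> {1..m}"
  shows "AE x in \<mu>. Q (\<phi> j x)"
proof -
  obtain N where N: "N \<in> sets borel" "measure \<mu> N = 0" "{x. \<not> Q x} \<subseteq> N"
    using AE_borel_null_set[OF Q] .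
  note [measurable] = N(1) phi_meas p_meas
  have nn: "AE x in \<mu>. 0 \<le> p i x * indicator N (\<phi> i x)" if "i \<in> {1..m}" for i
    using AE_K by eventually_elim (use p_pos[OF that] in \<open>simp add: less_imp_le\<close>)
  have le: "p i x \<le> 1" if "i \<in> {1..m}" "x \<in> K" for i x
    using wt_le_1[of "[i]" 1 x] that by (simp add: words_def)
  have int: "integrable \<mu> (\<lambda>x. p i x * indicator N (\<phi> i x))" if "i \<in> {1..m}" for i
  proof (rule integrable_bounded_on_K[where B=1])
    show "\<bar>p i x * indicator N (\<phi> i x)\<bar> \<le> 1" if "x \<in> K" for x
      using le[OF \<open>i \<in> {1..m}\<close> that] p_pos[OF \<open>i \<in> {1..m}\<close> that] by (simp add: indicator_def)
  qed (use that in measurable)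
  have "(\<Sum>i=1..m. \<integral>x. p i x * indicator N (\<phi> i x) \<partial>\<mu>) = (\<integral>x. indicator N x \<partial>\<mu>)"
    by (rule stationary[symmetric, where B=1]) (auto simp: indicator_def)
  also have "\<dots> = 0" using N(2) by simp
  finally have "(\<integral>x. p j x * indicator N (\<phi> j x) \<partial>\<mu>) = 0"
    using nn j by (subst (asm) sum_nonneg_eq_0_iff) (auto intro: integral_nonneg_AE)
  then have "AE x in \<mu>. p j x * indicator N (\<phi> j x) = 0"
    using integral_nonneg_eq_0_iff_AE[OF int[OF j] nn[OF j]] by simp
  with AE_K show ?thesis
  proof eventually_elim
    case (elim x)
    then have "\<phi> j x \<notin> N" using p_pos[OF j, of x] by (auto simp: indicator_def split: if_splits)
    then show ?case using N(3) by auto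
  qed
qed

lemma AE_cmp:
  assumes Q: "AE x in \<mu>. Q x" and w: "w \<in> W n"
  shows "AE x in \<mu>. Q (cmp w x)"
  using w Q
proof (induction n arbitrary: w Q)
  case 0
  then show ?case by simp
next
  case (Suc n)
  then obtain j v where w: "w = j # v" "j \<in> {1..m}" "v \<in> W n" by (auto simp: words_Suc)
  from Suc.IH[OF w(3) AE_branch[OF Suc.prems(2) w(2)]] show ?case by (simp add: w)
qed

lemma AE_T_cmp:
  assumes w: "w \<in> W n"
  shows "AE x in \<mu>. (T ^^ n) (cmp w x) = x"
  using w
proof (induction n arbitrary: w)
  case 0
  then show ?case by simp
next
  case (Suc n)
  then obtain j v where w: "w = j # v" "j \<in> {1..m}" "v \<in> W n" by (auto simp: words_Suc)
  from Suc.IH[OF w(3)] AE_cmp[OF T_branch[OF w(2)] w(3)] show ?case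
    by eventually_elim (simp add: w funpow_swap1)
qed

lemma Tn_meas [measurable]: "T ^^ n \<in> borel_measurable borel"
  by (rule measurable_compose_n) simp

lemma AE_T_preimage:
  assumes Q: "AE x in \<mu>. Q x"
  shows "AE x in \<mu>. Q ((T ^^ n) x)"
proof -
  obtain N where N: "N \<in> sets borel" "measure \<mu> N = 0" "{x. \<not> Q x} \<subseteq> N"
    using AE_borel_null_set[OF Q] .
  note [measurable] = N(1)
  have QN: "AE x in \<mu>. x \<notin> N"
    using N(1,2) sets_mu emeasure_eq_measure[of N] by (intro AE_not_in) (auto simp: null_sets_def)
  have "(\<integral>x. indicator N ((T ^^ n) x) \<partial>\<mu>) = (\<Sum>w\<in>W n. \<integral>x. wt w x * indicator N ((T ^^ n) (cmp w x)) \<partial>\<mu>)"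
    by (rule integral_words[where B=1]) (auto simp: indicator_def)
  also have "\<dots> = (\<Sum>w\<in>W n. \<integral>x. 0 \<partial>\<mu>)"
  proof (intro sum.cong refl integral_cong_AE)
    fix w assume w: "w \<in> W n"
    note [measurable] = wt_meas[OF w] cmp_meas[OF w]
    show "(\<lambda>x. wt w x * indicator N ((T ^^ n) (cmp w x))) \<in> borel_measurable \<mu>" by measurable
    show "AE x in \<mu>. wt w x * indicator N ((T ^^ n) (cmp w x)) = 0"
      using AE_T_cmp[OF w] QN by eventually_elim auto
  qed auto
  finally have 0: "(\<integral>x. indicator N ((T ^^ n) x) \<partial>\<mu>) = (0::real)" by simp
  have "integrable \<mu> (\<lambda>x. indicator N ((T ^^ n) x) :: real)"
    by (rule integrable_const_bound[where B=1]) auto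
  with 0 have "AE x in \<mu>. indicator N ((T ^^ n) x) = (0::real)"
    by (subst (asm) integral_nonneg_eq_0_iff_AE) auto
  then show ?thesis by eventually_elim (use N(3) in \<open>auto simp: indicator_def split: if_splits\<close>)
qed

text \<open>
  Stationarity over \<open>l\<close> steps, where \<open>T ^^ l\<close> returns the end point of a path to its start: the operator
  \<open>P\<close> is dual to composition with \<open>T\<close>.
\<close>

lemma transfer_integral:
  assumes G: "G \<in> borel_measurable borel" "\<And>x. x \<in> K \<Longrightarrow> \<bar>G x\<bar> \<le> B"
    and F: "F \<in> borel_measurable borel" "\<And>x. \<bar>F x\<bar> \<le> 1"
  shows "(\<integral>x. G x * F ((T ^^ l) x) \<partial>\<mu>) = (\<integral>x. (P ^^ l) G x * F x \<partial>\<mu>)"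
proof -
  note [measurable] = G(1) F(1)
  have B0: "0 \<le> B" using G(2) K_ne by force
  have bd: "\<bar>G x * F y\<bar> \<le> B" if "x \<in> K" for x y
    using mult_mono[OF G(2)[OF that] F(2)[of y] B0] by (simp add: abs_mult)
  have "(\<integral>x. G x * F ((T ^^ l) x) \<partial>\<mu>) = (\<Sum>w\<in>W l. \<integral>x. wt w x * (G (cmp w x) * F ((T ^^ l) (cmp w x))) \<partial>\<mu>)"
    by (rule integral_words[where B=B]) (use bd in auto)
  also have "\<dots> = (\<Sum>w\<in>W l. \<integral>x. wt w x * (G (cmp w x) * F x) \<partial>\<mu>)"
  proof (intro sum.cong refl integral_cong_AE)
    fix w assume w: "w \<in> W l"
    note [measurable] = wt_meas[OF w] cmp_meas[OF w]
    show "(\<lambda>x. wt w x * (G (cmp w x) * F ((T ^^ l) (cmp w x)))) \<in> borel_measurable \<mu>" by measurable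
    show "(\<lambda>x. wt w x * (G (cmp w x) * F x)) \<in> borel_measurable \<mu>" by measurable
    show "AE x in \<mu>. wt w x * (G (cmp w x) * F ((T ^^ l) (cmp w x))) = wt w x * (G (cmp w x) * F x)"
      using AE_T_cmp[OF w] by eventually_elim simp
  qed
  also have "\<dots> = (\<integral>x. (\<Sum>w\<in>W l. wt w x * (G (cmp w x) * F x)) \<partial>\<mu>)"
  proof (rule Bochner_Integration.integral_sum[symmetric])
    fix w assume w: "w \<in> W l"
    note [measurable] = wt_meas[OF w] cmp_meas[OF w]
    show "integrable \<mu> (\<lambda>x. wt w x * (G (cmp w x) * F x))"
    proof (rule integrable_bounded_on_K[where B="1 * B"])
      fix x assume x: "x \<in> K"
      show "\<bar>wt w x * (G (cmp w x) * F x)\<bar> \<le> 1 * B"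
        unfolding abs_mult[of "wt w x"]
        using wt_le_1[OF w x] wt_pos[OF w x] bd[OF cmp_in[OF w x]] B0 by (intro mult_mono) auto
    qed measurable
  qed
  also have "\<dots> = (\<integral>x. (P ^^ l) G x * F x \<partial>\<mu>)"
    by (simp add: branch_op_funpow sum_distrib_right mult.assoc)
  finally show ?thesis .
qed

text \<open>
  The \<open>\<mu>\<close>-mass of the cylinder of \<open>w\<close>, computed as a mean weight.
\<close>

definition "qm w = (\<integral>x. wt w x \<partial>\<mu>)"

lemma wt_integrable: "w \<in> W n \<Longrightarrow> integrable \<mu> (wt w)"
  by (rule integrable_bounded_on_K[where B=1, OF wt_meas])
     (use wt_pos wt_le_1 in \<open>auto simp: abs_of_pos\<close>)

lemma qm_bounds:
  assumes w: "w \<in> W n" and x: "x \<in> K"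
  shows "wt w x \<le> E * qm w" "qm w \<le> E * wt w x"
proof -
  have "wt w x = (\<integral>y. wt w x \<partial>\<mu>)" by (simp add: prob_space)
  also have "\<dots> \<le> (\<integral>y. E * wt w y \<partial>\<mu>)"
    by (rule integral_mono_AE) (use wt_integrable[OF w] AE_K wt_le[OF w x] in auto)
  finally show "wt w x \<le> E * qm w" by (simp add: qm_def)
  have "qm w \<le> (\<integral>y. E * wt w x \<partial>\<mu>)" unfolding qm_def
    by (rule integral_mono_AE) (use wt_integrable[OF w] AE_K wt_le[OF w _ x] in auto)
  then show "qm w \<le> E * wt w x" by (simp add: prob_space)
qed

lemma qm_nonneg:
  assumes "w \<in> W n" shows "0 \<le> qm w"
  unfolding qm_def
  by (rule integral_nonneg_AE) (use AE_K wt_pos[OF assms] in \<open>auto simp: less_imp_le\<close>)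

lemma qm_sum: "(\<Sum>w\<in>W n. qm w) = 1"
  using integral_words[of "\<lambda>_. 1" 1 n] by (simp add: prob_space qm_def)

lemma qm_append:
  assumes v: "v \<in> W a" and w: "w \<in> W b"
  shows "qm (v @ w) \<le> E * qm v * qm w"
proof -
  have vw: "v @ w \<in> W (a + b)" using v w by (auto simp: words_def)
  have "qm (v @ w) \<le> (\<integral>x. E * qm v * wt w x \<partial>\<mu>)"
    unfolding qm_def[of "v @ w"]
  proof (rule integral_mono_AE)
    show "AE x in \<mu>. wt (v @ w) x \<le> E * qm v * wt w x"
      using AE_K
    proof eventually_elim
      case (elim x)
      then show ?case unfolding word_weight_append
        using qm_bounds(1)[OF v cmp_in[OF w elim]] wt_pos[OF w elim] by (intro mult_right_mono) auto
    qed
  qed (use wt_integrable[OF vw] wt_integrable[OF w] in auto)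
  then show ?thesis by (simp add: qm_def)
qed

text \<open>
  Decay of correlations between a cylinder weight and an arbitrary set visited \<open>l\<close> steps later. The
  smoothing acts on the weight only, so no regularity of the target function is needed.
\<close>

lemma exponential_mixing:
  obtains Cm \<gamma> where "0 < Cm" "0 < \<gamma>" "\<gamma> < 1"
    "\<And>n w l F. w \<in> W n \<Longrightarrow> F \<in> borel_measurable borel \<Longrightarrow> (\<And>x. 0 \<le> F x \<and> F x \<le> 1) \<Longrightarrow>
       \<bar>(\<integral>x. wt w x * F ((T ^^ l) x) \<partial>\<mu>) - qm w * (\<integral>x. F x \<partial>\<mu>)\<bar> \<le> Cm * \<gamma> ^ l * qm w * (\<integral>x. F x \<partial>\<mu>)"
proof -
  obtain C \<gamma> where C: "0 < C" "0 < \<gamma>" "\<gamma> < 1"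
    and dec: "\<And>F a l x y. regular a (M * a) F \<Longrightarrow> x \<in> K \<Longrightarrow> y \<in> K \<Longrightarrow>
       (P ^^ l) F x - (P ^^ l) F y \<le> C * \<gamma> ^ l * a"
    using exponential_contraction by blast
  show ?thesis
  proof (rule that[of "C * E" \<gamma>])
    show "0 < C * E" using C E_ge_1 by simp
    fix n w l and F :: "'a \<Rightarrow> real" assume w: "w \<in> W n" and F [measurable]: "F \<in> borel_measurable borel"
      and F01: "\<And>x. 0 \<le> F x \<and> F x \<le> (1::real)"
    note [measurable] = wt_meas[OF w]
    have bw: "\<bar>wt w x\<bar> \<le> 1" if "x \<in> K" for x using wt_pos[OF w that] wt_le_1[OF w that] by auto
    define G where "G = (P ^^ l) (wt w)"
    have Geq: "G = (\<lambda>x. \<Sum>v\<in>W l. wt v x * wt w (cmp v x))"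
      by (rule ext) (simp add: G_def branch_op_funpow)
    have Gm [measurable]: "G \<in> borel_measurable borel"
      unfolding Geq using wt_meas cmp_meas by (intro borel_measurable_sum borel_measurable_times measurable_compose[OF _ wt_meas[OF w]]) auto
    have osc: "G x - G y \<le> C * \<gamma> ^ l * (E * qm w)" if "x \<in> K" "y \<in> K" for x y
      unfolding G_def by (rule dec[OF wt_regular[OF w] that]) (rule qm_bounds(1)[OF w])
    have Gb: "\<bar>G x\<bar> \<le> 1" if x: "x \<in> K" for x
    proof -
      have "\<bar>G x\<bar> \<le> (\<Sum>v\<in>W l. \<bar>wt v x * wt w (cmp v x)\<bar>)" unfolding Geq by (rule sum_abs)
      also have "\<dots> \<le> (\<Sum>v\<in>W l. wt v x * 1)"
        using wt_pos[OF _ x, of _ l] bw cmp_in[OF _ x, of _ l] unfolding abs_mult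
        by (intro sum_mono mult_mono) (auto intro: less_imp_le simp: abs_of_pos)
      finally show ?thesis by (simp add: wt_sum[OF x])
    qed
    have Gint: "integrable \<mu> G" by (rule integrable_bounded_on_K[OF Gm Gb])
    have "(\<integral>x. wt w x * 1 \<partial>\<mu>) = (\<integral>x. G x * 1 \<partial>\<mu>)"
      unfolding G_def by (rule transfer_integral[where F="\<lambda>_. 1" and B=1]) (use bw in auto)
    then have q: "qm w = (\<integral>x. G x \<partial>\<mu>)" by (simp add: qm_def)
    have dev: "\<bar>G x - qm w\<bar> \<le> C * E * \<gamma> ^ l * qm w" if x: "x \<in> K" for x
    proof -
      have "qm w \<le> (\<integral>y. G x + C * \<gamma>^l * (E * qm w) \<partial>\<mu>)"
        unfolding q by (rule integral_mono_AE) (use Gint AE_K osc[OF _ x] q in \<open>auto elim!: eventually_mono simp: field_simps\<close>)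
      moreover have "(\<integral>y. G x - C * \<gamma>^l * (E * qm w) \<partial>\<mu>) \<le> qm w"
        unfolding q by (rule integral_mono_AE) (use Gint AE_K osc[OF x] q in \<open>auto elim!: eventually_mono simp: field_simps\<close>)
      ultimately show ?thesis by (simp add: prob_space abs_le_iff mult_ac)
    qed
    have Fint: "integrable \<mu> F" by (rule integrable_const_bound[where B=1]) (use F01 in auto)
    have F1: "\<bar>F x\<bar> \<le> 1" for x using F01[of x] by auto
    have GFint: "integrable \<mu> (\<lambda>x. G x * F x)"
    proof (rule integrable_bounded_on_K[where B="1 * 1"])
      show "\<bar>G x * F x\<bar> \<le> 1 * 1" if "x \<in> K" for x
        unfolding abs_mult using Gb[OF that] F1[of x] by (intro mult_mono) auto
    qed measurable
    have "(\<integral>x. wt w x * F ((T ^^ l) x) \<partial>\<mu>) - qm w * (\<integral>x. F x \<partial>\<mu>) = (\<integral>x. G x * F x - qm w * F x \<partial>\<mu>)"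
      using transfer_integral[of "wt w" 1 F l] bw F1 GFint Fint by (simp add: G_def)
    also have "\<bar>\<dots>\<bar> \<le> (\<integral>x. \<bar>G x * F x - qm w * F x\<bar> \<partial>\<mu>)" by (rule integral_abs_bound)
    also have "\<dots> \<le> (\<integral>x. C * E * \<gamma> ^ l * qm w * F x \<partial>\<mu>)"
    proof (rule integral_mono_AE)
      show "AE x in \<mu>. \<bar>G x * F x - qm w * F x\<bar> \<le> C * E * \<gamma> ^ l * qm w * F x"
        using AE_K
      proof eventually_elim
        case (elim x)
        have "\<bar>G x * F x - qm w * F x\<bar> = \<bar>G x - qm w\<bar> * F x"
          using F01[of x] by (simp add: abs_mult flip: left_diff_distrib)
        then show ?case using mult_right_mono[OF dev[OF elim], of "F x"] F01[of x] by simp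
      qed
    qed (use GFint Fint in auto)
    finally show "\<bar>(\<integral>x. wt w x * F ((T ^^ l) x) \<partial>\<mu>) - qm w * (\<integral>x. F x \<partial>\<mu>)\<bar>
        \<le> C * E * \<gamma> ^ l * qm w * (\<integral>x. F x \<partial>\<mu>)" by simp
  qed (use C in auto)
qed

definition hit :: "nat \<Rightarrow> real \<Rightarrow> 'a \<Rightarrow> real" where
  "hit n r x = indicator (ball x r) ((T ^^ n) x)"

definition ball_mass :: "real \<Rightarrow> 'a \<Rightarrow> real" where
  "ball_mass r x = measure \<mu> (ball x r)"

lemma hit_meas [measurable]: "hit n r \<in> borel_measurable borel"
proof -
  have "hit n r = indicator {x. dist x ((T ^^ n) x) < r}"
    by (auto simp: hit_def indicator_def fun_eq_iff)
  moreover have "{x. dist x ((T ^^ n) x) < r} \<in> sets borel" by measurable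
  ultimately show ?thesis by simp
qed

lemma ball_mass_meas [measurable]: "ball_mass r \<in> borel_measurable borel"
proof -
  have "open {z :: 'a \<times> 'a. dist (fst z) (snd z) < r}"
    by (intro open_Collect_less continuous_intros)
  then have "{z :: 'a \<times> 'a. dist (fst z) (snd z) < r} \<in> sets (borel \<Otimes>\<^sub>M \<mu>)"
    by (subst sets_pair_measure_cong[OF refl sets_mu], subst borel_prod) simp
  then have "(\<lambda>x. emeasure \<mu> (Pair x -` {z. dist (fst z) (snd z) < r})) \<in> borel_measurable borel"
    by (rule measurable_emeasure_Pair)
  then have "(\<lambda>x. enn2real (emeasure \<mu> (Pair x -` {z. dist (fst z) (snd z) < r}))) \<in> borel_measurable borel"
    by measurable
  moreover have "Pair x -` {z. dist (fst z) (snd z) < r} = ball x r" for x :: 'a by auto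
  ultimately show ?thesis unfolding ball_mass_def[abs_def] measure_def by (simp only:)
qed

lemma hit_01: "0 \<le> hit n r x" "hit n r x \<le> 1"
  by (auto simp: hit_def indicator_def)

lemma ball_mass_01: "0 \<le> ball_mass r x" "ball_mass r x \<le> 1"
  by (auto simp: ball_mass_def)

text \<open>
  The Lipschitz constant of the mass of a ball as a function of its radius, for radii up to
  \<open>R + 8 * D\<close>. The excess \<open>8 * D\<close> accommodates the widest shell that is used, whose half-width is
  \<open>2 * (3 * \<rho> ^ j * D + \<rho> ^ a * D)\<close>.
\<close>

definition Lam :: "real \<Rightarrow> real" where
  "Lam R = 2 * Cb * real d * (R + 8 * D) ^ (d - 1)"

lemma Lam_nonneg: "0 \<le> R \<Longrightarrow> 0 \<le> Lam R"
  using Cb_nonneg D_pos by (simp add: Lam_def)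

lemma ball_mass_annulus:
  assumes "0 \<le> r" "r \<le> R" "0 \<le> s" "s \<le> 8 * D"
  shows "ball_mass (r + s) x - ball_mass (r - s) x \<le> Lam R * s"
    and "ball_mass (r + s) x \<le> Cb * r ^ d + Lam R * s"
proof -
  have max: "ball_mass (r - s) x = ball_mass (max 0 (r - s)) x"
    by (cases "s \<le> r") (auto simp: ball_mass_def max_def ball_empty)
  have "ball_mass (r + s) x - ball_mass (r - s) x \<le> Cb * ((r + s) ^ d - (max 0 (r - s)) ^ d)"
    unfolding max using assms shell[of "max 0 (r - s)" "r + s" x] by (simp add: ball_mass_def)
  also have "\<dots> \<le> Cb * (real d * (r + s) ^ (d - 1) * (r + s - max 0 (r - s)))"
    using assms d Cb_nonneg by (intro mult_left_mono power_diff_le) auto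
  also have "\<dots> \<le> Cb * (real d * (R + 8 * D) ^ (d - 1) * (2 * s))"
    using assms Cb_nonneg D_pos by (intro mult_left_mono mult_mono power_mono) auto
  finally show "ball_mass (r + s) x - ball_mass (r - s) x \<le> Lam R * s" by (simp add: Lam_def mult_ac)
  have "ball_mass (r + s) x \<le> Cb * r ^ d + (ball_mass (r + s) x - ball_mass r x)"
    using measure_ball_le[of r x] assms by (simp add: ball_mass_def)
  also have "ball_mass (r + s) x - ball_mass r x \<le> Cb * ((r + s) ^ d - r ^ d)"
    using assms shell[of r "r + s" x] by (simp add: ball_mass_def)
  also have "Cb * ((r + s) ^ d - r ^ d) \<le> Cb * (real d * (r + s) ^ (d - 1) * (r + s - r))"
    using assms d Cb_nonneg by (intro mult_left_mono power_diff_le) auto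
  also have "\<dots> \<le> Cb * (real d * (R + 8 * D) ^ (d - 1) * (2 * s))"
    using assms Cb_nonneg D_pos by (intro mult_left_mono mult_mono power_mono) auto
  finally show "ball_mass (r + s) x \<le> Cb * r ^ d + Lam R * s" by (simp add: Lam_def mult_ac)
qed

lemma ball_mass_mono: "ball x r \<subseteq> ball y s \<Longrightarrow> ball_mass r x \<le> ball_mass s y"
  unfolding ball_mass_def by (rule finite_measure_mono) auto

lemma cmp_dist:
  assumes "w \<in> W n" "x \<in> K" "y \<in> K"
  shows "dist (cmp w x) (cmp w y) \<le> \<rho> ^ n * D"
proof -
  have "dist (cmp w x) (cmp w y) \<le> \<rho> ^ n * dist x y"
    by (rule word_comp_contraction[where S=K and m=m and \<delta>=dist, OF inv contr]) (use assms \<rho> in auto)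
  also have "\<dots> \<le> \<rho> ^ n * D" using dist_le[OF assms(2,3)] \<rho> by (intro mult_left_mono) auto
  finally show ?thesis .
qed

text \<open>
  A function \<open>\<xi>\<close> that is nearly constant on the cylinders of generation \<open>N\<close> is nearly uncorrelated
  with the event that the orbit returns at time \<open>N + l\<close>. On one cylinder both the value of \<open>\<xi>\<close> and
  the centre of the target ball can be frozen; what remains is the mixing estimate for a fixed ball.
\<close>

lemma return_decorrelation:
  assumes R: "0 \<le> R"
  obtains C \<gamma> where "0 \<le> C" "0 < \<gamma>" "\<gamma> < 1"
    "\<And>N l r \<xi> z t. 0 \<le> r \<Longrightarrow> r \<le> R \<Longrightarrow> \<xi> \<in> borel_measurable borel \<Longrightarrow> (\<And>x. 0 \<le> \<xi> x \<and> \<xi> x \<le> 1) \<Longrightarrow>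
      (\<And>w. w \<in> W N \<Longrightarrow> 0 \<le> z w \<and> z w \<le> 1 \<and> 0 \<le> t w \<and> t w \<le> 1) \<Longrightarrow>
      (\<And>w. w \<in> W N \<Longrightarrow> AE x in \<mu>. \<bar>\<xi> (cmp w x) - z w\<bar> \<le> t w) \<Longrightarrow>
      \<bar>\<integral>x. \<xi> x * (hit (N + l) r x - ball_mass r x) \<partial>\<mu>\<bar>
        \<le> C * (((\<Sum>w\<in>W N. qm w * t w) + \<gamma> ^ l) * r ^ d + \<rho> ^ N)"
proof -
  obtain Cm \<gamma> where Cm: "0 < Cm" "0 < \<gamma>" "\<gamma> < 1"
    and mix: "\<And>n w l F. w \<in> W n \<Longrightarrow> F \<in> borel_measurable borel \<Longrightarrow> (\<And>x. 0 \<le> F x \<and> F x \<le> 1) \<Longrightarrow>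
       \<bar>(\<integral>x. wt w x * F ((T ^^ l) x) \<partial>\<mu>) - qm w * (\<integral>x. F x \<partial>\<mu>)\<bar> \<le> Cm * \<gamma> ^ l * qm w * (\<integral>x. F x \<partial>\<mu>)"
    using exponential_mixing by blast
  define C where "C = (2 + Cm) * Cb + (3 + 2 * Cm) * Lam R * D"
  obtain y0 where y0: "y0 \<in> K" using K_ne by auto
  show ?thesis
  proof (rule that[of C \<gamma>])
    show "0 \<le> C" using Cm Cb_nonneg Lam_nonneg[OF R] D_pos by (simp add: C_def)
    fix N l r and \<xi> :: "'a \<Rightarrow> real" and z t
    assume r: "0 \<le> r" "r \<le> R" and \<xi>m [measurable]: "\<xi> \<in> borel_measurable borel"
      and \<xi>: "\<And>x. 0 \<le> \<xi> x \<and> \<xi> x \<le> (1::real)"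
      and z: "\<And>w. w \<in> W N \<Longrightarrow> 0 \<le> z w \<and> z w \<le> (1::real) \<and> 0 \<le> t w \<and> t w \<le> 1"
      and app: "\<And>w. w \<in> W N \<Longrightarrow> AE x in \<mu>. \<bar>\<xi> (cmp w x) - z w\<bar> \<le> t w"
    define s where "s = \<rho> ^ N * D"
    have s: "0 \<le> s" "s \<le> 8 * D"
    proof -
      have "\<rho> ^ N \<le> 1" using \<rho> by (intro power_le_one) auto
      then show "s \<le> 8 * D" using D_pos mult_right_mono[of "\<rho>^N" 1 D] by (simp add: s_def)
    qed (use D_pos \<rho> in \<open>simp add: s_def\<close>)
    have g1: "\<gamma> ^ l \<le> 1" using Cm by (intro power_le_one) auto
    define V where "V = (\<Sum>w\<in>W N. qm w * t w)"
    have V: "0 \<le> V" "V \<le> 1"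
    proof -
      show "0 \<le> V" unfolding V_def by (intro sum_nonneg mult_nonneg_nonneg qm_nonneg) (use z in auto)
      have "V \<le> (\<Sum>w\<in>W N. qm w * 1)"
        unfolding V_def by (intro sum_mono mult_left_mono qm_nonneg) (use z in auto)
      then show "V \<le> 1" by (simp add: qm_sum)
    qed
    define U where "U = Cb * r ^ d + Lam R * s"
    have U0: "0 \<le> U" using r s Cb_nonneg Lam_nonneg[OF R] by (simp add: U_def)
    let ?g = "\<lambda>x. hit (N + l) r x - ball_mass r x"
    have g: "\<bar>?g x\<bar> \<le> 1" for x using hit_01[of "N + l" r x] ball_mass_01[of r x] by (auto simp: abs_le_iff)
    have piece: "\<bar>\<integral>x. wt w x * (\<xi> (cmp w x) * ?g (cmp w x)) \<partial>\<mu>\<bar>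
        \<le> qm w * (t w * (2 + Cm) * U + Lam R * s + Cm * \<gamma> ^ l * U)" if w: "w \<in> W N" for w
    proof -
      note [measurable] = wt_meas[OF w] cmp_meas[OF w]
      \<comment> \<open>all points of the cylinder are within \<open>s\<close> of \<open>x0\<close>, so \<open>F1\<close> and \<open>F2\<close> sandwich the moving target\<close>
      define x0 where "x0 = cmp w y0"
      define F1 :: "'a \<Rightarrow> real" where "F1 = indicator (ball x0 (r + s))"
      define F2 :: "'a \<Rightarrow> real" where "F2 = indicator (ball x0 (r - s))"
      define u where "u = ball_mass (r + s) x0"
      define v where "v = ball_mass (r - s) x0"
      have uv: "0 \<le> v" "0 \<le> u" "u - v \<le> Lam R * s" "u \<le> U" "v \<le> u"
        using ball_mass_annulus[OF r s, of x0] s by (auto simp: u_def v_def U_def ball_mass_01 intro!: ball_mass_mono)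
      have Fm [measurable]: "F1 \<in> borel_measurable borel" "F2 \<in> borel_measurable borel"
        unfolding F1_def F2_def by (auto intro!: borel_measurable_indicator borel_open)
      have F01: "0 \<le> F1 x" "F1 x \<le> 1" "0 \<le> F2 x" "F2 x \<le> 1" for x by (auto simp: F1_def F2_def indicator_def)
      have Fi: "(\<integral>x. F1 x \<partial>\<mu>) = u" "(\<integral>x. F2 x \<partial>\<mu>) = v"
        by (auto simp: F1_def F2_def u_def v_def ball_mass_def)
      have wtb: "0 \<le> wt w x" "wt w x \<le> 1" if "x \<in> K" for x
        using wt_pos[OF w that] wt_le_1[OF w that] by auto
      have intb: "integrable \<mu> (\<lambda>x. wt w x * f x)" if "f \<in> borel_measurable borel" "\<And>x. \<bar>f x\<bar> \<le> 1" for f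
      proof (rule integrable_bounded_on_K[where B="1 * 1"])
        show "\<bar>wt w x * f x\<bar> \<le> 1 * 1" if "x \<in> K" for x
          unfolding abs_mult using wtb[OF that] \<open>\<And>x. \<bar>f x\<bar> \<le> 1\<close>[of x] by (intro mult_mono) auto
      qed (use that in auto)
      have I1: "integrable \<mu> (\<lambda>x. wt w x * F1 ((T ^^ l) x))" "integrable \<mu> (\<lambda>x. wt w x * F2 ((T ^^ l) x))"
        using F01 by (auto intro!: intb)
      note I0 = wt_integrable[OF w]
      have sand: "AE x in \<mu>. F2 ((T ^^ l) x) \<le> hit (N + l) r (cmp w x) \<and> hit (N + l) r (cmp w x) \<le> F1 ((T ^^ l) x)
          \<and> v \<le> ball_mass r (cmp w x) \<and> ball_mass r (cmp w x) \<le> u"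
        using AE_T_cmp[OF w] AE_K
      proof eventually_elim
        case (elim x)
        have dst: "dist x0 (cmp w x) \<le> s" unfolding x0_def s_def by (rule cmp_dist[OF w y0 elim(2)])
        have sub1: "ball (cmp w x) r \<subseteq> ball x0 (r + s)"
        proof
          fix y assume "y \<in> ball (cmp w x) r"
          then show "y \<in> ball x0 (r + s)" using dst dist_triangle[of x0 y "cmp w x"] by simp
        qed
        have sub2: "ball x0 (r - s) \<subseteq> ball (cmp w x) r"
        proof
          fix y assume "y \<in> ball x0 (r - s)"
          then show "y \<in> ball (cmp w x) r"
            using dst dist_triangle[of "cmp w x" y x0] by (simp add: dist_commute)
        qed
        have "(T ^^ (N + l)) (cmp w x) = (T ^^ l) x"
          by (subst add.commute) (simp add: funpow_add elim(1))
        then show ?case using sub1 sub2 ball_mass_mono[OF sub1] ball_mass_mono[OF sub2]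
          by (auto simp: hit_def F1_def F2_def u_def v_def indicator_def split: if_splits)
      qed
      let ?h = "\<lambda>x. hit (N + l) r (cmp w x)" and ?b = "\<lambda>x. ball_mass r (cmp w x)"
      have I2: "integrable \<mu> (\<lambda>x. wt w x * (?h x - ?b x))"
        by (rule intb) (use g in auto)
      have I3: "integrable \<mu> (\<lambda>x. wt w x * (\<xi> (cmp w x) * (?h x - ?b x)))"
      proof (rule intb)
        show "\<bar>\<xi> (cmp w x) * (?h x - ?b x)\<bar> \<le> 1" for x
          using mult_mono[of "\<bar>\<xi> (cmp w x)\<bar>" 1 "\<bar>?h x - ?b x\<bar>" 1] \<xi>[of "cmp w x"] g[of "cmp w x"]
          by (simp add: abs_mult)
      qed measurable
      have m1: "(\<integral>x. wt w x * F1 ((T ^^ l) x) \<partial>\<mu>) \<le> qm w * u + Cm * \<gamma> ^ l * qm w * u"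
        using mix[OF w Fm(1), of l] F01 by (simp add: Fi abs_le_iff)
      have m2: "qm w * v - Cm * \<gamma> ^ l * qm w * v \<le> (\<integral>x. wt w x * F2 ((T ^^ l) x) \<partial>\<mu>)"
        using mix[OF w Fm(2), of l] F01 by (simp add: Fi abs_le_iff)
      have q0: "0 \<le> qm w" by (rule qm_nonneg[OF w])
      have up: "(\<integral>x. wt w x * (?h x - ?b x) \<partial>\<mu>) \<le> qm w * (Lam R * s + Cm * \<gamma> ^ l * U)"
      proof -
        have "(\<integral>x. wt w x * (?h x - ?b x) \<partial>\<mu>) \<le> (\<integral>x. wt w x * F1 ((T ^^ l) x) - v * wt w x \<partial>\<mu>)"
        proof (rule integral_mono_AE[OF I2])
          show "AE x in \<mu>. wt w x * (?h x - ?b x) \<le> wt w x * F1 ((T ^^ l) x) - v * wt w x"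
            using sand AE_K
          proof eventually_elim
            case (elim x)
            have "wt w x * (?h x - ?b x) \<le> wt w x * (F1 ((T ^^ l) x) - v)"
              using elim wtb[of x] by (intro mult_left_mono) auto
            then show ?case by (simp add: algebra_simps)
          qed
        qed (use I1 I0 in auto)
        also have "\<dots> = (\<integral>x. wt w x * F1 ((T ^^ l) x) \<partial>\<mu>) - v * qm w"
          using I1 I0 by (simp add: qm_def)
        also have "\<dots> \<le> qm w * ((u - v) + Cm * \<gamma> ^ l * u)"
          using m1 by (simp add: algebra_simps)
        also have "\<dots> \<le> qm w * (Lam R * s + Cm * \<gamma> ^ l * U)"
          using uv q0 Cm by (intro mult_left_mono add_mono) auto
        finally show ?thesis .
      qed
      have lo: "- (qm w * (Lam R * s + Cm * \<gamma> ^ l * U)) \<le> (\<integral>x. wt w x * (?h x - ?b x) \<partial>\<mu>)"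
      proof -
        have "- (qm w * (Lam R * s + Cm * \<gamma> ^ l * U)) \<le> - (qm w * ((u - v) + Cm * \<gamma> ^ l * v))"
          using uv q0 Cm by (intro le_imp_neg_le mult_left_mono add_mono) auto
        also have "\<dots> \<le> (\<integral>x. wt w x * F2 ((T ^^ l) x) \<partial>\<mu>) - u * qm w"
          using m2 by (simp add: algebra_simps)
        also have "\<dots> = (\<integral>x. wt w x * F2 ((T ^^ l) x) - u * wt w x \<partial>\<mu>)"
          using I1 I0 by (simp add: qm_def)
        also have "\<dots> \<le> (\<integral>x. wt w x * (?h x - ?b x) \<partial>\<mu>)"
        proof (rule integral_mono_AE[OF _ I2])
          show "AE x in \<mu>. wt w x * F2 ((T ^^ l) x) - u * wt w x \<le> wt w x * (?h x - ?b x)"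
            using sand AE_K
          proof eventually_elim
            case (elim x)
            have "wt w x * (F2 ((T ^^ l) x) - u) \<le> wt w x * (?h x - ?b x)"
              using elim wtb[of x] by (intro mult_left_mono) auto
            then show ?case by (simp add: algebra_simps)
          qed
        qed (use I1 I0 in auto)
        finally show ?thesis .
      qed
      have first: "\<bar>\<integral>x. wt w x * (\<xi> (cmp w x) * ?g (cmp w x)) - z w * (wt w x * (?h x - ?b x)) \<partial>\<mu>\<bar>
          \<le> t w * ((\<integral>x. wt w x * F1 ((T ^^ l) x) \<partial>\<mu>) + u * qm w)"
      proof -
        have "\<bar>\<integral>x. wt w x * (\<xi> (cmp w x) * ?g (cmp w x)) - z w * (wt w x * (?h x - ?b x)) \<partial>\<mu>\<bar>
            \<le> (\<integral>x. \<bar>wt w x * (\<xi> (cmp w x) * ?g (cmp w x)) - z w * (wt w x * (?h x - ?b x))\<bar> \<partial>\<mu>)"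
          by (rule integral_abs_bound)
        also have "\<dots> \<le> (\<integral>x. t w * (wt w x * F1 ((T ^^ l) x) + u * wt w x) \<partial>\<mu>)"
        proof (rule integral_mono_AE)
          show "AE x in \<mu>. \<bar>wt w x * (\<xi> (cmp w x) * ?g (cmp w x)) - z w * (wt w x * (?h x - ?b x))\<bar>
              \<le> t w * (wt w x * F1 ((T ^^ l) x) + u * wt w x)"
            using sand AE_K app[OF w]
          proof eventually_elim
            case (elim x)
            have "\<bar>wt w x * (\<xi> (cmp w x) * ?g (cmp w x)) - z w * (wt w x * (?h x - ?b x))\<bar>
                = \<bar>\<xi> (cmp w x) - z w\<bar> * (wt w x * \<bar>?h x - ?b x\<bar>)"
            proof -
              have "wt w x * (\<xi> (cmp w x) * ?g (cmp w x)) - z w * (wt w x * (?h x - ?b x))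
                  = (\<xi> (cmp w x) - z w) * (wt w x * (?h x - ?b x))"
                by (simp add: algebra_simps)
              then show ?thesis using wtb(1)[OF elim(2)] by (simp add: abs_mult)
            qed
            also have "\<dots> \<le> t w * (wt w x * (F1 ((T ^^ l) x) + u))"
            proof (intro mult_mono elim(3))
              show "\<bar>?h x - ?b x\<bar> \<le> F1 ((T ^^ l) x) + u"
                using elim(1) hit_01[of "N + l" r "cmp w x"] ball_mass_01[of r "cmp w x"] uv by (auto simp: abs_le_iff)
            qed (use wtb(1)[OF elim(2)] z[OF w] in auto)
            finally show ?case by (simp add: algebra_simps)
          qed
        qed (use I1 I0 I2 I3 in auto)
        also have "\<dots> = t w * ((\<integral>x. wt w x * F1 ((T ^^ l) x) \<partial>\<mu>) + u * qm w)"
          using I1 I0 by (simp add: qm_def)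
        finally show ?thesis .
      qed
      also have "\<dots> \<le> t w * (qm w * ((2 + Cm) * U))"
      proof (rule mult_left_mono)
        have "Cm * \<gamma> ^ l * qm w * u \<le> Cm * 1 * qm w * U"
          using g1 Cm q0 uv by (intro mult_mono) auto
        moreover have "qm w * u \<le> qm w * U" using q0 uv by (intro mult_left_mono)
        ultimately show "(\<integral>x. wt w x * F1 ((T ^^ l) x) \<partial>\<mu>) + u * qm w \<le> qm w * ((2 + Cm) * U)"
          using m1 by (simp add: algebra_simps)
      qed (use z[OF w] in auto)
      finally have f: "\<bar>(\<integral>x. wt w x * (\<xi> (cmp w x) * ?g (cmp w x)) \<partial>\<mu>) - z w * (\<integral>x. wt w x * (?h x - ?b x) \<partial>\<mu>)\<bar>
          \<le> t w * (qm w * ((2 + Cm) * U))"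
        using I2 I3 by simp
      have "\<bar>z w * (\<integral>x. wt w x * (?h x - ?b x) \<partial>\<mu>)\<bar> \<le> 1 * (qm w * (Lam R * s + Cm * \<gamma> ^ l * U))"
        unfolding abs_mult using up lo z[OF w] by (intro mult_mono) (auto simp: abs_le_iff)
      then show ?thesis using f by (simp add: algebra_simps)
    qed
    have "(\<integral>x. \<xi> x * ?g x \<partial>\<mu>) = (\<Sum>w\<in>W N. \<integral>x. wt w x * (\<xi> (cmp w x) * ?g (cmp w x)) \<partial>\<mu>)"
    proof (rule integral_words[where B="1 * 1"])
      show "\<bar>\<xi> x * ?g x\<bar> \<le> 1 * 1" for x
        unfolding abs_mult using \<xi>[of x] g[of x] by (intro mult_mono) auto
    qed measurable
    also have "\<bar>\<dots>\<bar> \<le> (\<Sum>w\<in>W N. qm w * (t w * (2 + Cm) * U + Lam R * s + Cm * \<gamma> ^ l * U))"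
      by (rule order_trans[OF sum_abs sum_mono[OF piece]])
    also have "\<dots> = (\<Sum>w\<in>W N. (qm w * t w) * ((2 + Cm) * U) + qm w * (Lam R * s + Cm * \<gamma> ^ l * U))"
      by (intro sum.cong) (auto simp: algebra_simps)
    also have "\<dots> = V * ((2 + Cm) * U) + (\<Sum>w\<in>W N. qm w) * (Lam R * s + Cm * \<gamma> ^ l * U)"
      by (simp only: V_def sum_distrib_right sum.distrib)
    also have "\<dots> = V * ((2 + Cm) * (Cb * r ^ d)) + V * ((2 + Cm) * (Lam R * s)) + Lam R * s
        + Cm * \<gamma> ^ l * (Cb * r ^ d) + Cm * \<gamma> ^ l * (Lam R * s)"
      by (simp add: qm_sum U_def algebra_simps)
    also have "\<dots> \<le> V * ((2 + Cm) * (Cb * r ^ d)) + 1 * ((2 + Cm) * (Lam R * s)) + Lam R * s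
        + (2 + Cm) * \<gamma> ^ l * (Cb * r ^ d) + Cm * 1 * (Lam R * s)"
      using V g1 Cm Lam_nonneg[OF R] s r Cb_nonneg by (intro add_mono mult_right_mono mult_left_mono) auto
    also have "\<dots> = ((2 + Cm) * Cb) * ((V + \<gamma> ^ l) * r ^ d) + ((3 + 2 * Cm) * Lam R * D) * \<rho> ^ N"
      by (simp add: s_def algebra_simps)
    also have "\<dots> \<le> C * ((V + \<gamma> ^ l) * r ^ d) + C * \<rho> ^ N"
      using Cm Lam_nonneg[OF R] D_pos r Cb_nonneg V \<rho>
      by (intro add_mono mult_right_mono) (auto simp: C_def)
    finally show "\<bar>\<integral>x. \<xi> x * ?g x \<partial>\<mu>\<bar> \<le> C * (((\<Sum>w\<in>W N. qm w * t w) + \<gamma> ^ l) * r ^ d + \<rho> ^ N)"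
      by (simp add: V_def distrib_left)
  qed (use Cm in auto)
qed

end

section \<open>The variance of the return count\<close>

context measured_chain
begin

text \<open>
  This is \<open>return_decorrelation\<close> for the constant function 1, with all of the time spent on freezing the
  centre of the target.
\<close>

lemma hit_mean:
  assumes R: "0 \<le> R"
  obtains C where "0 \<le> C" "\<And>n r. 0 \<le> r \<Longrightarrow> r \<le> R \<Longrightarrow> (\<integral>x. hit n r x \<partial>\<mu>) \<le> C * (r ^ d + \<rho> ^ n)"
    "\<And>n r. 0 \<le> r \<Longrightarrow> r \<le> R \<Longrightarrow> (\<integral>x. ball_mass r x \<partial>\<mu>) \<le> C * (r ^ d + \<rho> ^ n)"
proof -
  obtain C \<gamma> where C: "0 \<le> C" "0 < \<gamma>" "\<gamma> < 1"
    and dec: "\<And>N l r \<xi> z t. 0 \<le> r \<Longrightarrow> r \<le> R \<Longrightarrow> \<xi> \<in> borel_measurable borel \<Longrightarrow> (\<And>x. 0 \<le> \<xi> x \<and> \<xi> x \<le> 1) \<Longrightarrow>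
      (\<And>w. w \<in> W N \<Longrightarrow> 0 \<le> z w \<and> z w \<le> 1 \<and> 0 \<le> t w \<and> t w \<le> 1) \<Longrightarrow>
      (\<And>w. w \<in> W N \<Longrightarrow> AE x in \<mu>. \<bar>\<xi> (cmp w x) - z w\<bar> \<le> t w) \<Longrightarrow>
      \<bar>\<integral>x. \<xi> x * (hit (N + l) r x - ball_mass r x) \<partial>\<mu>\<bar>
        \<le> C * (((\<Sum>w\<in>W N. qm w * t w) + \<gamma> ^ l) * r ^ d + \<rho> ^ N)"
    using return_decorrelation[OF R] by blast
  have ih: "integrable \<mu> (hit n r)" for n r
    by (rule integrable_const_bound[where B=1]) (use hit_01 in auto)
  have ib: "integrable \<mu> (ball_mass r)" for r
    by (rule integrable_const_bound[where B=1]) (use ball_mass_01 in auto)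
  have b: "(\<integral>x. ball_mass r x \<partial>\<mu>) \<le> Cb * r ^ d" if "0 \<le> r" for r
  proof -
    have "(\<integral>x. ball_mass r x \<partial>\<mu>) \<le> (\<integral>x. Cb * r ^ d \<partial>\<mu>)"
      by (rule integral_mono[OF ib]) (auto simp: ball_mass_def measure_ball_le[OF that])
    then show ?thesis by simp
  qed
  show ?thesis
  proof (rule that[of "C + Cb"])
    show "0 \<le> C + Cb" using C Cb_nonneg by simp
    fix n r assume r: "0 \<le> r" "r \<le> R"
    have r0: "0 \<le> r ^ d" "0 \<le> \<rho> ^ n" using r \<rho> by auto
    have "Cb * r ^ d \<le> Cb * (r ^ d + \<rho> ^ n)" using Cb_nonneg r0 by (intro mult_left_mono) auto
    moreover have "0 \<le> C * (r ^ d + \<rho> ^ n)" using C r0 by simp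
    ultimately show "(\<integral>x. ball_mass r x \<partial>\<mu>) \<le> (C + Cb) * (r ^ d + \<rho> ^ n)"
      using b[OF r(1)] by (simp add: distrib_right)
    have "\<bar>\<integral>x. 1 * (hit (n + 0) r x - ball_mass r x) \<partial>\<mu>\<bar> \<le> C * (((\<Sum>w\<in>W n. qm w * 0) + \<gamma> ^ 0) * r ^ d + \<rho> ^ n)"
      by (rule dec[of r "\<lambda>_. 1" n "\<lambda>_. 1" "\<lambda>_. 0" 0]) (use r in auto)
    then have "(\<integral>x. hit n r x \<partial>\<mu>) \<le> (\<integral>x. ball_mass r x \<partial>\<mu>) + C * (r ^ d + \<rho> ^ n)"
      using ih ib by (simp add: abs_le_iff)
    then show "(\<integral>x. hit n r x \<partial>\<mu>) \<le> (C + Cb) * (r ^ d + \<rho> ^ n)"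
      using b[OF r(1)] \<open>Cb * r ^ d \<le> Cb * (r ^ d + \<rho> ^ n)\<close> by (simp add: distrib_right)
  qed
qed

text \<open>
  On a cylinder of generation \<open>a + j\<close> the distance from \<open>x\<close> to \<open>(T ^^ a) x\<close> varies by at most
  \<open>2 * \<rho> ^ j * D\<close>, so the event of a return at time \<open>a\<close> is decided by the cylinder unless this distance
  is that close to \<open>r\<close>. Fixing the first \<open>a\<close> letters also fixes \<open>x\<close> up to \<open>\<rho> ^ a * D\<close>, and the
  undecided cylinders map under \<open>T ^^ a\<close> into a thin shell around a fixed centre.
\<close>

lemma cylinder_shell_mass:
  assumes R: "0 \<le> R" and r: "0 \<le> r" "r \<le> R" and y0: "y0 \<in> K"
  shows "(\<Sum>w\<in>W (a + j). qm w * (if \<bar>dist (cmp (drop a w) y0) (cmp w y0) - r\<bar> \<le> 2 * \<rho> ^ j * D then 1 else 0))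
     \<le> 8 * E * Lam R * D * (\<rho> ^ j + \<rho> ^ a)"
proof -
  let ?I = "\<lambda>w. if \<bar>dist (cmp (drop a w) y0) (cmp w y0) - r\<bar> \<le> 2 * \<rho> ^ j * D then 1 else 0::real"
  define e where "e = 3 * (\<rho> ^ j * D) + \<rho> ^ a * D"
  have \<rho>1: "\<rho> ^ j \<le> 1" "\<rho> ^ a \<le> 1" "0 < \<rho> ^ j" "0 < \<rho> ^ a" using \<rho> by (auto intro: power_le_one)
  have jD: "0 \<le> \<rho> ^ j * D" "\<rho> ^ j * D \<le> D" "0 \<le> \<rho> ^ a * D" "\<rho> ^ a * D \<le> D"
    using \<rho>1 D_pos mult_right_mono[of "\<rho> ^ j" 1 D] mult_right_mono[of "\<rho> ^ a" 1 D] by auto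
  have "0 < \<rho> ^ a * D" using \<rho>1 D_pos by simp
  then have e: "0 < e" "2 * e \<le> 8 * D"
  proof -
    have "x \<le> D \<Longrightarrow> y \<le> D \<Longrightarrow> 2 * (3 * x + y) \<le> 8 * D" for x y :: real by simp
    then show "2 * e \<le> 8 * D" unfolding e_def using jD(2,4) .
  qed (use jD in \<open>simp add: e_def add_nonneg_pos\<close>)
  have "(\<Sum>w\<in>W (a + j). qm w * ?I w) = (\<Sum>v\<in>W a. \<Sum>w\<in>W j. qm (v @ w) * ?I (v @ w))"
    by (rule sum_words_add)
  also have "\<dots> \<le> (\<Sum>v\<in>W a. E * qm v * (Lam R * (2 * e)))"
  proof (rule sum_mono)
    fix v assume v: "v \<in> W a"
    define x0 where "x0 = cmp v y0"
    define J :: "'a \<Rightarrow> real" where "J = indicator {x. \<bar>dist x x0 - r\<bar> \<le> e}"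
    have Jm [measurable]: "J \<in> borel_measurable borel" unfolding J_def by measurable
    have E0: "0 \<le> E * qm v" using E_ge_1 qm_nonneg[OF v] by simp
    have "(\<Sum>w\<in>W j. qm (v @ w) * ?I (v @ w)) \<le> (\<Sum>w\<in>W j. E * qm v * (\<integral>x. wt w x * J (cmp w x) \<partial>\<mu>))"
    proof (rule sum_mono)
      fix w assume w: "w \<in> W j"
      note [measurable] = wt_meas[OF w] cmp_meas[OF w]
      have lv: "length v = a" using v by (simp add: words_def)
      have intJ: "integrable \<mu> (\<lambda>x. wt w x * J (cmp w x))"
        by (rule integrable_bounded_on_K[where B=1])
           (use wt_le_1[OF w] wt_pos[OF w] in \<open>auto simp: J_def indicator_def abs_of_pos\<close>)
      have Jn: "AE x in \<mu>. 0 \<le> wt w x * J (cmp w x)"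
        using AE_K by eventually_elim (use wt_pos[OF w] in \<open>simp add: J_def less_imp_le\<close>)
      show "qm (v @ w) * ?I (v @ w) \<le> E * qm v * (\<integral>x. wt w x * J (cmp w x) \<partial>\<mu>)"
      proof (cases "?I (v @ w) = 0")
        case True
        show ?thesis using integral_nonneg_AE[OF Jn] E0 unfolding True by simp
      next
        case False
        then have "\<bar>dist (cmp w y0) (cmp v (cmp w y0)) - r\<bar> \<le> 2 * \<rho> ^ j * D"
          by (simp add: lv word_comp_append split: if_splits)
        moreover have "dist x0 (cmp v (cmp w y0)) \<le> \<rho> ^ a * D"
          unfolding x0_def by (rule cmp_dist[OF v y0 cmp_in[OF w y0]])
        ultimately have c: "\<bar>dist (cmp w y0) x0 - r\<bar> \<le> 2 * \<rho> ^ j * D + \<rho> ^ a * D"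
          using dist_triangle[of "cmp w y0" x0 "cmp v (cmp w y0)"]
            dist_triangle[of "cmp w y0" "cmp v (cmp w y0)" x0] by (simp add: dist_commute abs_le_iff)
        have "AE x in \<mu>. wt w x * J (cmp w x) = wt w x"
          using AE_K
        proof eventually_elim
          case (elim x)
          have "dist (cmp w x) (cmp w y0) \<le> \<rho> ^ j * D" by (rule cmp_dist[OF w elim y0])
          then have "\<bar>dist (cmp w x) x0 - r\<bar> \<le> e"
            using c dist_triangle[of "cmp w x" x0 "cmp w y0"] dist_triangle[of "cmp w y0" x0 "cmp w x"]
            by (simp add: dist_commute abs_le_iff e_def)
          then show ?case by (simp add: J_def)
        qed
        then have "(\<integral>x. wt w x * J (cmp w x) \<partial>\<mu>) = qm w"
          unfolding qm_def by (intro integral_cong_AE) auto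
        then show ?thesis using qm_append[OF v w] qm_nonneg[of "v @ w" "a + j"] v w by (auto simp: words_def)
      qed
    qed
    also have "\<dots> = E * qm v * (\<integral>x. J x \<partial>\<mu>)"
      unfolding sum_distrib_left[symmetric]
      by (subst integral_words[of J 1 j]) (auto simp: J_def indicator_def)
    also have "\<dots> \<le> E * qm v * (Lam R * (2 * e))"
    proof (rule mult_left_mono[OF _ E0])
      have "(\<integral>x. J x \<partial>\<mu>) = measure \<mu> {x. \<bar>dist x x0 - r\<bar> \<le> e}" by (simp add: J_def)
      also have "\<dots> \<le> measure \<mu> (ball x0 (r + 2 * e) - ball x0 (r - 2 * e))"
      proof (rule finite_measure_mono)
        show "{x. \<bar>dist x x0 - r\<bar> \<le> e} \<subseteq> ball x0 (r + 2 * e) - ball x0 (r - 2 * e)"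
          using e by (auto simp: dist_commute)
      qed auto
      also have "\<dots> = ball_mass (r + 2 * e) x0 - ball_mass (r - 2 * e) x0"
        unfolding ball_mass_def by (rule finite_measure_Diff) (use e in \<open>auto simp: subset_ball\<close>)
      also have "\<dots> \<le> Lam R * (2 * e)"
        by (rule ball_mass_annulus) (use r e in auto)
      finally show "(\<integral>x. J x \<partial>\<mu>) \<le> Lam R * (2 * e)" .
    qed
    finally show "(\<Sum>w\<in>W j. qm (v @ w) * ?I (v @ w)) \<le> E * qm v * (Lam R * (2 * e))" .
  qed
  also have "\<dots> = E * Lam R * (2 * e)"
    by (simp add: qm_sum algebra_simps flip: sum_distrib_left sum_distrib_right)
  also have "\<dots> \<le> E * Lam R * (8 * D * (\<rho> ^ j + \<rho> ^ a))"
  proof (rule mult_left_mono)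
    show "2 * e \<le> 8 * D * (\<rho> ^ j + \<rho> ^ a)" using jD by (simp add: e_def algebra_simps)
    show "0 \<le> E * Lam R" using E_ge_1 Lam_nonneg[OF R] by simp
  qed
  also have "\<dots> = 8 * E * Lam R * D * (\<rho> ^ j + \<rho> ^ a)" by (simp only: mult_ac)
  finally show ?thesis .
qed

text \<open>
  The time from \<open>a\<close> to \<open>n\<close> is split in halves. Cylinders of generation \<open>a + (n - a) div 2\<close> nearly
  decide the return at time \<open>a\<close>, and the remaining steps are available for mixing.
\<close>

lemma covariance_bound:
  assumes R: "0 \<le> R"
  obtains C \<tau> where "0 \<le> C" "0 < \<tau>" "\<tau> < 1" "\<rho> \<le> \<tau>"
    "\<And>a n r r'. a < n \<Longrightarrow> 0 \<le> r \<Longrightarrow> r \<le> R \<Longrightarrow> 0 \<le> r' \<Longrightarrow> r' \<le> R \<Longrightarrow>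
      \<bar>\<integral>x. (hit a r' x - ball_mass r' x) * (hit n r x - ball_mass r x) \<partial>\<mu>\<bar>
        \<le> C * ((\<tau> ^ (n - a) + \<tau> ^ a) * r ^ d + \<tau> ^ n)"
proof -
  obtain C \<gamma> where C: "0 \<le> C" "0 < \<gamma>" "\<gamma> < 1"
    and dec: "\<And>N l r \<xi> z t. 0 \<le> r \<Longrightarrow> r \<le> R \<Longrightarrow> \<xi> \<in> borel_measurable borel \<Longrightarrow> (\<And>x. 0 \<le> \<xi> x \<and> \<xi> x \<le> 1) \<Longrightarrow>
      (\<And>w. w \<in> W N \<Longrightarrow> 0 \<le> z w \<and> z w \<le> 1 \<and> 0 \<le> t w \<and> t w \<le> 1) \<Longrightarrow>
      (\<And>w. w \<in> W N \<Longrightarrow> AE x in \<mu>. \<bar>\<xi> (cmp w x) - z w\<bar> \<le> t w) \<Longrightarrow>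
      \<bar>\<integral>x. \<xi> x * (hit (N + l) r x - ball_mass r x) \<partial>\<mu>\<bar>
        \<le> C * (((\<Sum>w\<in>W N. qm w * t w) + \<gamma> ^ l) * r ^ d + \<rho> ^ N)"
    using return_decorrelation[OF R] by blast
  obtain y0 where y0: "y0 \<in> K" using K_ne by auto
  define \<theta> where "\<theta> = max \<rho> \<gamma>"
  have \<theta>: "0 < \<theta>" "\<theta> < 1" "\<rho> \<le> \<theta>" "\<gamma> \<le> \<theta>" using \<rho> C by (auto simp: \<theta>_def)
  \<comment> \<open>the square root accounts for the fact that only half of the time is available for each effect\<close>
  define \<tau> where "\<tau> = sqrt \<theta>"
  have \<tau>: "0 < \<tau>" "\<tau> < 1" "\<tau> ^ 2 = \<theta>" using \<theta> by (auto simp: \<tau>_def)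
  have \<theta>\<tau>: "\<theta> ^ i \<le> \<tau> ^ k / \<tau>" if "k \<le> 2 * i + 1" for i k
  proof -
    have "\<tau> * \<theta> ^ i = \<tau> ^ (2 * i + 1)" by (simp add: power_mult flip: \<tau>(3))
    also have "\<dots> \<le> \<tau> ^ k" using \<tau> that by (intro power_decreasing) auto
    finally show ?thesis using \<tau> by (simp add: field_simps)
  qed
  define Q where "Q = 8 * E * Lam R * D + Lam R * D + 1"
  have LE: "0 \<le> E * Lam R * D" "0 \<le> Lam R * D" using E_ge_1 Lam_nonneg[OF R] D_pos by auto
  show ?thesis
  proof (rule that[of "(C * (4 * Q + 2)) / \<tau>" \<tau>])
    show "0 \<le> (C * (4 * Q + 2)) / \<tau>" using C LE \<tau> by (simp add: Q_def)
    have "\<tau> * \<tau> \<le> \<tau> * 1" using \<tau> by (intro mult_left_mono) auto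
    then show "\<rho> \<le> \<tau>" using \<tau>(3) \<theta> by (simp add: power2_eq_square)
    fix a n :: nat and r r' :: real assume an: "a < n" and r: "0 \<le> r" "r \<le> R" and r': "0 \<le> r'" "r' \<le> R"
    define j where "j = (n - a) div 2"
    define l where "l = n - a - j"
    define N where "N = a + j"
    have n: "n = N + l" "j \<le> l" "n - a \<le> 2 * j + 1" "n - a \<le> 2 * l + 1" "n \<le> 2 * N + 1"
      using an by (auto simp: N_def l_def j_def)
    have \<rho>0: "0 \<le> \<rho> ^ i" for i using \<rho> by simp
    have \<rho>\<theta>: "\<rho> ^ i \<le> \<theta> ^ i" "\<gamma> ^ i \<le> \<theta> ^ i" for i using \<rho> \<theta> C by (auto intro: power_mono)
    let ?S = "\<lambda>w. dist (cmp (drop a w) y0) (cmp w y0)"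
    let ?t1 = "\<lambda>w. if \<bar>?S w - r'\<bar> \<le> 2 * \<rho> ^ j * D then 1 else 0::real"
    let ?z1 = "\<lambda>w. if ?S w < r' then 1 else 0::real"
    have H: "\<bar>\<integral>x. hit a r' x * (hit n r x - ball_mass r x) \<partial>\<mu>\<bar>
        \<le> C * (((\<Sum>w\<in>W N. qm w * ?t1 w) + \<gamma> ^ l) * r ^ d + \<rho> ^ N)"
      unfolding n(1)
    proof (rule dec[OF r hit_meas])
      fix w assume w: "w \<in> W N"
      define v u where "v = take a w" and "u = drop a w"
      have vu: "w = v @ u" "v \<in> W a" "u \<in> W j"
        using w by (auto simp: v_def u_def words_def N_def dest: in_set_takeD in_set_dropD)
      show "AE x in \<mu>. \<bar>hit a r' (cmp w x) - ?z1 w\<bar> \<le> ?t1 w"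
        using AE_cmp[OF AE_T_cmp[OF vu(2)] vu(3)] AE_K
      proof eventually_elim
        case (elim x)
        have T: "(T ^^ a) (cmp w x) = cmp u x" using elim(1) by (simp add: vu(1) word_comp_append)
        have 1: "dist (cmp u x) (cmp u y0) \<le> \<rho> ^ j * D" by (rule cmp_dist[OF vu(3) elim(2) y0])
        have "dist (cmp w x) (cmp w y0) \<le> \<rho> ^ N * D" by (rule cmp_dist[OF w elim(2) y0])
        also have "\<dots> \<le> \<rho> ^ j * D"
          using \<rho> D_pos by (intro mult_right_mono power_decreasing) (auto simp: N_def)
        finally have 2: "dist (cmp w x) (cmp w y0) \<le> \<rho> ^ j * D" .
        have "\<bar>dist (cmp u x) (cmp w x) - ?S w\<bar> \<le> 2 * \<rho> ^ j * D"
          using 1 2 dist_triangle[of "cmp u x" "cmp w x" "cmp u y0"] dist_triangle[of "cmp u y0" "cmp w x" "cmp w y0"]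
            dist_triangle[of "cmp u y0" "cmp w y0" "cmp u x"] dist_triangle[of "cmp u x" "cmp w y0" "cmp w x"]
          unfolding u_def[symmetric] by (simp add: dist_commute abs_le_iff)
        moreover have "hit a r' (cmp w x) = (if dist (cmp u x) (cmp w x) < r' then 1 else 0)"
          by (simp add: hit_def T indicator_def dist_commute)
        ultimately show ?case by (auto simp: abs_le_iff)
      qed
    qed (use hit_01 in auto)
    have Vh: "(\<Sum>w\<in>W N. qm w * ?t1 w) \<le> Q * (\<theta> ^ j + \<theta> ^ a)"
    proof -
      have "(\<Sum>w\<in>W N. qm w * ?t1 w) \<le> 8 * E * Lam R * D * (\<rho> ^ j + \<rho> ^ a)"
        unfolding N_def by (rule cylinder_shell_mass[OF R r' y0])
      also have "\<dots> \<le> Q * (\<theta> ^ j + \<theta> ^ a)"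
        using LE \<rho>\<theta> \<rho>0 by (intro mult_mono add_mono) (auto simp: Q_def)
      finally show ?thesis .
    qed
    let ?t2 = "\<lambda>w. min 1 (Lam R * (\<rho> ^ N * D))"
    have B: "\<bar>\<integral>x. ball_mass r' x * (hit n r x - ball_mass r x) \<partial>\<mu>\<bar>
        \<le> C * (((\<Sum>w\<in>W N. qm w * ?t2 w) + \<gamma> ^ l) * r ^ d + \<rho> ^ N)"
      unfolding n(1)
    proof (rule dec[of r "ball_mass r'" N "\<lambda>w. ball_mass r' (cmp w y0)" ?t2 l])
      fix w assume w: "w \<in> W N"
      have sD: "\<rho> ^ N * D \<le> 8 * D" "0 \<le> \<rho> ^ N * D"
        using \<rho> D_pos mult_right_mono[OF power_le_one[of \<rho> N], of D] by auto
      show "AE x in \<mu>. \<bar>ball_mass r' (cmp w x) - ball_mass r' (cmp w y0)\<bar> \<le> ?t2 w"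
        using AE_K
      proof eventually_elim
        case (elim x)
        let ?x = "cmp w x" and ?y = "cmp w y0"
        have dd: "dist ?x ?y \<le> \<rho> ^ N * D" by (rule cmp_dist[OF w elim y0])
        have s1: "ball ?x r' \<subseteq> ball ?y (r' + \<rho> ^ N * D)"
        proof
          fix q assume "q \<in> ball ?x r'"
          then show "q \<in> ball ?y (r' + \<rho> ^ N * D)" using dd dist_triangle[of ?y q ?x] by (simp add: dist_commute)
        qed
        have s2: "ball ?y (r' - \<rho> ^ N * D) \<subseteq> ball ?x r'"
        proof
          fix q assume "q \<in> ball ?y (r' - \<rho> ^ N * D)"
          then show "q \<in> ball ?x r'" using dd dist_triangle[of ?x q ?y] by (simp add: dist_commute)
        qed
        have s3: "ball ?y r' \<subseteq> ball ?y (r' + \<rho> ^ N * D)" "ball ?y (r' - \<rho> ^ N * D) \<subseteq> ball ?y r'"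
          using sD by (auto simp: subset_ball)
        have "\<bar>ball_mass r' ?x - ball_mass r' ?y\<bar> \<le> Lam R * (\<rho> ^ N * D)"
          using ball_mass_annulus(1)[OF r' sD(2,1), of ?y] ball_mass_mono[OF s1] ball_mass_mono[OF s2]
            ball_mass_mono[OF s3(1)] ball_mass_mono[OF s3(2)] by (simp add: abs_le_iff)
        moreover have "\<bar>ball_mass r' ?x - ball_mass r' ?y\<bar> \<le> 1"
          using ball_mass_01[of r' ?x] ball_mass_01[of r' ?y] by (simp add: abs_le_iff)
        ultimately show ?case by simp
      qed
    qed (use r ball_mass_01 Lam_nonneg[OF R] D_pos \<rho> in auto)
    have Vb: "(\<Sum>w\<in>W N. qm w * ?t2 w) \<le> Q * (\<theta> ^ j + \<theta> ^ a)"
    proof -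
      have "(\<Sum>w\<in>W N. qm w * ?t2 w) = ?t2 []" by (simp add: qm_sum flip: sum_distrib_right)
      also have "\<dots> \<le> (Lam R * D) * \<rho> ^ N" by (simp add: mult_ac)
      also have "\<dots> \<le> Q * (\<theta> ^ j + \<theta> ^ a)"
      proof (rule mult_mono)
        have "\<rho> ^ N \<le> \<rho> ^ a" using \<rho> by (intro power_decreasing) (auto simp: N_def)
        then show "\<rho> ^ N \<le> \<theta> ^ j + \<theta> ^ a" using \<rho>\<theta>(1)[of a] \<theta> by (simp add: add_increasing)
      qed (use LE \<rho> in \<open>auto simp: Q_def\<close>)
      finally show ?thesis .
    qed
    have tot: "C * ((V + \<gamma> ^ l) * r ^ d + \<rho> ^ N) \<le> (C * (2 * Q + 1)) / \<tau> * ((\<tau> ^ (n - a) + \<tau> ^ a) * r ^ d + \<tau> ^ n)"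
      if V: "V \<le> Q * (\<theta> ^ j + \<theta> ^ a)" for V
    proof -
      have Q1: "1 \<le> Q" using LE by (simp add: Q_def)
      have "V + \<gamma> ^ l \<le> Q * (\<tau> ^ (n - a) / \<tau> + \<tau> ^ a / \<tau>) + \<tau> ^ (n - a) / \<tau>"
      proof (rule add_mono)
        show "V \<le> Q * (\<tau> ^ (n - a) / \<tau> + \<tau> ^ a / \<tau>)"
          using V Q1 by (elim order_trans) (intro mult_left_mono add_mono \<theta>\<tau> n, auto)
        show "\<gamma> ^ l \<le> \<tau> ^ (n - a) / \<tau>" using \<rho>\<theta>(2)[of l] \<theta>\<tau>[OF n(4)] by linarith
      qed
      also have "\<dots> \<le> (2 * Q + 1) / \<tau> * (\<tau> ^ (n - a) + \<tau> ^ a)"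
        using \<tau> Q1 by (simp add: field_simps)
      finally have 1: "(V + \<gamma> ^ l) * r ^ d \<le> ((2 * Q + 1) / \<tau> * (\<tau> ^ (n - a) + \<tau> ^ a)) * r ^ d"
        using r by (intro mult_right_mono) auto
      have 2: "\<rho> ^ N \<le> (2 * Q + 1) / \<tau> * \<tau> ^ n"
      proof -
        have "\<rho> ^ N \<le> 1 * (\<tau> ^ n / \<tau>)" using \<rho>\<theta>(1)[of N] \<theta>\<tau>[OF n(5)] by simp
        also have "\<dots> \<le> (2 * Q + 1) * (\<tau> ^ n / \<tau>)" using Q1 \<tau> by (intro mult_right_mono) auto
        finally show ?thesis by simp
      qed
      have "(V + \<gamma> ^ l) * r ^ d + \<rho> ^ N \<le> (2 * Q + 1) / \<tau> * ((\<tau> ^ (n - a) + \<tau> ^ a) * r ^ d + \<tau> ^ n)"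
        using add_mono[OF 1 2]
        by (simp only: distrib_left[of "(2 * Q + 1) / \<tau>" "(\<tau> ^ (n - a) + \<tau> ^ a) * r ^ d"] mult.assoc)
      from mult_left_mono[OF this C(1)] show ?thesis by simp
    qed
    have i: "integrable \<mu> (\<lambda>x. f x * (hit n r x - ball_mass r x))"
      if "f \<in> borel_measurable borel" "\<And>x. 0 \<le> f x \<and> f x \<le> 1" for f
    proof (rule integrable_bounded_on_K[where B="1 * 1"])
      show "\<bar>f x * (hit n r x - ball_mass r x)\<bar> \<le> 1 * 1" for x
        unfolding abs_mult using that(2)[of x] hit_01[of n r x] ball_mass_01[of r x] by (intro mult_mono) auto
    qed (use that in measurable)
    have "(\<integral>x. (hit a r' x - ball_mass r' x) * (hit n r x - ball_mass r x) \<partial>\<mu>)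
       = (\<integral>x. hit a r' x * (hit n r x - ball_mass r x) \<partial>\<mu>) - (\<integral>x. ball_mass r' x * (hit n r x - ball_mass r x) \<partial>\<mu>)"
      by (subst Bochner_Integration.integral_diff[symmetric])
         (use i[OF hit_meas[of a r']] i[OF ball_mass_meas[of r']] hit_01 ball_mass_01 in \<open>auto simp: left_diff_distrib\<close>)
    also have "\<bar>\<dots>\<bar> \<le> 2 * ((C * (2 * Q + 1)) / \<tau> * ((\<tau> ^ (n - a) + \<tau> ^ a) * r ^ d + \<tau> ^ n))"
      using order_trans[OF H tot[OF Vh]] order_trans[OF B tot[OF Vb]] by linarith
    also have "\<dots> = (C * (4 * Q + 2)) / \<tau> * ((\<tau> ^ (n - a) + \<tau> ^ a) * r ^ d + \<tau> ^ n)"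
      by (simp add: field_simps)
    finally show "\<bar>\<integral>x. (hit a r' x - ball_mass r' x) * (hit n r x - ball_mass r x) \<partial>\<mu>\<bar>
        \<le> (C * (4 * Q + 2)) / \<tau> * ((\<tau> ^ (n - a) + \<tau> ^ a) * r ^ d + \<tau> ^ n)" .
  qed (use \<tau> in auto)
qed

text \<open>
  For fixed \<open>n\<close> the covariance bounds sum over the earlier times to a multiple of
  \<open>r n ^ d + (n + 1) * \<tau> ^ n\<close>, which also bounds the diagonal term.
\<close>

lemma return_variance:
  assumes r: "\<And>n. 0 \<le> r n" "\<And>n. r n \<le> R"
  obtains \<tau> C where "0 < \<tau>" "\<tau> < 1" "\<rho> \<le> \<tau>" "0 \<le> C"
    "\<And>l k. l \<le> k \<Longrightarrow> (\<integral>x. (\<Sum>n\<in>{l..<k}. hit n (r n) x - ball_mass (r n) x)\<^sup>2 \<partial>\<mu>)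
        \<le> C * (\<Sum>n\<in>{l..<k}. r n ^ d + (real n + 1) * \<tau> ^ n)"
proof -
  have R: "0 \<le> R" using r[of 0] by linarith
  obtain C1 \<tau> where C1: "0 \<le> C1" and \<tau>: "0 < \<tau>" "\<tau> < 1" "\<rho> \<le> \<tau>"
    and cov: "\<And>a n r r'. a < n \<Longrightarrow> 0 \<le> r \<Longrightarrow> r \<le> R \<Longrightarrow> 0 \<le> r' \<Longrightarrow> r' \<le> R \<Longrightarrow>
      \<bar>\<integral>x. (hit a r' x - ball_mass r' x) * (hit n r x - ball_mass r x) \<partial>\<mu>\<bar>
        \<le> C1 * ((\<tau> ^ (n - a) + \<tau> ^ a) * r ^ d + \<tau> ^ n)"
    using covariance_bound[OF R] by blast
  obtain C2 where C2: "0 \<le> C2" and mh: "\<And>n r. 0 \<le> r \<Longrightarrow> r \<le> R \<Longrightarrow> (\<integral>x. hit n r x \<partial>\<mu>) \<le> C2 * (r ^ d + \<rho> ^ n)"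
    and mb: "\<And>n r. 0 \<le> r \<Longrightarrow> r \<le> R \<Longrightarrow> (\<integral>x. ball_mass r x \<partial>\<mu>) \<le> C2 * (r ^ d + \<rho> ^ n)"
    using hit_mean[OF R] by blast
  define c where "c n = r n ^ d + (real n + 1) * \<tau> ^ n" for n
  define f where "f n x = hit n (r n) x - ball_mass (r n) x" for n x
  have fm [measurable]: "f n \<in> borel_measurable borel" for n unfolding f_def by measurable
  have f1: "\<bar>f n x\<bar> \<le> 1" for n x
    using hit_01[of n "r n" x] ball_mass_01[of "r n" x] by (auto simp: f_def abs_le_iff)
  have ih: "integrable \<mu> (hit n s)" for n s
    by (rule integrable_const_bound[where B=1]) (use hit_01 in auto)
  have ib: "integrable \<mu> (ball_mass s)" for s
    by (rule integrable_const_bound[where B=1]) (use ball_mass_01 in auto)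
  have iff: "integrable \<mu> (\<lambda>x. f a x * f n x)" for a n
  proof (rule integrable_bounded_on_K[where B="1 * 1"])
    show "\<bar>f a x * f n x\<bar> \<le> 1 * 1" for x unfolding abs_mult by (intro mult_mono f1) auto
  qed measurable
  have sq: "(\<integral>x. f n x * f n x \<partial>\<mu>) \<le> 2 * C2 * c n" for n
  proof -
    have "(\<integral>x. f n x * f n x \<partial>\<mu>) \<le> (\<integral>x. hit n (r n) x + ball_mass (r n) x \<partial>\<mu>)"
    proof (rule integral_mono[OF iff])
      fix x
      have "f n x * f n x \<le> \<bar>f n x\<bar> * 1"
        using mult_left_mono[OF f1[of n x], of "\<bar>f n x\<bar>"] by (simp flip: abs_mult)
      also have "\<dots> \<le> hit n (r n) x + ball_mass (r n) x"
        using hit_01[of n "r n" x] ball_mass_01[of "r n" x] by (auto simp: f_def abs_le_iff)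
      finally show "f n x * f n x \<le> hit n (r n) x + ball_mass (r n) x" .
    qed (use ih ib in auto)
    also have "\<dots> \<le> 2 * (C2 * (r n ^ d + \<rho> ^ n))"
      using mh[OF r, of n n] mb[OF r, of n n] ih ib by simp
    also have "\<dots> \<le> 2 * (C2 * c n)"
    proof -
      have "\<rho> ^ n \<le> 1 * \<tau> ^ n" using \<rho> \<tau> by (simp add: power_mono)
      also have "\<dots> \<le> (real n + 1) * \<tau> ^ n" using \<tau> by (intro mult_right_mono) auto
      finally show ?thesis using C2 by (intro mult_left_mono) (auto simp: c_def)
    qed
    finally show ?thesis by simp
  qed
  define C3 where "C3 = C1 * (2 / (1 - \<tau>) + 1)"
  have C30: "0 \<le> C3" using C1 \<tau> by (simp add: C3_def)
  have cross: "(\<Sum>a\<in>{l..<n}. \<integral>x. f a x * f n x \<partial>\<mu>) \<le> C3 * c n" for l n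
  proof -
    have g: "(\<Sum>i<n. \<tau> ^ i) \<le> 1 / (1 - \<tau>)"
      using \<tau> by (simp add: sum_gp_strict divide_right_mono)
    have g': "(\<Sum>a<n. \<tau> ^ (n - a)) \<le> 1 / (1 - \<tau>)"
    proof -
      have "(\<Sum>a<n. \<tau> ^ (n - a)) \<le> (\<Sum>a<n. \<tau> ^ (n - Suc a))"
        using \<tau> by (intro sum_mono power_decreasing) auto
      also have "\<dots> = (\<Sum>a<n. \<tau> ^ a)" by (rule sum.nat_diff_reindex)
      finally show ?thesis using g by linarith
    qed
    have "(\<Sum>a\<in>{l..<n}. \<integral>x. f a x * f n x \<partial>\<mu>) \<le> (\<Sum>a\<in>{l..<n}. C1 * ((\<tau> ^ (n - a) + \<tau> ^ a) * r n ^ d + \<tau> ^ n))"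
    proof (rule sum_mono)
      fix a assume "a \<in> {l..<n}"
      then show "(\<integral>x. f a x * f n x \<partial>\<mu>) \<le> C1 * ((\<tau> ^ (n - a) + \<tau> ^ a) * r n ^ d + \<tau> ^ n)"
        using cov[OF _ r r, of a n a n] by (simp add: f_def abs_le_iff)
    qed
    also have "\<dots> \<le> (\<Sum>a<n. C1 * ((\<tau> ^ (n - a) + \<tau> ^ a) * r n ^ d + \<tau> ^ n))"
      using C1 \<tau> r(1)[of n] by (intro sum_mono2) auto
    also have "\<dots> = C1 * (((\<Sum>a<n. \<tau> ^ (n - a)) + (\<Sum>a<n. \<tau> ^ a)) * r n ^ d + real n * \<tau> ^ n)"
      by (simp add: sum_distrib_left[symmetric] sum_distrib_right[symmetric] sum.distrib)
    also have "\<dots> \<le> C1 * ((1 / (1 - \<tau>) + 1 / (1 - \<tau>)) * r n ^ d + (real n + 1) * \<tau> ^ n)"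
      using C1 \<tau> r(1)[of n] g g' by (intro mult_left_mono add_mono mult_right_mono) auto
    also have "\<dots> \<le> C1 * ((2 / (1 - \<tau>) + 1) * r n ^ d + (2 / (1 - \<tau>) + 1) * ((real n + 1) * \<tau> ^ n))"
    proof (rule mult_left_mono[OF add_mono C1])
      have "1 / (1 - \<tau>) + 1 / (1 - \<tau>) \<le> 2 / (1 - \<tau>) + 1" by simp
      then show "(1 / (1 - \<tau>) + 1 / (1 - \<tau>)) * r n ^ d \<le> (2 / (1 - \<tau>) + 1) * r n ^ d"
        by (rule mult_right_mono) (use r(1)[of n] in simp)
      have "1 * ((real n + 1) * \<tau> ^ n) \<le> (2 / (1 - \<tau>) + 1) * ((real n + 1) * \<tau> ^ n)"
        using \<tau> by (intro mult_right_mono) auto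
      then show "(real n + 1) * \<tau> ^ n \<le> (2 / (1 - \<tau>) + 1) * ((real n + 1) * \<tau> ^ n)" by simp
    qed
    also have "\<dots> = C3 * c n"
    proof -
      have "C1 * (k * x + k * y) = (C1 * k) * (x + y)" for k x y by (simp add: algebra_simps)
      then show ?thesis unfolding C3_def c_def .
    qed
    finally show ?thesis .
  qed
  show ?thesis
  proof (rule that[of \<tau> "2 * C2 + 2 * C3"])
    fix l k :: nat assume "l \<le> k"
    then have "(\<integral>x. (\<Sum>n\<in>{l..<k}. f n x)\<^sup>2 \<partial>\<mu>) \<le> (2 * C2 + 2 * C3) * (\<Sum>n\<in>{l..<k}. c n)"
    proof (induction k rule: dec_induct)
      case base
      then show ?case by simp
    next
      case (step k)
      have iS2: "integrable \<mu> (\<lambda>x. (\<Sum>n\<in>{l..<k}. f n x)\<^sup>2)"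
        unfolding power2_eq_square sum_product by (intro Bochner_Integration.integrable_sum iff)
      have iS: "integrable \<mu> (\<lambda>x. \<Sum>n\<in>{l..<k}. f n x * f k x)"
        by (intro Bochner_Integration.integrable_sum iff)
      have "(\<integral>x. (\<Sum>n\<in>{l..<Suc k}. f n x)\<^sup>2 \<partial>\<mu>)
          = (\<integral>x. (\<Sum>n\<in>{l..<k}. f n x)\<^sup>2 + 2 * (\<Sum>n\<in>{l..<k}. f n x * f k x) + f k x * f k x \<partial>\<mu>)"
        using step by (intro Bochner_Integration.integral_cong)
          (auto simp: power2_eq_square sum_distrib_right[symmetric] algebra_simps)
      also have "\<dots> = (\<integral>x. (\<Sum>n\<in>{l..<k}. f n x)\<^sup>2 \<partial>\<mu>) + 2 * (\<Sum>n\<in>{l..<k}. \<integral>x. f n x * f k x \<partial>\<mu>)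
          + (\<integral>x. f k x * f k x \<partial>\<mu>)"
        using iS2 iS iff by (simp add: Bochner_Integration.integral_sum)
      also have "\<dots> \<le> (2 * C2 + 2 * C3) * (\<Sum>n\<in>{l..<k}. c n) + 2 * (C3 * c k) + 2 * C2 * c k"
        by (intro add_mono step.IH mult_left_mono cross sq) auto
      also have "\<dots> = (2 * C2 + 2 * C3) * (\<Sum>n\<in>{l..<Suc k}. c n)"
        using step by (simp add: algebra_simps)
      finally show ?case .
    qed
    then show "(\<integral>x. (\<Sum>n\<in>{l..<k}. hit n (r n) x - ball_mass (r n) x)\<^sup>2 \<partial>\<mu>)
        \<le> (2 * C2 + 2 * C3) * (\<Sum>n\<in>{l..<k}. r n ^ d + (real n + 1) * \<tau> ^ n)"
      by (simp add: f_def c_def)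
  qed (use \<tau> C2 C30 in auto)
qed

text \<open>
  The terms \<open>(n + 1) * \<tau> ^ n\<close> are summable and enter the error only through constants.
\<close>

theorem return_count_error:
  assumes r: "\<And>n. 0 \<le> r n" "\<And>n. r n \<le> R" and e: "\<epsilon> > 0"
  shows "AE x in \<mu>. \<exists>C\<ge>0. \<forall>N. \<bar>\<Sum>n<N. hit n (r n) x - ball_mass (r n) x\<bar>
     \<le> C * (sqrt (1 + (\<Sum>n<N. r n ^ d)) * ln (2 + (\<Sum>n<N. r n ^ d)) powr (3/2 + \<epsilon>))"
proof -
  obtain \<tau> C1 where \<tau>: "0 < \<tau>" "\<tau> < 1" "\<rho> \<le> \<tau>" and C1: "0 \<le> C1"
    and var: "\<And>l k. l \<le> k \<Longrightarrow> (\<integral>x. (\<Sum>n\<in>{l..<k}. hit n (r n) x - ball_mass (r n) x)\<^sup>2 \<partial>\<mu>)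
        \<le> C1 * (\<Sum>n\<in>{l..<k}. r n ^ d + (real n + 1) * \<tau> ^ n)"
    by (rule return_variance[of r R, OF r]) (rule that)
  have R: "0 \<le> R" using r[of 0] by linarith
  obtain C2 where C2: "0 \<le> C2" and mh: "\<And>n r. 0 \<le> r \<Longrightarrow> r \<le> R \<Longrightarrow> (\<integral>x. hit n r x \<partial>\<mu>) \<le> C2 * (r ^ d + \<rho> ^ n)"
    and mb: "\<And>n r. 0 \<le> r \<Longrightarrow> r \<le> R \<Longrightarrow> (\<integral>x. ball_mass r x \<partial>\<mu>) \<le> C2 * (r ^ d + \<rho> ^ n)"
    using hit_mean[OF R] by blast
  define s where "s n = (real n + 1) * \<tau> ^ n" for n
  define c where "c n = r n ^ d + s n" for n
  have s0: "0 \<le> s n" for n using \<tau> by (simp add: s_def)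
  have summ: "summable s"
    using geometric_deriv_sums[of \<tau>] \<tau> by (auto simp: s_def[abs_def] sums_iff add.commute)
  define B where "B = suminf s"
  have sB: "(\<Sum>n<N. s n) \<le> B" for N unfolding B_def using summ s0 by (intro sum_le_suminf) auto
  have sB1: "s n \<le> B" for n using sB[of "Suc n"] sum_nonneg[of "{..<n}" s] s0 by simp
  have B0: "0 \<le> B" using sB[of 0] by simp
  have c0: "0 \<le> c n" for n using s0 r by (simp add: c_def)
  have \<rho>s: "\<rho> ^ n \<le> s n" for n
  proof -
    have "\<rho> ^ n \<le> 1 * \<tau> ^ n" using \<rho> \<tau> by (simp add: power_mono)
    also have "\<dots> \<le> (real n + 1) * \<tau> ^ n" using \<tau> by (intro mult_right_mono) auto
    finally show ?thesis by (simp add: s_def)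
  qed
  define Q where "Q = C1 + C2 + Cb"
  have Q: "C1 \<le> Q" "C2 \<le> Q" "Cb \<le> Q" "0 \<le> Q" using C1 C2 Cb_nonneg by (auto simp: Q_def)
  have rs: "r n ^ d + \<rho> ^ n \<le> c n" for n using \<rho>s[of n] by (simp add: c_def)
  have "AE x in \<mu>. \<exists>C\<ge>0. \<forall>N. \<bar>\<Sum>n<N. hit n (r n) x - ball_mass (r n) x\<bar>
     \<le> C * (sqrt (1 + (\<Sum>n<N. c n)) * ln (2 + (\<Sum>n<N. c n)) powr (3/2 + \<epsilon>))"
  proof (rule counting_error_AE[where B="R ^ d + B" and D=Q])
    show "finite_measure \<mu>" by unfold_locales
    show "c n \<le> R ^ d + B" for n unfolding c_def
      by (intro add_mono sB1 power_mono r)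
    have c1: "C2 * (r n ^ d + \<rho> ^ n) \<le> Q * c n" for n
      using Q rs[of n] r(1)[of n] \<rho> c0[of n] by (intro mult_mono) auto
    show "(\<integral>x. hit n (r n) x \<partial>\<mu>) \<le> Q * c n" for n using mh[OF r, of n n] c1[of n] by linarith
    show "(\<integral>x. ball_mass (r n) x \<partial>\<mu>) \<le> Q * c n" for n using mb[OF r, of n n] c1[of n] by linarith
    show "ball_mass (r n) x \<le> Q * c n" for n x
    proof -
      have "ball_mass (r n) x \<le> Cb * r n ^ d" unfolding ball_mass_def by (rule measure_ball_le[OF r(1)])
      also have "\<dots> \<le> Q * c n" using Q s0[of n] r(1)[of n] Cb_nonneg by (intro mult_mono) (auto simp: c_def)
      finally show ?thesis .
    qed
    show "(\<integral>x. (\<Sum>n\<in>{l..<k}. hit n (r n) x - ball_mass (r n) x)\<^sup>2 \<partial>\<mu>) \<le> Q * (\<Sum>n\<in>{l..<k}. c n)"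
      if "l \<le> k" for l k
    proof -
      have "C1 * (\<Sum>n\<in>{l..<k}. c n) \<le> Q * (\<Sum>n\<in>{l..<k}. c n)"
        using Q c0 by (intro mult_right_mono sum_nonneg) auto
      then show ?thesis using var[OF that] by (simp add: c_def s_def)
    qed
  qed (use c0 hit_01 ball_mass_01 e in auto)
  then show ?thesis
  proof eventually_elim
    case (elim x)
    then obtain C where C: "0 \<le> C" "\<And>N. \<bar>\<Sum>n<N. hit n (r n) x - ball_mass (r n) x\<bar>
       \<le> C * (sqrt (1 + (\<Sum>n<N. c n)) * ln (2 + (\<Sum>n<N. c n)) powr (3/2 + \<epsilon>))" by blast
    define L where "L = 1 + ln (1 + B) / ln 2"
    have L0: "0 < L" using B0 by (simp add: L_def add_pos_nonneg)
    have "\<bar>\<Sum>n<N. hit n (r n) x - ball_mass (r n) x\<bar>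
       \<le> (C * (sqrt (1 + B) * L powr (3/2 + \<epsilon>))) * (sqrt (1 + (\<Sum>n<N. r n ^ d)) * ln (2 + (\<Sum>n<N. r n ^ d)) powr (3/2 + \<epsilon>))" for N
    proof -
      define S where "S = (\<Sum>n<N. r n ^ d)"
      have S0: "0 \<le> S" unfolding S_def using r by (intro sum_nonneg) auto
      have cS: "(\<Sum>n<N. c n) \<le> S + B" using sB[of N] by (simp add: c_def sum.distrib S_def)
      have cn: "0 \<le> (\<Sum>n<N. c n)" by (intro sum_nonneg c0)
      have SB: "0 \<le> S * B" using S0 B0 by simp
      have "1 + (\<Sum>n<N. c n) \<le> (1 + B) * (1 + S)" using cS SB by (simp add: algebra_simps)
      then have 1: "sqrt (1 + (\<Sum>n<N. c n)) \<le> sqrt (1 + B) * sqrt (1 + S)"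
        by (simp flip: real_sqrt_mult)
      have "2 + (\<Sum>n<N. c n) \<le> (1 + B) * (2 + S)" using cS SB B0 by (simp add: algebra_simps)
      then have "ln (2 + (\<Sum>n<N. c n)) \<le> ln ((1 + B) * (2 + S))" using cn by (intro ln_mono) auto
      also have "\<dots> = ln (1 + B) + ln (2 + S)" using B0 S0 by (intro ln_mult_pos) auto
      also have "\<dots> \<le> L * ln (2 + S)"
      proof -
        have "ln 2 \<le> ln (2 + S)" using S0 by simp
        then have "ln (1 + B) * ln 2 \<le> ln (1 + B) * ln (2 + S)" using B0 by (intro mult_left_mono) auto
        then show ?thesis by (simp add: L_def field_simps)
      qed
      finally have 2: "ln (2 + (\<Sum>n<N. c n)) \<le> L * ln (2 + S)" .
      have "\<bar>\<Sum>n<N. hit n (r n) x - ball_mass (r n) x\<bar> \<le> C * ((sqrt (1 + B) * sqrt (1 + S)) * (L * ln (2 + S)) powr (3/2 + \<epsilon>))"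
        by (rule order_trans[OF C(2)[of N]], intro mult_left_mono mult_mono powr_mono2 1 2)
           (use cn e C(1) B0 S0 in auto)
      also have "\<dots> = (C * (sqrt (1 + B) * L powr (3/2 + \<epsilon>))) * (sqrt (1 + S) * ln (2 + S) powr (3/2 + \<epsilon>))"
        by (simp add: powr_mult)
      finally show ?thesis by (simp add: S_def)
    qed
    moreover have "0 \<le> C * (sqrt (1 + B) * L powr (3/2 + \<epsilon>))" using C(1) B0 by simp
    ultimately show ?case by blast
  qed
qed

end

section \<open>Lebesgue measure of conformal images\<close>

text \<open>
  A well-ordered copy of a finite type. The isometry \<open>reindex\<close> below carries the volume formula for
  coordinates indexed by a well-ordered type over to arbitrary finite index types.
\<close>

typedef (overloaded) ('a::finite) index = "{..<CARD('a)}" morphisms index_nat Index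
  by (rule exI[of _ 0]) simp

instantiation index :: (finite) wellorder
begin

definition less_eq_index :: "'a index \<Rightarrow> 'a index \<Rightarrow> bool" where
  "less_eq_index x y \<longleftrightarrow> index_nat x \<le> index_nat y"
definition less_index :: "'a index \<Rightarrow> 'a index \<Rightarrow> bool" where
  "less_index x y \<longleftrightarrow> index_nat x < index_nat y"

instance
proof
  fix x y z :: "'a index"
  show "x < y \<longleftrightarrow> x \<le> y \<and> \<not> y \<le> x" unfolding less_index_def less_eq_index_def by linarith
  show "x \<le> x" unfolding less_eq_index_def by simp
  show "x \<le> z" if "x \<le> y" "y \<le> z" using that unfolding less_eq_index_def by linarith
  show "x = y" if "x \<le> y" "y \<le> x"
    using that unfolding less_eq_index_def by (metis index_nat_inject le_antisym)
  show "x \<le> y \<or> y \<le> x" unfolding less_eq_index_def by linarith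
next
  fix P :: "'a index \<Rightarrow> bool" and a
  assume step: "\<And>x. (\<And>y. y < x \<Longrightarrow> P y) \<Longrightarrow> P x"
  show "P a"
  proof (induction "index_nat a" arbitrary: a rule: less_induct)
    case less
    show ?case
    proof (rule step)
      fix y assume "y < a"
      then have "index_nat y < index_nat a" by (simp only: less_index_def)
      then show "P y" by (rule less.hyps)
    qed
  qed
qed

end

instance index :: (finite) finite
proof
  have "(UNIV :: 'a index set) = Index ` {..<CARD('a)}"
    by (rule type_definition.univ[OF type_definition_index])
  then show "finite (UNIV :: 'a index set)" by (metis finite_imageI finite_lessThan)
qed

lemma card_index: "CARD('a index) = CARD('a::finite)"
  by (simp add: type_definition.card[OF type_definition_index])

definition index_bij :: "'a index \<Rightarrow> 'a::finite" where
  "index_bij = (SOME \<sigma>. bij \<sigma>)"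

lemma bij_index_bij: "bij (index_bij :: 'a index \<Rightarrow> 'a::finite)"
proof -
  have "\<exists>\<sigma> :: 'a index \<Rightarrow> 'a. bij \<sigma>" by (rule finite_same_card_bij) (auto simp: card_index)
  then show ?thesis unfolding index_bij_def by (rule someI_ex)
qed

definition reindex :: "real^'n \<Rightarrow> real^('n index)" where
  "reindex x = (\<chi> i. x $ index_bij i)"

definition unindex :: "real^('n index) \<Rightarrow> real^'n" where
  "unindex y = (\<chi> j. y $ inv index_bij j)"

lemma unindex_reindex [simp]: "unindex (reindex x) = x"
  by (simp add: reindex_def unindex_def vec_eq_iff surj_f_inv_f[OF bij_is_surj[OF bij_index_bij]])

lemma reindex_unindex [simp]: "reindex (unindex y) = y"
  by (simp add: reindex_def unindex_def vec_eq_iff inv_f_f[OF bij_is_inj[OF bij_index_bij]])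

lemma linear_reindex: "linear reindex"
  by (rule linearI) (auto simp: reindex_def vec_eq_iff)

lemma linear_unindex: "linear unindex"
  by (rule linearI) (auto simp: unindex_def vec_eq_iff)

lemma norm_reindex [simp]: "norm (reindex x) = norm x"
proof -
  have "(\<Sum>i\<in>UNIV. (x $ index_bij i)\<^sup>2) = (\<Sum>j\<in>UNIV. (x $ j)\<^sup>2)"
    by (rule sum.reindex_bij_betw[OF bij_index_bij, of "\<lambda>j. (x $ j)\<^sup>2"])
  then show ?thesis by (simp add: norm_vec_def L2_set_def reindex_def)
qed

lemma norm_unindex [simp]: "norm (unindex y) = norm y"
  using norm_reindex[of "unindex y"] by simp

lemma bounded_linear_reindex: "bounded_linear reindex"
  using linear_reindex by (simp add: linear_conv_bounded_linear)

lemma bounded_linear_unindex: "bounded_linear unindex"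
  using linear_unindex by (simp add: linear_conv_bounded_linear)

lemma reindex_borel [measurable]: "reindex \<in> borel_measurable borel"
  by (intro borel_measurable_continuous_onI linear_continuous_on bounded_linear_reindex)

lemma emeasure_box_cart:
  fixes l u :: "real^'n"
  assumes "\<And>i. l $ i \<le> u $ i"
  shows "emeasure lborel (box l u) = ennreal (\<Prod>i\<in>UNIV. u $ i - l $ i)"
proof -
  have ne: "cbox l u \<noteq> {}" using assms by (simp add: interval_ne_empty_cart)
  have "emeasure lborel (box l u) = emeasure lborel (cbox l u)"
    by (simp add: emeasure_lborel_box_eq emeasure_lborel_cbox_eq)
  also have "\<dots> = ennreal (measure lborel (cbox l u))"
    by (rule emeasure_eq_ennreal_measure) (use emeasure_lborel_cbox_finite[of l u] in auto)
  finally show ?thesis by (simp add: content_cbox_cart[OF ne])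
qed

lemma lborel_distr_reindex: "lborel = distr lborel borel (reindex :: real^'n \<Rightarrow> real^('n index))"
proof (rule lborel_eqI)
  fix l u :: "real^('n index)" assume le: "\<And>b. b \<in> Basis \<Longrightarrow> l \<bullet> b \<le> u \<bullet> b"
  have le': "l $ i \<le> u $ i" for i using le[of "axis i 1"] by (simp add: axis_in_Basis_iff inner_axis)
  have pre: "reindex -` box l u = box (unindex l) (unindex u)"
  proof -
    have "(\<forall>i. l $ i < x $ index_bij i \<and> x $ index_bij i < u $ i) \<longleftrightarrow>
        (\<forall>j. l $ inv index_bij j < x $ j \<and> x $ j < u $ inv index_bij j)" for x :: "real^'n"
      by (metis bij_index_bij bij_is_inj bij_is_surj inv_f_f surj_f_inv_f)
    then show ?thesis by (auto simp: mem_box_cart reindex_def unindex_def)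
  qed
  have "emeasure (distr lborel borel reindex) (box l u) = emeasure lborel (box (unindex l) (unindex u))"
    by (subst emeasure_distr) (auto simp: pre)
  also have "\<dots> = ennreal (\<Prod>j\<in>UNIV. u $ inv index_bij j - l $ inv index_bij j)"
    by (subst emeasure_box_cart) (auto simp: unindex_def le')
  also have "(\<Prod>j\<in>UNIV. u $ inv index_bij j - l $ inv index_bij j) = (\<Prod>i\<in>UNIV. u $ i - l $ i)"
    by (rule prod.reindex_bij_betw[OF bij_imp_bij_inv[OF bij_index_bij], of "\<lambda>i. u $ i - l $ i"])
  also have "ennreal \<dots> = emeasure lborel (box l u)" by (rule emeasure_box_cart[symmetric]) (rule le')
  also have "\<dots> = (\<Prod>b\<in>Basis. (u - l) \<bullet> b)" by (rule emeasure_lborel_box) (rule le)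
  finally show "emeasure (distr lborel borel reindex) (box l u) = (\<Prod>b\<in>Basis. (u - l) \<bullet> b)" .
qed simp

lemma measure_reindex_image:
  fixes S :: "(real^'n) set"
  assumes "compact S"
  shows "measure lebesgue (reindex ` S) = measure lebesgue S"
proof -
  have c: "compact (reindex ` S)"
    using assms by (intro compact_continuous_image linear_continuous_on bounded_linear_reindex)
  have "reindex -` (reindex ` S) = S" by (auto dest: arg_cong[of _ _ unindex])
  then have "measure lborel (reindex ` S) = measure lborel S"
    using c assms by (subst lborel_distr_reindex, subst measure_distr) (auto simp: borel_compact)
  then show ?thesis using c assms by (simp add: borel_compact)
qed

lemma det_similarity:
  fixes f :: "real^'n \<Rightarrow> real^'n"
  assumes lin: "linear f" and c: "\<And>v. norm (f v) = c * norm v"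
  shows "\<bar>det (matrix f)\<bar> = c ^ CARD('n)"
proof (cases "c = 0")
  case True
  then have "f = (\<lambda>v. 0)" using c by (auto simp: fun_eq_iff)
  then have "matrix f = 0" by (simp add: matrix_def vec_eq_iff)
  moreover have "det (0 :: real^'n^'n) = 0"
    by (rule det_zero_row(1)[of undefined]) (simp add: row_def vec_eq_iff)
  ultimately show ?thesis using True by (simp add: power_0_left)
next
  case False
  have c0: "0 < c"
  proof -
    have "0 \<le> c * norm (axis undefined 1 :: real^'n)" unfolding c[symmetric] by simp
    then show ?thesis using False by (simp add: norm_axis_1)
  qed
  define g where "g v = (1 / c) *\<^sub>R f v" for v
  have lg: "linear g" unfolding g_def by (intro linear_compose_scale_right lin)
  have og: "orthogonal_transformation g"
    unfolding orthogonal_transformation using lg c c0 by (simp add: g_def)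
  have "f = (*\<^sub>R) c \<circ> g" using c0 by (auto simp: g_def fun_eq_iff)
  then have "matrix f = matrix ((*\<^sub>R) c) ** matrix g"
    by (simp add: matrix_compose lg linear_scale_self)
  then have "\<bar>det (matrix f)\<bar> = \<bar>c ^ CARD('n)\<bar> * 1"
    using orthogonal_transformation_det[OF og] by (simp add: det_mul abs_mult det_matrix_scaleR)
  then show ?thesis using c0 by simp
qed

text \<open>
  A linear similarity of ratio \<open>c\<close> multiplies volumes by \<open>c ^ CARD('n)\<close>, so the change of variables
  formula gives both bounds.
\<close>

lemma conformal_image_measure_wellorder:
  fixes f :: "real^'n::{finite,wellorder} \<Rightarrow> real^'n::_"
  assumes S: "compact S" and der: "\<And>x. x \<in> S \<Longrightarrow> (f has_derivative f' x) (at x within S)" and inj: "inj_on f S"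
    and sim: "\<And>x v. x \<in> S \<Longrightarrow> norm (f' x v) = c x * norm v"
    and ab: "0 \<le> a" "\<And>x. x \<in> S \<Longrightarrow> a \<le> c x \<and> c x \<le> b"
  shows "a ^ CARD('n) * measure lebesgue S \<le> measure lebesgue (f ` S)"
    and "measure lebesgue (f ` S) \<le> b ^ CARD('n) * measure lebesgue S"
proof -
  have Sl: "S \<in> lmeasurable" using S by (rule lmeasurable_compact)
  have Ss: "S \<in> sets lebesgue" using Sl by (rule fmeasurableD)
  have dt: "\<bar>det (matrix (f' x))\<bar> = c x ^ CARD('n)" if "x \<in> S" for x
    by (rule det_similarity[OF has_derivative_linear[OF der[OF that]] sim[OF that]])
  have bd: "a ^ CARD('n) \<le> \<bar>det (matrix (f' x))\<bar>" "\<bar>det (matrix (f' x))\<bar> \<le> b ^ CARD('n)" if "x \<in> S" for x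
    unfolding dt[OF that] using ab(1) ab(2)[OF that] by (simp_all add: power_mono)
  have "(\<lambda>x. det (matrix (f' x))) \<in> borel_measurable (lebesgue_on S)"
    by (rule borel_measurable_det_Jacobian[OF Ss der])
  then have "(\<lambda>x. \<bar>det (matrix (f' x))\<bar>) \<in> borel_measurable (lebesgue_on S)" by measurable
  then have int: "(\<lambda>x. \<bar>det (matrix (f' x))\<bar>) integrable_on S"
  proof (rule measurable_bounded_by_integrable_imp_integrable[OF _ integrable_on_const[OF Sl] _ Ss])
    show "norm \<bar>det (matrix (f' x))\<bar> \<le> b ^ CARD('n)" if "x \<in> S" for x using bd(2)[OF that] by simp
  qed
  show "measure lebesgue (f ` S) \<le> b ^ CARD('n) * measure lebesgue S"
    by (rule measure_bounded_differentiable_image[OF Sl der int bd(2)])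
  have m: "measure lebesgue (f ` S) = integral S (\<lambda>x. \<bar>det (matrix (f' x))\<bar>)"
    by (rule measure_differentiable_image_eq[OF Ss der inj int])
  have "a ^ CARD('n) * measure lebesgue S = integral S (\<lambda>_. a ^ CARD('n))"
    by (simp only: lmeasure_integral[OF Sl] integral_mult_right[symmetric] mult_1_right)
  also have "\<dots> \<le> integral S (\<lambda>x. \<bar>det (matrix (f' x))\<bar>)"
    by (rule integral_le[OF integrable_on_const[OF Sl] int bd(1)])
  finally show "a ^ CARD('n) * measure lebesgue S \<le> measure lebesgue (f ` S)" unfolding m .
qed

lemma conformal_image_measure:
  fixes f :: "real^'n \<Rightarrow> real^'n"
  assumes S: "compact S" and der: "\<And>x. x \<in> S \<Longrightarrow> (f has_derivative f' x) (at x within S)" and inj: "inj_on f S"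
    and sim: "\<And>x v. x \<in> S \<Longrightarrow> norm (f' x v) = c x * norm v"
    and ab: "0 \<le> a" "\<And>x. x \<in> S \<Longrightarrow> a \<le> c x \<and> c x \<le> b"
  shows "a ^ CARD('n) * measure lebesgue S \<le> measure lebesgue (f ` S)"
    and "measure lebesgue (f ` S) \<le> b ^ CARD('n) * measure lebesgue S"
proof -
  define F where "F = reindex \<circ> f \<circ> unindex"
  define S' where "S' = reindex ` S"
  have cS': "compact S'" unfolding S'_def
    using S by (intro compact_continuous_image linear_continuous_on bounded_linear_reindex)
  have S'D: "unindex y \<in> S" if "y \<in> S'" for y using that by (auto simp: S'_def)
  have uS': "unindex ` S' = S" by (auto simp: S'_def image_image)
  have cont: "continuous_on S f" using der by (rule has_derivative_continuous_on)
  have derF: "(F has_derivative (\<lambda>v. reindex (f' (unindex y) (unindex v)))) (at y within S')" if "y \<in> S'" for y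
  proof -
    have u: "(unindex has_derivative unindex) (at y within S')"
      by (rule bounded_linear_imp_has_derivative[OF bounded_linear_unindex])
    have "(f has_derivative f' (unindex y)) (at (unindex y) within unindex ` S')"
      unfolding uS' by (rule der[OF S'D[OF that]])
    from diff_chain_within[OF u this] have "(f \<circ> unindex has_derivative f' (unindex y) \<circ> unindex) (at y within S')" .
    from bounded_linear.has_derivative[OF bounded_linear_reindex this]
    show ?thesis by (simp add: F_def o_def)
  qed
  have injF: "inj_on F S'"
    unfolding F_def using inj S'D by (auto simp: inj_on_def) (metis reindex_unindex unindex_reindex)
  have FS: "F ` S' = reindex ` (f ` S)" by (auto simp: F_def S'_def image_image)
  have simF: "norm (reindex (f' (unindex y) (unindex v))) = c (unindex y) * norm v" if "y \<in> S'" for y v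
    using sim[OF S'D[OF that]] by simp
  have ab': "a \<le> c (unindex y) \<and> c (unindex y) \<le> b" if "y \<in> S'" for y using ab(2)[OF S'D[OF that]] .
  have m: "measure lebesgue S' = measure lebesgue S" "measure lebesgue (F ` S') = measure lebesgue (f ` S)"
    unfolding FS unfolding S'_def
    by (rule measure_reindex_image[OF S] measure_reindex_image[OF compact_continuous_image[OF cont S]])+
  show "a ^ CARD('n) * measure lebesgue S \<le> measure lebesgue (f ` S)"
    using conformal_image_measure_wellorder(1)[OF cS' derF injF simF ab(1) ab'] by (simp add: m card_index)
  show "measure lebesgue (f ` S) \<le> b ^ CARD('n) * measure lebesgue S"
    using conformal_image_measure_wellorder(2)[OF cS' derF injF simF ab(1) ab'] by (simp add: m card_index)
qed

section \<open>Overlaps of a conformal attractor are null\<close>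

lemma measure_compact_overlap:
  fixes F :: "nat \<Rightarrow> (real^'n) set"
  assumes comp: "\<And>k. k \<in> {1..m} \<Longrightarrow> compact (F k)" and ij: "i \<in> {1..m}" "j \<in> {1..m}" "i \<noteq> j"
  shows "measure lebesgue (\<Union>k\<in>{1..m}. F k) + measure lebesgue (F i \<inter> F j) \<le> (\<Sum>k=1..m. measure lebesgue (F k))"
proof -
  have lm: "F k \<in> lmeasurable" if "k \<in> {1..m}" for k using comp[OF that] by (rule lmeasurable_compact)
  let ?R = "{1..m} - {i, j}"
  have split: "{1..m} = insert i (insert j ?R)" using ij by auto
  have lmR: "(\<Union>k\<in>?R. F k) \<in> lmeasurable" by (rule fmeasurable.finite_UN) (use lm in auto)
  have lij: "F i \<union> F j \<in> lmeasurable" using lm[OF ij(1)] lm[OF ij(2)] by (rule fmeasurable.Un)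
  have "(\<Union>k\<in>{1..m}. F k) = (F i \<union> F j) \<union> (\<Union>k\<in>?R. F k)" by (subst split) auto
  then have "measure lebesgue (\<Union>k\<in>{1..m}. F k) \<le> measure lebesgue (F i \<union> F j) + measure lebesgue (\<Union>k\<in>?R. F k)"
    using measure_Un_le[OF fmeasurableD[OF lij] fmeasurableD[OF lmR]] by simp
  moreover have "measure lebesgue (\<Union>k\<in>?R. F k) \<le> (\<Sum>k\<in>?R. measure lebesgue (F k))"
    by (rule measure_UNION_le) (use lm in \<open>auto intro: fmeasurableD\<close>)
  moreover have "measure lebesgue (F i \<union> F j) + measure lebesgue (F i \<inter> F j) = measure lebesgue (F i) + measure lebesgue (F j)"
    using measure_Un3[OF lm[OF ij(1)] lm[OF ij(2)]] by simp
  moreover have "(\<Sum>k=1..m. measure lebesgue (F k))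
      = measure lebesgue (F i) + measure lebesgue (F j) + (\<Sum>k\<in>?R. measure lebesgue (F k))"
    by (subst split) (use ij in \<open>simp add: sum.insert_if\<close>)
  ultimately show ?thesis by linarith
qed

locale conformal_attractor =
  fixes \<alpha> :: real and \<Omega> :: "(real^'n) set" and m :: nat and \<phi> :: "nat \<Rightarrow> real^'n \<Rightarrow> real^'n" and K :: "(real^'n) set"
  assumes ifs: "conformal_ifs \<alpha> \<Omega> m \<phi>" and osc: "open_set_condition \<Omega> m \<phi>" and att: "attractor \<Omega> m \<phi> K"
begin

abbreviation "J \<equiv> \<lambda>j. jacobian_norm (\<phi> j)"

lemma alpha_pos: "0 < \<alpha>" and m_ge_2: "2 \<le> m" and bounded_Omega: "bounded \<Omega>" and open_Omega: "open \<Omega>"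
  using ifs by (auto simp: conformal_ifs_def)

lemma K_ne: "K \<noteq> {}" and compact_K: "compact K" and K_sub: "K \<subseteq> \<Omega>" and K_eq: "K = (\<Union>j\<in>{1..m}. \<phi> j ` K)"
  using att by (auto simp: attractor_def)

lemma branch_facts:
  assumes "j \<in> {1..m}"
  shows "conformal_on \<Omega> (\<phi> j)" "closure (\<phi> j ` \<Omega>) \<subseteq> \<Omega>"
    "\<exists>\<rho><1. \<forall>x\<in>\<Omega>. \<forall>y\<in>\<Omega>. dist (\<phi> j x) (\<phi> j y) \<le> \<rho> * dist x y"
    "\<exists>a>0. \<forall>x\<in>\<Omega>. a \<le> J j x" "holder_on \<alpha> \<Omega> (J j)"
  using ifs assms unfolding conformal_ifs_def by blast+

lemma phi_Omega: "j \<in> {1..m} \<Longrightarrow> x \<in> \<Omega> \<Longrightarrow> \<phi> j x \<in> \<Omega>"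
  using branch_facts(2)[of j] closure_subset[of "\<phi> j ` \<Omega>"] by blast

lemma phi_K: "j \<in> {1..m} \<Longrightarrow> x \<in> K \<Longrightarrow> \<phi> j x \<in> K"
  using K_eq by blast

lemma phi_inj: "j \<in> {1..m} \<Longrightarrow> inj_on (\<phi> j) \<Omega>"
  using branch_facts(1)[of j] by (simp add: conformal_on_def)

lemma phi_conformal:
  assumes "j \<in> {1..m}" "x \<in> \<Omega>"
  shows "(\<phi> j has_derivative (\<lambda>v. jacobian (\<phi> j) (at x) *v v)) (at x)"
    and "norm (jacobian (\<phi> j) (at x) *v v) = J j x * norm v"
  using branch_facts(1)[OF assms(1)] assms(2) by (auto simp: conformal_on_def jacobian_works)

lemma uniform_contraction:
  obtains \<rho> where "0 < \<rho>" "\<rho> < 1"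
    "\<And>j x y. j \<in> {1..m} \<Longrightarrow> x \<in> \<Omega> \<Longrightarrow> y \<in> \<Omega> \<Longrightarrow> dist (\<phi> j x) (\<phi> j y) \<le> \<rho> * dist x y"
proof -
  have "\<forall>j\<in>{1..m}. \<exists>\<rho><1. \<forall>x\<in>\<Omega>. \<forall>y\<in>\<Omega>. dist (\<phi> j x) (\<phi> j y) \<le> \<rho> * dist x y"
    using branch_facts(3) by blast
  then obtain r where r: "\<And>j. j \<in> {1..m} \<Longrightarrow> r j < (1::real)"
    "\<And>j x y. j \<in> {1..m} \<Longrightarrow> x \<in> \<Omega> \<Longrightarrow> y \<in> \<Omega> \<Longrightarrow> dist (\<phi> j x) (\<phi> j y) \<le> r j * dist x y"
    by metis
  define \<rho> where "\<rho> = Max (insert (1/2) (r ` {1..m}))"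
  have ge: "r j \<le> \<rho>" if "j \<in> {1..m}" for j unfolding \<rho>_def using that by (intro Max_ge) auto
  have "1/2 \<le> \<rho>" unfolding \<rho>_def by (intro Max_ge) auto
  then have "0 < \<rho>" by simp
  moreover have "\<rho> < 1" unfolding \<rho>_def by (subst Max_less_iff) (use r(1) in auto)
  moreover have "dist (\<phi> j x) (\<phi> j y) \<le> \<rho> * dist x y" if "j \<in> {1..m}" "x \<in> \<Omega>" "y \<in> \<Omega>" for j x y
    using r(2)[OF that] mult_right_mono[OF ge[OF that(1)], of "dist x y"] by simp
  ultimately show thesis by (rule that)
qed

lemma dist_powr_contraction:
  assumes "dist x' y' \<le> \<rho> * dist x y" "0 < \<rho>" "0 < a"
  shows "dist x' y' powr a \<le> \<rho> powr a * dist x y powr a"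
  using assms powr_mono2[of a "dist x' y'" "\<rho> * dist x y"] by (simp add: powr_mult)

lemma jacobian_pos: "j \<in> {1..m} \<Longrightarrow> x \<in> \<Omega> \<Longrightarrow> 0 < J j x"
  using branch_facts(4) by (meson less_le_trans)

lemma jacobian_distortion:
  obtains H where "0 \<le> H"
    "\<And>j x y. j \<in> {1..m} \<Longrightarrow> x \<in> \<Omega> \<Longrightarrow> y \<in> \<Omega> \<Longrightarrow> J j x \<le> J j y * exp (H * dist x y powr \<alpha>)"
proof -
  have "\<forall>j\<in>{1..m}. \<exists>a C. 0 < a \<and> (\<forall>x\<in>\<Omega>. a \<le> J j x) \<and> (\<forall>x\<in>\<Omega>. \<forall>y\<in>\<Omega>. \<bar>J j x - J j y\<bar> \<le> C * dist x y powr \<alpha>)"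
    using branch_facts(4,5) unfolding holder_on_def by meson
  then obtain a C where aC: "\<And>j. j \<in> {1..m} \<Longrightarrow> 0 < a j" "\<And>j x. j \<in> {1..m} \<Longrightarrow> x \<in> \<Omega> \<Longrightarrow> a j \<le> J j x"
    "\<And>j x y. j \<in> {1..m} \<Longrightarrow> x \<in> \<Omega> \<Longrightarrow> y \<in> \<Omega> \<Longrightarrow> \<bar>J j x - J j y\<bar> \<le> C j * dist x y powr \<alpha>"
    by metis
  define H where "H = Max (insert 0 ((\<lambda>j. C j / a j) ` {1..m}))"
  have H0: "0 \<le> H" unfolding H_def by (intro Max_ge) auto
  have HC: "C j / a j \<le> H" if "j \<in> {1..m}" for j unfolding H_def using that by (intro Max_ge) auto
  have "J j x \<le> J j y * exp (H * dist x y powr \<alpha>)" if j: "j \<in> {1..m}" and x: "x \<in> \<Omega>" and y: "y \<in> \<Omega>" for j x y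
  proof -
    have "C j \<le> H * a j" using HC[OF j] aC(1)[OF j] by (simp add: pos_divide_le_eq)
    also have "\<dots> \<le> H * J j y" using aC(2)[OF j y] H0 by (rule mult_left_mono)
    finally have "C j * dist x y powr \<alpha> \<le> H * J j y * dist x y powr \<alpha>" by (rule mult_right_mono) simp
    then have "J j x \<le> J j y * (1 + H * dist x y powr \<alpha>)"
      using aC(3)[OF j x y] by (simp add: algebra_simps abs_le_iff)
    also have "\<dots> \<le> J j y * exp (H * dist x y powr \<alpha>)"
      using jacobian_pos[OF j y] by (intro mult_left_mono) (auto simp: exp_ge_add_one_self)
    finally show ?thesis .
  qed
  then show thesis using that H0 by blast
qed

lemma cmp_Omega: "w \<in> words m n \<Longrightarrow> x \<in> \<Omega> \<Longrightarrow> word_comp \<phi> w x \<in> \<Omega>"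
  by (rule word_comp_in[where S=\<Omega> and m=m]) (use phi_Omega in auto)

lemma cmp_K: "w \<in> words m n \<Longrightarrow> x \<in> K \<Longrightarrow> word_comp \<phi> w x \<in> K"
  by (rule word_comp_in[where S=K and m=m]) (use phi_K in auto)

lemma cmp_conformal:
  assumes w: "w \<in> words m n" and x: "x \<in> \<Omega>"
  shows "\<exists>L. (word_comp \<phi> w has_derivative L) (at x) \<and> (\<forall>v. norm (L v) = word_weight J \<phi> w x * norm v)"
  using w
proof (induction n arbitrary: w)
  case 0
  then show ?case by (intro exI[of _ "\<lambda>v. v"]) (auto simp: word_comp.simps(1)[abs_def])
next
  case (Suc n)
  then obtain j v where w: "w = j # v" "j \<in> {1..m}" "v \<in> words m n" by (auto simp: words_Suc)
  obtain L where L: "(word_comp \<phi> v has_derivative L) (at x)" "\<And>u. norm (L u) = word_weight J \<phi> v x * norm u"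
    using Suc.IH[OF w(3)] by blast
  note c = phi_conformal[OF w(2) cmp_Omega[OF w(3) x]]
  have "(\<phi> j \<circ> word_comp \<phi> v has_derivative (\<lambda>u. jacobian (\<phi> j) (at (word_comp \<phi> v x)) *v u) \<circ> L) (at x)"
    by (rule diff_chain_at[OF L(1) c(1)])
  moreover have "\<phi> j \<circ> word_comp \<phi> v = word_comp \<phi> w" by (auto simp: w(1))
  ultimately have 1: "(word_comp \<phi> w has_derivative (\<lambda>u. jacobian (\<phi> j) (at (word_comp \<phi> v x)) *v u) \<circ> L) (at x)" by simp
  have 2: "\<forall>u. norm (((\<lambda>u. jacobian (\<phi> j) (at (word_comp \<phi> v x)) *v u) \<circ> L) u) = word_weight J \<phi> w x * norm u"
    by (simp add: c(2) L(2) w(1))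
  show ?case by (rule exI, rule conjI[OF 1 2])
qed

lemma cmp_inj: "w \<in> words m n \<Longrightarrow> inj_on (word_comp \<phi> w) \<Omega>"
proof (induction n arbitrary: w)
  case 0
  then show ?case by (simp add: inj_on_def)
next
  case (Suc n)
  then obtain j v where w: "w = j # v" "j \<in> {1..m}" "v \<in> words m n" by (auto simp: words_Suc)
  show ?case
    using Suc.IH[OF w(3)] phi_inj[OF w(2)] cmp_Omega[OF w(3)] unfolding w(1) inj_on_def by auto
qed

lemma cmp_continuous: "w \<in> words m n \<Longrightarrow> continuous_on \<Omega> (word_comp \<phi> w)"
  using cmp_conformal by (metis continuous_at_imp_continuous_on has_derivative_continuous)

lemma cmp_compact: "w \<in> words m n \<Longrightarrow> compact S \<Longrightarrow> S \<subseteq> \<Omega> \<Longrightarrow> compact (word_comp \<phi> w ` S)"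
  by (meson cmp_continuous compact_continuous_image continuous_on_subset)

text \<open>
  By conformality and bounded distortion, all of \<open>\<Omega>\<close> is scaled by \<open>word_comp \<phi> w\<close> with one and the same
  volume factor up to a constant that does not depend on \<open>w\<close>.
\<close>

lemma word_measure_distortion:
  obtains E where "1 \<le> E"
    "\<And>n w x S. w \<in> words m n \<Longrightarrow> x \<in> \<Omega> \<Longrightarrow> compact S \<Longrightarrow> S \<subseteq> \<Omega> \<Longrightarrow>
       word_weight J \<phi> w x ^ CARD('n) * measure lebesgue S \<le> E * measure lebesgue (word_comp \<phi> w ` S)"
    "\<And>n w x S. w \<in> words m n \<Longrightarrow> x \<in> \<Omega> \<Longrightarrow> compact S \<Longrightarrow> S \<subseteq> \<Omega> \<Longrightarrow>
       measure lebesgue (word_comp \<phi> w ` S) \<le> E * word_weight J \<phi> w x ^ CARD('n) * measure lebesgue S"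
proof -
  obtain \<rho> where \<rho>: "0 < \<rho>" "\<rho> < 1"
    "\<And>j x y. j \<in> {1..m} \<Longrightarrow> x \<in> \<Omega> \<Longrightarrow> y \<in> \<Omega> \<Longrightarrow> dist (\<phi> j x) (\<phi> j y) \<le> \<rho> * dist x y"
    using uniform_contraction by metis
  obtain H where H: "0 \<le> H"
    "\<And>j x y. j \<in> {1..m} \<Longrightarrow> x \<in> \<Omega> \<Longrightarrow> y \<in> \<Omega> \<Longrightarrow> J j x \<le> J j y * exp (H * dist x y powr \<alpha>)"
    using jacobian_distortion by metis
  obtain B where B: "\<And>x y. x \<in> \<Omega> \<Longrightarrow> y \<in> \<Omega> \<Longrightarrow> dist x y \<le> B"
    using bounded_Omega by (metis bounded_two_points)
  define \<beta> where "\<beta> = \<rho> powr \<alpha>"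
  have \<beta>: "0 \<le> \<beta>" "\<beta> < 1" using \<rho> alpha_pos powr_less_mono2[of \<alpha> \<rho> 1] by (auto simp: \<beta>_def)
  define e where "e = exp (H / (1 - \<beta>) * B powr \<alpha>)"
  have e1: "1 \<le> e" using H \<beta> by (simp add: e_def)
  have dist: "word_weight J \<phi> w x \<le> e * word_weight J \<phi> w y" if w: "w \<in> words m n" and x: "x \<in> \<Omega>" and y: "y \<in> \<Omega>" for n w x y
  proof -
    have "word_weight J \<phi> w x \<le> word_weight J \<phi> w y * exp (H / (1 - \<beta>) * dist x y powr \<alpha>)"
    proof (rule bounded_distortion[where S=\<Omega> and m=m and n=n and \<delta>="\<lambda>x y. dist x y powr \<alpha>"])
      show "dist (\<phi> j x) (\<phi> j y) powr \<alpha> \<le> \<beta> * dist x y powr \<alpha>" if "j \<in> {1..m}" "x \<in> \<Omega>" "y \<in> \<Omega>" for j x y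
        unfolding \<beta>_def by (rule dist_powr_contraction[OF \<rho>(3)[OF that] \<rho>(1) alpha_pos])
    qed (use phi_Omega \<beta> H jacobian_pos that in auto)
    also have "\<dots> \<le> word_weight J \<phi> w y * e"
    proof (rule mult_left_mono)
      have "dist x y powr \<alpha> \<le> B powr \<alpha>" using B[OF x y] alpha_pos by (intro powr_mono2) auto
      then show "exp (H / (1 - \<beta>) * dist x y powr \<alpha>) \<le> e"
        using H(1) \<beta> mult_left_mono[of "dist x y powr \<alpha>" "B powr \<alpha>" "H / (1 - \<beta>)"] by (simp add: e_def)
      show "0 \<le> word_weight J \<phi> w y"
        by (rule less_imp_le, rule word_weight_pos[where S=\<Omega> and m=m]) (use phi_Omega jacobian_pos w y in auto)
    qed
    finally show ?thesis by (simp add: mult.commute)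
  qed
  have pos: "0 < word_weight J \<phi> w x" if "w \<in> words m n" "x \<in> \<Omega>" for n w x
    by (rule word_weight_pos[where S=\<Omega> and m=m]) (use phi_Omega jacobian_pos that in auto)
  have ed: "0 < e ^ CARD('n)" using e1 by simp
  have ed1: "1 \<le> e ^ CARD('n)" using e1 by simp
  have main: "(word_weight J \<phi> w x / e) ^ CARD('n) * measure lebesgue S \<le> measure lebesgue (word_comp \<phi> w ` S)"
      "measure lebesgue (word_comp \<phi> w ` S) \<le> (e * word_weight J \<phi> w x) ^ CARD('n) * measure lebesgue S"
    if w: "w \<in> words m n" and x: "x \<in> \<Omega>" and S: "compact S" "S \<subseteq> \<Omega>" for n w x S
  proof -
    have "\<forall>y. \<exists>L. y \<in> S \<longrightarrow> (word_comp \<phi> w has_derivative L) (at y) \<and> (\<forall>v. norm (L v) = word_weight J \<phi> w y * norm v)"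
      using cmp_conformal[OF w] S(2) by blast
    then obtain f' where f': "\<And>y. y \<in> S \<Longrightarrow> (word_comp \<phi> w has_derivative f' y) (at y)"
      "\<And>y v. y \<in> S \<Longrightarrow> norm (f' y v) = word_weight J \<phi> w y * norm v" by metis
    have der: "(word_comp \<phi> w has_derivative f' y) (at y within S)" if "y \<in> S" for y
      using f'(1)[OF that] by (rule has_derivative_at_withinI)
    have inj: "inj_on (word_comp \<phi> w) S" using cmp_inj[OF w] S(2) by (rule inj_on_subset)
    have a0: "0 \<le> word_weight J \<phi> w x / e" using pos[OF w x] e1 by simp
    have ab: "word_weight J \<phi> w x / e \<le> word_weight J \<phi> w y \<and> word_weight J \<phi> w y \<le> e * word_weight J \<phi> w x" if "y \<in> S" for y
      using dist[OF w x, of y] dist[OF w _ x, of y] that S(2) e1 by (auto simp: pos_divide_le_eq mult.commute)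
    show "(word_weight J \<phi> w x / e) ^ CARD('n) * measure lebesgue S \<le> measure lebesgue (word_comp \<phi> w ` S)"
      "measure lebesgue (word_comp \<phi> w ` S) \<le> (e * word_weight J \<phi> w x) ^ CARD('n) * measure lebesgue S"
      by (rule conformal_image_measure[OF S(1) der inj f'(2) a0 ab]; assumption)+
  qed
  show thesis
  proof (rule that[of "e ^ CARD('n)"])
    show "1 \<le> e ^ CARD('n)" by (rule ed1)
    fix n w x S assume a: "w \<in> words m n" "x \<in> \<Omega>" "compact S" "S \<subseteq> \<Omega>"
    show "word_weight J \<phi> w x ^ CARD('n) * measure lebesgue S \<le> e ^ CARD('n) * measure lebesgue (word_comp \<phi> w ` S)"
      using main(1)[OF a] ed by (simp add: power_divide field_simps)
    show "measure lebesgue (word_comp \<phi> w ` S) \<le> e ^ CARD('n) * word_weight J \<phi> w x ^ CARD('n) * measure lebesgue S"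
      using main(2)[OF a] by (simp add: power_mult_distrib)
  qed
qed

lemma cmp_disjoint:
  assumes V: "V \<subseteq> \<Omega>" "\<And>j. j \<in> {1..m} \<Longrightarrow> \<phi> j ` V \<subseteq> V"
    "\<And>i j. i \<in> {1..m} \<Longrightarrow> j \<in> {1..m} \<Longrightarrow> i \<noteq> j \<Longrightarrow> \<phi> i ` V \<inter> \<phi> j ` V = {}"
    and "w \<in> words m n" "w' \<in> words m n" "w \<noteq> w'"
  shows "word_comp \<phi> w ` V \<inter> word_comp \<phi> w' ` V = {}"
  using assms(4-6)
proof (induction n arbitrary: w w')
  case 0
  then show ?case by simp
next
  case (Suc n)
  obtain j v where w: "w = j # v" "j \<in> {1..m}" "v \<in> words m n" using Suc.prems(1) by (auto simp: words_Suc)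
  obtain j' v' where w': "w' = j' # v'" "j' \<in> {1..m}" "v' \<in> words m n" using Suc.prems(2) by (auto simp: words_Suc)
  have VV: "word_comp \<phi> u x \<in> V" if "u \<in> words m n" "x \<in> V" for u x
    by (rule word_comp_in[where S=V and m=m, OF _ that]) (use V(2) in auto)
  show ?case
  proof (cases "j = j'")
    case True
    then have "word_comp \<phi> v ` V \<inter> word_comp \<phi> v' ` V = {}" using Suc w w' by simp
    moreover have "inj_on (\<phi> j) V" using phi_inj[OF w(2)] V(1) by (rule inj_on_subset)
    moreover have "word_comp \<phi> v ` V \<subseteq> V" "word_comp \<phi> v' ` V \<subseteq> V" using VV[OF w(3)] VV[OF w'(3)] by auto
    ultimately have "\<phi> j ` (word_comp \<phi> v ` V) \<inter> \<phi> j ` (word_comp \<phi> v' ` V) = {}"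
      by (metis image_empty inj_on_image_Int)
    then show ?thesis by (simp add: w(1) w'(1) True image_image)
  next
    case False
    have "word_comp \<phi> w ` V \<subseteq> \<phi> j ` V" "word_comp \<phi> w' ` V \<subseteq> \<phi> j' ` V"
      using VV[OF w(3)] VV[OF w'(3)] by (auto simp: w(1) w'(1))
    with V(3)[OF w(2) w'(2) False] show ?thesis by blast
  qed
qed

lemma K_words: "K = (\<Union>w\<in>words m n. word_comp \<phi> w ` K)"
proof (induction n)
  case 0
  then show ?case by simp
next
  case (Suc n)
  have "K = (\<Union>j\<in>{1..m}. \<phi> j ` (\<Union>w\<in>words m n. word_comp \<phi> w ` K))" using K_eq Suc by simp
  also have "\<dots> = (\<Union>w\<in>words m (Suc n). word_comp \<phi> w ` K)" by (force simp: words_Suc)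
  finally show ?case .
qed

text \<open>
  The sum of the Lebesgue measures of the generation \<open>n\<close> pieces of \<open>K\<close> stays bounded, because by
  bounded distortion these measures are comparable to those of disjoint images of a ball inside the
  open set of the separation condition. An overlap of positive measure would, again by bounded
  distortion, be repeated inside the pieces of every generation and make this sum grow linearly.
\<close>

theorem overlap_null:
  assumes K: "0 < measure lebesgue K" and ij: "i \<in> {1..m}" "j \<in> {1..m}" "i \<noteq> j"
  shows "measure lebesgue (\<phi> i ` K \<inter> \<phi> j ` K) = 0"
proof (rule ccontr)
  let ?leb = "measure lebesgue" and ?d = "CARD('n)"
  let ?W = "\<lambda>w x. word_weight J \<phi> w x ^ ?d"
  define Ov where "Ov = \<phi> i ` K \<inter> \<phi> j ` K"
  assume "?leb (\<phi> i ` K \<inter> \<phi> j ` K) \<noteq> 0"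
  then have Ov0: "0 < ?leb Ov" by (simp add: Ov_def zero_less_measure_iff)
  obtain E where E: "1 \<le> E"
    and lower: "\<And>n w x S. w \<in> words m n \<Longrightarrow> x \<in> \<Omega> \<Longrightarrow> compact S \<Longrightarrow> S \<subseteq> \<Omega> \<Longrightarrow> ?W w x * ?leb S \<le> E * ?leb (word_comp \<phi> w ` S)"
    and upper: "\<And>n w x S. w \<in> words m n \<Longrightarrow> x \<in> \<Omega> \<Longrightarrow> compact S \<Longrightarrow> S \<subseteq> \<Omega> \<Longrightarrow> ?leb (word_comp \<phi> w ` S) \<le> E * ?W w x * ?leb S"
    using word_measure_distortion by metis
  obtain x0 where x0: "x0 \<in> K" using K_ne by auto
  then have x0\<Omega>: "x0 \<in> \<Omega>" using K_sub by auto
  obtain V where V: "V \<noteq> {}" "open V" "V \<subseteq> \<Omega>" "\<And>j. j \<in> {1..m} \<Longrightarrow> \<phi> j ` V \<subseteq> V"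
    "\<And>i j. i \<in> {1..m} \<Longrightarrow> j \<in> {1..m} \<Longrightarrow> i \<noteq> j \<Longrightarrow> \<phi> i ` V \<inter> \<phi> j ` V = {}"
    using osc unfolding open_set_condition_def by metis
  obtain v r where v: "0 < r" "cball v r \<subseteq> V" using V(1,2) by (metis ex_in_conv open_contains_cball)
  \<comment> \<open>a compact ball keeps its images compact, hence measurable\<close>
  define B where "B = cball v r"
  have B: "compact B" "B \<subseteq> V" "B \<subseteq> \<Omega>" "0 < ?leb B" using v V(3) by (auto simp: B_def)
  have cK: "compact (\<phi> k ` S)" if "k \<in> {1..m}" "compact S" "S \<subseteq> \<Omega>" for k S
    using cmp_compact[of "[k]" 1 S] that by (simp add: words_def)
  have Ov: "compact Ov" "Ov \<subseteq> \<Omega>"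
    unfolding Ov_def using cK[OF ij(1) compact_K K_sub] cK[OF ij(2) compact_K K_sub] phi_Omega[OF ij(1)] K_sub
    by (auto intro: compact_Int)
  have lm\<Omega>: "\<Omega> \<in> lmeasurable" by (rule lmeasurable_open[OF bounded_Omega open_Omega])
  have Wsum: "(\<Sum>w\<in>words m n. ?W w x0) * ?leb B \<le> E * ?leb \<Omega>" for n
  proof -
    have lm: "word_comp \<phi> w ` B \<in> lmeasurable" if "w \<in> words m n" for w
      by (rule lmeasurable_compact[OF cmp_compact[OF that B(1,3)]])
    have "(\<Sum>w\<in>words m n. ?W w x0) * ?leb B \<le> (\<Sum>w\<in>words m n. E * ?leb (word_comp \<phi> w ` B))"
      unfolding sum_distrib_right by (intro sum_mono lower x0\<Omega> B)
    also have "\<dots> = E * (\<Sum>w\<in>words m n. ?leb (word_comp \<phi> w ` B))" by (simp add: sum_distrib_left)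
    also have "(\<Sum>w\<in>words m n. ?leb (word_comp \<phi> w ` B)) = ?leb (\<Union>w\<in>words m n. word_comp \<phi> w ` B)"
    proof (rule measure_UNION'[symmetric])
      show "pairwise (\<lambda>w w'. disjnt (word_comp \<phi> w ` B) (word_comp \<phi> w' ` B)) (words m n)"
        using cmp_disjoint[OF V(3,4,5), where n=n] B(2) by (fastforce simp: pairwise_def disjnt_def)
    qed (use lm in auto)
    also have "\<dots> \<le> ?leb \<Omega>"
    proof (rule measure_mono_fmeasurable[OF _ _ lm\<Omega>])
      show "(\<Union>w\<in>words m n. word_comp \<phi> w ` B) \<subseteq> \<Omega>" using cmp_Omega B(3) by blast
      show "(\<Union>w\<in>words m n. word_comp \<phi> w ` B) \<in> sets lebesgue"
        by (rule sets.finite_UN) (use lm in \<open>auto intro: fmeasurableD\<close>)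
    qed
    finally show ?thesis using E by (simp add: mult_left_mono)
  qed
  define a where "a n = (\<Sum>w\<in>words m n. ?leb (word_comp \<phi> w ` K))" for n
  have aW: "a n \<le> E * ?leb K * (\<Sum>w\<in>words m n. ?W w x0)" for n
  proof -
    have "a n \<le> (\<Sum>w\<in>words m n. E * ?W w x0 * ?leb K)"
      unfolding a_def by (intro sum_mono upper x0\<Omega> compact_K K_sub)
    then show ?thesis by (simp add: sum_distrib_left sum_distrib_right mult_ac)
  qed
  have Ka: "?leb K \<le> a n" for n
  proof -
    have "?leb K = ?leb (\<Union>w\<in>words m n. word_comp \<phi> w ` K)" using K_words by simp
    also have "\<dots> \<le> a n" unfolding a_def
      by (rule measure_UNION_le)
         (use cmp_compact[OF _ compact_K K_sub] in \<open>auto intro: fmeasurableD lmeasurable_compact\<close>)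
    finally show ?thesis .
  qed
  have W1: "1 \<le> E * (\<Sum>w\<in>words m n. ?W w x0)" for n
  proof -
    have "?leb K * 1 \<le> ?leb K * (E * (\<Sum>w\<in>words m n. ?W w x0))" using order_trans[OF Ka aW] by (simp add: mult_ac)
    then show ?thesis using K by simp
  qed
  \<comment> \<open>the volume by which the overlap inflates the pieces of each generation, at least\<close>
  define \<kappa> where "\<kappa> = ?leb Ov / (E * E)"
  have \<kappa>0: "0 < \<kappa>" using Ov0 E by (simp add: \<kappa>_def)
  have step: "a n + \<kappa> \<le> a (Suc n)" for n
  proof -
    have W\<kappa>: "\<kappa> \<le> (\<Sum>w\<in>words m n. ?leb (word_comp \<phi> w ` Ov))"
    proof -
      have "?leb Ov * 1 \<le> ?leb Ov * (E * (\<Sum>w\<in>words m n. ?W w x0))" using Ov0 W1[of n] by (intro mult_left_mono) auto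
      also have "\<dots> = E * (\<Sum>w\<in>words m n. ?W w x0 * ?leb Ov)" by (simp add: sum_distrib_left sum_distrib_right mult_ac)
      also have "\<dots> \<le> E * (\<Sum>w\<in>words m n. E * ?leb (word_comp \<phi> w ` Ov))"
        using E by (intro mult_left_mono sum_mono lower x0\<Omega> Ov) auto
      also have "\<dots> = (E * E) * (\<Sum>w\<in>words m n. ?leb (word_comp \<phi> w ` Ov))" by (simp add: sum_distrib_left mult_ac)
      finally show ?thesis using E by (simp add: \<kappa>_def divide_le_eq mult.commute)
    qed
    have "a n + (\<Sum>w\<in>words m n. ?leb (word_comp \<phi> w ` Ov)) = (\<Sum>w\<in>words m n. ?leb (word_comp \<phi> w ` K) + ?leb (word_comp \<phi> w ` Ov))"
      by (simp add: a_def sum.distrib)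
    also have "\<dots> \<le> (\<Sum>w\<in>words m n. \<Sum>k=1..m. ?leb (word_comp \<phi> w ` \<phi> k ` K))"
    proof (rule sum_mono)
      fix w assume w: "w \<in> words m n"
      have "word_comp \<phi> w ` K = (\<Union>k\<in>{1..m}. word_comp \<phi> w ` \<phi> k ` K)" by (subst K_eq) auto
      moreover have "word_comp \<phi> w ` Ov = word_comp \<phi> w ` \<phi> i ` K \<inter> word_comp \<phi> w ` \<phi> j ` K"
        unfolding Ov_def by (rule inj_on_image_Int[OF cmp_inj[OF w]]) (use phi_Omega ij K_sub in auto)
      moreover have "?leb (\<Union>k\<in>{1..m}. word_comp \<phi> w ` \<phi> k ` K) + ?leb (word_comp \<phi> w ` \<phi> i ` K \<inter> word_comp \<phi> w ` \<phi> j ` K)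
          \<le> (\<Sum>k=1..m. ?leb (word_comp \<phi> w ` \<phi> k ` K))"
      proof (rule measure_compact_overlap[OF _ ij])
        fix k assume k: "k \<in> {1..m}"
        show "compact (word_comp \<phi> w ` \<phi> k ` K)"
          by (rule cmp_compact[OF w cK[OF k compact_K K_sub]]) (use phi_Omega[OF k] K_sub in auto)
      qed
      ultimately show "?leb (word_comp \<phi> w ` K) + ?leb (word_comp \<phi> w ` Ov) \<le> (\<Sum>k=1..m. ?leb (word_comp \<phi> w ` \<phi> k ` K))"
        by simp
    qed
    also have "\<dots> = a (Suc n)"
    proof -
      have "a (n + 1) = (\<Sum>w\<in>words m n. \<Sum>u\<in>words m 1. ?leb (word_comp \<phi> (w @ u) ` K))"
        unfolding a_def by (rule sum_words_add)
      also have "\<dots> = (\<Sum>w\<in>words m n. \<Sum>k=1..m. ?leb (word_comp \<phi> w ` \<phi> k ` K))"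
        by (simp add: sum_words_Suc[where n=0, simplified] word_comp_append image_image)
      finally show ?thesis by simp
    qed
    finally show ?thesis using W\<kappa> by linarith
  qed
  have lin: "real n * \<kappa> \<le> a n" for n
  proof (induction n)
    case 0
    then show ?case using Ka[of 0] by (simp add: order_trans[OF measure_nonneg])
  next
    case (Suc n)
    then show ?case using step[of n] by (simp add: algebra_simps)
  qed
  have bound: "a n * ?leb B \<le> E * ?leb K * (E * ?leb \<Omega>)" for n
  proof -
    have "a n * ?leb B \<le> E * ?leb K * (\<Sum>w\<in>words m n. ?W w x0) * ?leb B" by (rule mult_right_mono[OF aW]) simp
    also have "\<dots> \<le> E * ?leb K * (E * ?leb \<Omega>)"
      using mult_left_mono[OF Wsum[of n], of "E * ?leb K"] E by (simp add: mult.assoc)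
    finally show ?thesis .
  qed
  obtain n :: nat where "E * ?leb K * (E * ?leb \<Omega>) < real n * (\<kappa> * ?leb B)"
    using reals_Archimedean3[of "\<kappa> * ?leb B"] \<kappa>0 B(4) by (meson mult_pos_pos)
  moreover have "real n * (\<kappa> * ?leb B) \<le> a n * ?leb B"
    using mult_right_mono[OF lin[of n], of "?leb B"] by (simp add: mult.assoc)
  ultimately show False using bound[of n] by linarith
qed

end

section \<open>Symbolic coding and the induced map\<close>

lemma word_map_eq_word_comp: "word_map \<phi> \<omega> n x = word_comp \<phi> (map \<omega> [0..<n]) x"
  by (induction n arbitrary: x) (auto simp: word_comp_append)

lemma negligible_finite_UN:
  "finite A \<Longrightarrow> (\<And>a. a \<in> A \<Longrightarrow> negligible (f a)) \<Longrightarrow> negligible (\<Union>a\<in>A. f a)"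
  by (intro negligible_Union) auto

context conformal_attractor
begin

lemma prefix_word: "\<omega> \<in> symbolic_space m \<Longrightarrow> map \<omega> [0..<n] \<in> words m n"
  by (auto simp: symbolic_space_def words_def)

lemma shift_symbolic: "\<omega> \<in> symbolic_space m \<Longrightarrow> (\<lambda>k. \<omega> (n + k)) \<in> symbolic_space m"
  by (auto simp: symbolic_space_def)

lemma cylinder_diameter:
  obtains \<rho> D where "0 < \<rho>" "\<rho> < 1" "0 < D"
    "\<And>n w x y. w \<in> words m n \<Longrightarrow> x \<in> K \<Longrightarrow> y \<in> K \<Longrightarrow> dist (word_comp \<phi> w x) (word_comp \<phi> w y) \<le> \<rho> ^ n * D"
proof -
  obtain \<rho> where \<rho>: "0 < \<rho>" "\<rho> < 1"
    "\<And>j x y. j \<in> {1..m} \<Longrightarrow> x \<in> \<Omega> \<Longrightarrow> y \<in> \<Omega> \<Longrightarrow> dist (\<phi> j x) (\<phi> j y) \<le> \<rho> * dist x y"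
    using uniform_contraction by metis
  obtain B where B: "\<And>x y. x \<in> K \<Longrightarrow> y \<in> K \<Longrightarrow> dist x y \<le> B"
    using compact_imp_bounded[OF compact_K] by (metis bounded_two_points)
  have "dist (word_comp \<phi> w x) (word_comp \<phi> w y) \<le> \<rho> ^ n * max B 1"
    if w: "w \<in> words m n" and x: "x \<in> K" and y: "y \<in> K" for n w x y
  proof -
    have "dist (word_comp \<phi> w x) (word_comp \<phi> w y) \<le> \<rho> ^ n * dist x y"
      by (rule word_comp_contraction[where S=\<Omega> and m=m and \<delta>=dist, OF phi_Omega \<rho>(3)]) (use w x y K_sub \<rho> in auto)
    also have "\<dots> \<le> \<rho> ^ n * max B 1" using B[OF x y] \<rho> by (intro mult_left_mono) auto
    finally show ?thesis .
  qed
  then show thesis using that[of \<rho> "max B 1"] \<rho> by auto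
qed

lemma word_limit:
  assumes \<omega>: "\<omega> \<in> symbolic_space m"
  shows "\<exists>y\<in>K. \<forall>x\<in>K. (\<lambda>n. word_map \<phi> \<omega> n x) \<longlonglongrightarrow> y"
proof -
  obtain \<rho> D where \<rho>: "0 < \<rho>" "\<rho> < 1" "0 < D"
    and diam: "\<And>n w x y. w \<in> words m n \<Longrightarrow> x \<in> K \<Longrightarrow> y \<in> K \<Longrightarrow> dist (word_comp \<phi> w x) (word_comp \<phi> w y) \<le> \<rho> ^ n * D"
    using cylinder_diameter by metis
  have \<rho>0: "(\<lambda>n. \<rho> ^ n * D) \<longlonglongrightarrow> 0" using \<rho> by (intro tendsto_mult_left_zero LIMSEQ_realpow_zero) auto
  obtain x0 where x0: "x0 \<in> K" using K_ne by auto
  have dst: "dist (word_map \<phi> \<omega> n x) (word_map \<phi> \<omega> k y) \<le> \<rho> ^ n * D" if "n \<le> k" "x \<in> K" "y \<in> K" for n k x y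
  proof -
    have w: "map \<omega> [n..<k] \<in> words m (k - n)" using \<omega> by (auto simp: symbolic_space_def words_def)
    have "map \<omega> [0..<k] = map \<omega> [0..<n] @ map \<omega> [n..<k]"
      using upt_add_eq_append[of 0 n "k - n"] that by simp
    then have "word_map \<phi> \<omega> k y = word_comp \<phi> (map \<omega> [0..<n]) (word_comp \<phi> (map \<omega> [n..<k]) y)"
      by (simp add: word_map_eq_word_comp word_comp_append)
    then show ?thesis
      using diam[OF prefix_word[OF \<omega>] that(2) cmp_K[OF w that(3)], of n] by (simp add: word_map_eq_word_comp)
  qed
  have inK: "word_map \<phi> \<omega> n x \<in> K" if "x \<in> K" for n x
    unfolding word_map_eq_word_comp by (rule cmp_K[OF prefix_word[OF \<omega>] that])
  have cau: "Cauchy (\<lambda>n. word_map \<phi> \<omega> n x0)"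
  proof (rule metric_CauchyI)
    fix e :: real assume "0 < e"
    then obtain N where N: "\<rho> ^ N * D < e / 2"
      using order_tendstoD(2)[OF \<rho>0, of "e / 2"] by (auto simp: eventually_sequentially)
    have "dist (word_map \<phi> \<omega> a x0) (word_map \<phi> \<omega> b x0) < e" if "N \<le> a" "N \<le> b" for a b
      using dst[OF that(1) x0 x0] dst[OF that(2) x0 x0] N
        dist_triangle2[of "word_map \<phi> \<omega> a x0" "word_map \<phi> \<omega> b x0" "word_map \<phi> \<omega> N x0"]
      by (simp add: dist_commute)
    then show "\<exists>N. \<forall>a\<ge>N. \<forall>b\<ge>N. dist (word_map \<phi> \<omega> a x0) (word_map \<phi> \<omega> b x0) < e" by blast
  qed
  have "\<forall>n. word_map \<phi> \<omega> n x0 \<in> K" using inK[OF x0] by simp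
  then obtain y where y: "y \<in> K" "(\<lambda>n. word_map \<phi> \<omega> n x0) \<longlonglongrightarrow> y"
    using compact_imp_complete[OF compact_K] cau by (metis completeE)
  have "(\<lambda>n. word_map \<phi> \<omega> n x) \<longlonglongrightarrow> y" if x: "x \<in> K" for x
  proof (rule Lim_transform[OF y(2)])
    show "(\<lambda>n. word_map \<phi> \<omega> n x - word_map \<phi> \<omega> n x0) \<longlonglongrightarrow> 0"
    proof (rule Lim_null_comparison[OF always_eventually \<rho>0], rule allI)
      show "norm (word_map \<phi> \<omega> n x - word_map \<phi> \<omega> n x0) \<le> \<rho> ^ n * D" for n
        using dst[OF order_refl x x0, of n] by (simp add: dist_norm)
    qed
  qed
  then show ?thesis using y(1) by blast
qed

lemma coding_map_eqI:
  assumes "\<And>x. x \<in> K \<Longrightarrow> (\<lambda>n. word_map \<phi> \<omega> n x) \<longlonglongrightarrow> y"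
  shows "coding_map \<phi> K \<omega> = y"
  unfolding coding_map_def
proof (rule the_equality)
  obtain x0 where x0: "x0 \<in> K" using K_ne by auto
  fix z assume "\<forall>x\<in>K. (\<lambda>n. word_map \<phi> \<omega> n x) \<longlonglongrightarrow> z"
  then show "z = y" using assms[OF x0] x0 LIMSEQ_unique by blast
qed (use assms in auto)

lemma coding_map_limit:
  assumes "\<omega> \<in> symbolic_space m"
  shows "coding_map \<phi> K \<omega> \<in> K" "x \<in> K \<Longrightarrow> (\<lambda>n. word_map \<phi> \<omega> n x) \<longlonglongrightarrow> coding_map \<phi> K \<omega>"
proof -
  obtain y where y: "y \<in> K" "\<forall>x\<in>K. (\<lambda>n. word_map \<phi> \<omega> n x) \<longlonglongrightarrow> y" using word_limit[OF assms] by blast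
  then have "coding_map \<phi> K \<omega> = y" by (intro coding_map_eqI) auto
  then show "coding_map \<phi> K \<omega> \<in> K" "x \<in> K \<Longrightarrow> (\<lambda>n. word_map \<phi> \<omega> n x) \<longlonglongrightarrow> coding_map \<phi> K \<omega>" using y by auto
qed

lemma coding_map_shift:
  assumes \<omega>: "\<omega> \<in> symbolic_space m"
  shows "coding_map \<phi> K \<omega> = \<phi> (\<omega> 0) (coding_map \<phi> K (\<lambda>n. \<omega> (Suc n)))"
proof (rule coding_map_eqI)
  fix x assume x: "x \<in> K"
  have s: "(\<lambda>n. \<omega> (Suc n)) \<in> symbolic_space m" using shift_symbolic[OF \<omega>, of 1] by simp
  have 0: "\<omega> 0 \<in> {1..m}" using \<omega> by (simp add: symbolic_space_def)
  have "coding_map \<phi> K (\<lambda>n. \<omega> (Suc n)) \<in> \<Omega>" using coding_map_limit(1)[OF s] K_sub by auto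
  then have "isCont (\<phi> (\<omega> 0)) (coding_map \<phi> K (\<lambda>n. \<omega> (Suc n)))"
    using phi_conformal(1)[OF 0] has_derivative_continuous by blast
  from isCont_tendsto_compose[OF this coding_map_limit(2)[OF s x]]
  have "(\<lambda>n. \<phi> (\<omega> 0) (word_map \<phi> (\<lambda>n. \<omega> (Suc n)) n x)) \<longlonglongrightarrow> \<phi> (\<omega> 0) (coding_map \<phi> K (\<lambda>n. \<omega> (Suc n)))" .
  moreover have "\<phi> (\<omega> 0) (word_map \<phi> (\<lambda>n. \<omega> (Suc n)) n x) = word_map \<phi> \<omega> (Suc n) x" for n
  proof -
    have eq: "map \<omega> [0..<Suc n] = \<omega> 0 # map (\<lambda>n. \<omega> (Suc n)) [0..<n]"
      by (rule nth_equalityI) (auto simp: nth_Cons' simp del: upt_Suc)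
    show ?thesis unfolding word_map_eq_word_comp eq by simp
  qed
  ultimately have "(\<lambda>n. word_map \<phi> \<omega> (Suc n) x) \<longlonglongrightarrow> \<phi> (\<omega> 0) (coding_map \<phi> K (\<lambda>n. \<omega> (Suc n)))" by simp
  then show "(\<lambda>n. word_map \<phi> \<omega> n x) \<longlonglongrightarrow> \<phi> (\<omega> 0) (coding_map \<phi> K (\<lambda>n. \<omega> (Suc n)))"
    by (rule LIMSEQ_imp_Suc)
qed

lemma coding_map_shift_n:
  assumes "\<omega> \<in> symbolic_space m"
  shows "coding_map \<phi> K \<omega> = word_comp \<phi> (map \<omega> [0..<n]) (coding_map \<phi> K (\<lambda>k. \<omega> (n + k)))"
proof (induction n)
  case 0
  then show ?case by simp
next
  case (Suc n)
  have "coding_map \<phi> K (\<lambda>k. \<omega> (n + k)) = \<phi> (\<omega> n) (coding_map \<phi> K (\<lambda>k. \<omega> (Suc n + k)))"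
    using coding_map_shift[OF shift_symbolic[OF assms, of n]] by simp
  with Suc show ?case by (simp add: word_comp_append)
qed

text \<open>
  A code of \<open>x\<close> is found by following preimages: \<open>r y\<close> is a preimage of \<open>y\<close> in \<open>K\<close> under the branch
  \<open>s y\<close>.
\<close>

lemma coding_map_surj:
  assumes x: "x \<in> K"
  shows "\<exists>\<omega>\<in>symbolic_space m. coding_map \<phi> K \<omega> = x"
proof -
  have "\<forall>y. \<exists>j z. y \<in> K \<longrightarrow> j \<in> {1..m} \<and> z \<in> K \<and> y = \<phi> j z" using K_eq by blast
  then obtain s r where sr: "\<And>y. y \<in> K \<Longrightarrow> s y \<in> {1..m}" "\<And>y. y \<in> K \<Longrightarrow> r y \<in> K" "\<And>y. y \<in> K \<Longrightarrow> y = \<phi> (s y) (r y)"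
    by metis
  define \<omega> where "\<omega> n = s ((r ^^ n) x)" for n
  have rK: "(r ^^ n) x \<in> K" for n by (induction n) (use x sr in auto)
  have \<omega>: "\<omega> \<in> symbolic_space m" using sr(1)[OF rK] by (simp add: symbolic_space_def \<omega>_def)
  have it: "word_comp \<phi> (map \<omega> [0..<n]) ((r ^^ n) x) = x" for n
  proof (induction n)
    case (Suc n)
    then show ?case using sr(3)[OF rK[of n]] by (simp add: word_comp_append \<omega>_def)
  qed simp
  obtain \<rho> D where \<rho>: "0 < \<rho>" "\<rho> < 1" "0 < D"
    and diam: "\<And>n w x y. w \<in> words m n \<Longrightarrow> x \<in> K \<Longrightarrow> y \<in> K \<Longrightarrow> dist (word_comp \<phi> w x) (word_comp \<phi> w y) \<le> \<rho> ^ n * D"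
    using cylinder_diameter by metis
  have \<rho>0: "(\<lambda>n. \<rho> ^ n * D) \<longlonglongrightarrow> 0" using \<rho> by (intro tendsto_mult_left_zero LIMSEQ_realpow_zero) auto
  have "coding_map \<phi> K \<omega> = x"
  proof (rule coding_map_eqI)
    fix y assume y: "y \<in> K"
    have "(\<lambda>n. word_map \<phi> \<omega> n y - x) \<longlonglongrightarrow> 0"
    proof (rule Lim_null_comparison[OF always_eventually \<rho>0], rule allI)
      show "norm (word_map \<phi> \<omega> n y - x) \<le> \<rho> ^ n * D" for n
        using diam[OF prefix_word[OF \<omega>] y rK, of n n] it[of n] by (simp add: dist_norm word_map_eq_word_comp)
    qed
    then show "(\<lambda>n. word_map \<phi> \<omega> n y) \<longlonglongrightarrow> x" by (simp add: LIM_zero_iff)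
  qed
  then show ?thesis using \<omega> by blast
qed

definition overlap :: "(real^'n) set" where
  "overlap = (\<Union>i\<in>{1..m}. \<Union>j\<in>{1..m} - {i}. \<phi> i ` K \<inter> \<phi> j ` K)"

text \<open>
  If two codes of a point agree on a word \<open>w\<close> and differ in the next letter, then the point lies in
  \<open>word_comp \<phi> w ` overlap\<close>.
\<close>

definition exceptional :: "(real^'n) set" where
  "exceptional = (\<Union>n. \<Union>w\<in>words m n. word_comp \<phi> w ` overlap)"

lemma phi_compact: "j \<in> {1..m} \<Longrightarrow> compact S \<Longrightarrow> S \<subseteq> \<Omega> \<Longrightarrow> compact (\<phi> j ` S)"
  using cmp_compact[of "[j]" 1 S] by (simp add: words_def)

lemma overlap_compact: "compact overlap" and overlap_subset: "overlap \<subseteq> \<Omega>"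
proof -
  have "compact (\<phi> j ` K)" if "j \<in> {1..m}" for j by (rule phi_compact[OF that compact_K K_sub])
  then show "compact overlap" unfolding overlap_def by (intro compact_UN compact_Int) auto
  show "overlap \<subseteq> \<Omega>" using phi_Omega K_sub by (fastforce simp: overlap_def)
qed

lemma overlap_subset_exceptional: "overlap \<subseteq> exceptional"
  unfolding exceptional_def by (intro subsetI UN_I[of 0]) auto

lemma unique_code:
  assumes "x \<notin> exceptional" "\<omega> \<in> symbolic_space m" "\<omega>' \<in> symbolic_space m"
    and "coding_map \<phi> K \<omega> = x" "coding_map \<phi> K \<omega>' = x"
  shows "\<omega> = \<omega>'"
proof (rule ccontr)
  assume "\<omega> \<noteq> \<omega>'"
  then have ex: "\<exists>n. \<omega> n \<noteq> \<omega>' n" by auto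
  define n where "n = (LEAST n. \<omega> n \<noteq> \<omega>' n)"
  have n: "\<omega> n \<noteq> \<omega>' n" unfolding n_def by (rule LeastI_ex[OF ex])
  have "\<omega> k = \<omega>' k" if "k < n" for k using not_less_Least[of k "\<lambda>n. \<omega> n \<noteq> \<omega>' n"] that by (auto simp: n_def)
  then have w: "map \<omega> [0..<n] = map \<omega>' [0..<n]" by simp
  let ?w = "map \<omega> [0..<n]"
  let ?z = "coding_map \<phi> K (\<lambda>k. \<omega> (n + k))" and ?z' = "coding_map \<phi> K (\<lambda>k. \<omega>' (n + k))"
  have wW: "?w \<in> words m n" by (rule prefix_word) fact
  have zK: "?z \<in> K" "?z' \<in> K" using assms by (auto intro!: coding_map_limit(1) shift_symbolic)
  have x: "x = word_comp \<phi> ?w ?z"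
    by (rule trans[OF assms(4)[symmetric] coding_map_shift_n[OF assms(2)]])
  have x': "x = word_comp \<phi> ?w ?z'"
    unfolding w by (rule trans[OF assms(5)[symmetric] coding_map_shift_n[OF assms(3)]])
  have "?z = ?z'"
    by (rule inj_onD[OF cmp_inj[OF wW] trans[OF x[symmetric] x']]) (use zK K_sub in auto)
  moreover have "?z \<in> \<phi> (\<omega> n) ` K" "?z' \<in> \<phi> (\<omega>' n) ` K"
    using coding_map_shift[OF shift_symbolic[OF assms(2), of n]] coding_map_shift[OF shift_symbolic[OF assms(3), of n]]
      coding_map_limit(1)[OF shift_symbolic[OF assms(2), of "Suc n"]] coding_map_limit(1)[OF shift_symbolic[OF assms(3), of "Suc n"]]
    by auto
  moreover have "\<omega> n \<in> {1..m}" "\<omega>' n \<in> {1..m}" using assms(2,3) by (auto simp: symbolic_space_def)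
  ultimately have "?z \<in> \<phi> (\<omega> n) ` K \<inter> \<phi> (\<omega>' n) ` K" "\<omega> n \<in> {1..m}" "\<omega>' n \<in> {1..m} - {\<omega> n}"
    using n by auto
  then have "?z \<in> overlap" unfolding overlap_def by blast
  then have "x \<in> exceptional" unfolding exceptional_def x using wW by blast
  with assms(1) show False by simp
qed

lemma induced_map_branch:
  assumes j: "j \<in> {1..m}" and y: "y \<in> K" and x: "\<phi> j y \<notin> exceptional"
  shows "induced_map m \<phi> K (\<phi> j y) = y"
proof -
  obtain \<omega> where \<omega>: "\<omega> \<in> symbolic_space m" "coding_map \<phi> K \<omega> = y" using coding_map_surj[OF y] by blast
  define \<omega>' where "\<omega>' = case_nat j \<omega>"
  have \<omega>': "\<omega>' \<in> symbolic_space m" using \<omega> j by (auto simp: \<omega>'_def symbolic_space_def split: nat.split)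
  have s: "(\<lambda>n. \<omega>' (Suc n)) = \<omega>" by (simp add: \<omega>'_def)
  have c: "coding_map \<phi> K \<omega>' = \<phi> j y" using coding_map_shift[OF \<omega>'] \<omega>(2) s by (simp add: \<omega>'_def)
  have u: "\<tau> = \<omega>'" if "\<tau> \<in> symbolic_space m \<and> coding_map \<phi> K \<tau> = \<phi> j y" for \<tau>
    using unique_code[OF x _ \<omega>' _ c] that by blast
  have the: "(THE \<tau>. \<tau> \<in> symbolic_space m \<and> coding_map \<phi> K \<tau> = \<phi> j y) = \<omega>'"
    by (rule the_equality, rule conjI[OF \<omega>' c], rule u)
  have "\<exists>!\<tau>. \<tau> \<in> symbolic_space m \<and> coding_map \<phi> K \<tau> = \<phi> j y"
    by (rule ex1I, rule conjI[OF \<omega>' c], rule u)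
  then show ?thesis unfolding induced_map_def using phi_K[OF j y] the s \<omega>(2) by simp
qed

lemma exceptional_null:
  assumes "0 < measure lebesgue K"
  shows "negligible exceptional"
proof -
  have "negligible (\<phi> i ` K \<inter> \<phi> j ` K)" if ij: "i \<in> {1..m}" "j \<in> {1..m}" "i \<noteq> j" for i j
  proof -
    have "compact (\<phi> i ` K \<inter> \<phi> j ` K)"
      using phi_compact[OF ij(1) compact_K K_sub] phi_compact[OF ij(2) compact_K K_sub] by (rule compact_Int)
    then show ?thesis using overlap_null[OF assms ij] negligible_iff_measure0[OF lmeasurable_compact] by blast
  qed
  then have "negligible overlap" unfolding overlap_def by (intro negligible_finite_UN) auto
  then have "negligible (word_comp \<phi> w ` overlap)" if "w \<in> words m n" for w n
  proof (rule negligible_differentiable_image_negligible[OF order_refl])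
    show "word_comp \<phi> w differentiable_on overlap"
      unfolding differentiable_on_def differentiable_def
      using cmp_conformal[OF that] overlap_subset has_derivative_at_withinI by blast
  qed
  then show ?thesis unfolding exceptional_def
    by (intro negligible_countable_Union) (auto intro!: negligible_finite_UN)
qed

text \<open>
  A Borel version of the inverse branches: on \<open>\<phi> j ` K\<close> it inverts \<open>\<phi> j\<close>, the smallest index
  winning on overlaps.
\<close>

definition inverse_branch :: "real^'n \<Rightarrow> real^'n" where
  "inverse_branch x = (\<Sum>j=1..m. indicator (\<phi> j ` K - (\<Union>i\<in>{1..<j}. \<phi> i ` K)) x *\<^sub>R inv_into K (\<phi> j) x)"

lemma inverse_branch_borel: "inverse_branch \<in> borel_measurable borel"
  unfolding inverse_branch_def[abs_def]
proof (rule borel_measurable_sum)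
  fix j assume j: "j \<in> {1..m}"
  have c: "compact (\<phi> k ` K)" if "k \<in> {1..m}" for k by (rule phi_compact[OF that compact_K K_sub])
  have inj: "inj_on (\<phi> j) K" using phi_inj[OF j] K_sub by (rule inj_on_subset)
  have "continuous_on K (\<phi> j)"
    using continuous_on_subset[OF cmp_continuous[of "[j]" 1] K_sub] j by (simp add: words_def)
  then have "continuous_on (\<phi> j ` K) (inv_into K (\<phi> j))" 
    by (rule continuous_on_inv[OF _ compact_K]) (simp add: inv_into_f_f[OF inj])
  moreover have D: "\<phi> j ` K - (\<Union>i\<in>{1..<j}. \<phi> i ` K) \<in> sets borel"
    using c j by (intro sets.Diff sets.finite_UN) (auto intro: borel_compact)
  ultimately show "(\<lambda>x. indicator (\<phi> j ` K - (\<Union>i\<in>{1..<j}. \<phi> i ` K)) x *\<^sub>R inv_into K (\<phi> j) x) \<in> borel_measurable borel"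
    by (intro borel_measurable_continuous_on_indicator) (auto intro: continuous_on_subset)
qed

lemma inverse_branch_eq:
  assumes j: "j \<in> {1..m}" and y: "y \<in> K" and x: "\<phi> j y \<notin> overlap"
  shows "inverse_branch (\<phi> j y) = y"
proof -
  have inj: "inj_on (\<phi> j) K" using phi_inj[OF j] K_sub by (rule inj_on_subset)
  have other: "\<phi> j y \<notin> \<phi> i ` K" if "i \<in> {1..m}" "i \<noteq> j" for i
    using x j y that unfolding overlap_def by blast
  have "inverse_branch (\<phi> j y) = (\<Sum>k=1..m. if k = j then y else 0)"
    unfolding inverse_branch_def
  proof (rule sum.cong[OF refl])
    fix k assume k: "k \<in> {1..m}"
    show "indicator (\<phi> k ` K - (\<Union>i\<in>{1..<k}. \<phi> i ` K)) (\<phi> j y) *\<^sub>R inv_into K (\<phi> k) (\<phi> j y) = (if k = j then y else 0)"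
    proof (cases "k = j")
      case True
      then show ?thesis using other j y inv_into_f_f[OF inj y] by (auto simp: indicator_def)
    next
      case False
      then show ?thesis using other[OF k] by (auto simp: indicator_def)
    qed
  qed
  then show ?thesis using j by simp
qed

lemma induced_map_eq_inverse_branch:
  assumes "x \<in> K" "x \<notin> exceptional"
  shows "induced_map m \<phi> K x = inverse_branch x"
proof -
  obtain j y where jy: "j \<in> {1..m}" "y \<in> K" "x = \<phi> j y" using K_eq assms(1) by blast
  have "\<phi> j y \<notin> overlap" using assms(2) jy(3) overlap_subset_exceptional by blast
  then show ?thesis
    using induced_map_branch[OF jy(1,2)] inverse_branch_eq[OF jy(1,2)] assms(2) jy(3) by simp
qed

text \<open>
  The lower volume bound for images prevents a set of positive volume from being mapped into the null
  set \<open>overlap\<close>.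
\<close>

lemma preimage_overlap_null:
  assumes K: "0 < measure lebesgue K" and j: "j \<in> {1..m}"
  shows "negligible {y \<in> K. \<phi> j y \<in> overlap}"
proof -
  let ?Y = "{y \<in> K. \<phi> j y \<in> overlap}"
  have cont: "continuous_on K (\<phi> j)"
    using continuous_on_subset[OF cmp_continuous[of "[j]" 1] K_sub] j by (simp add: words_def)
  have "closed (K \<inter> \<phi> j -` overlap)"
    using compact_imp_closed[OF compact_K] compact_imp_closed[OF overlap_compact] cont
    by (intro continuous_closed_preimage)
  moreover have Y: "?Y = K \<inter> \<phi> j -` overlap" by auto
  ultimately have cY: "compact ?Y"
    using compact_Int_closed[OF compact_K, of "K \<inter> \<phi> j -` overlap"] by (simp add: Int_absorb1)
  have YO: "?Y \<subseteq> \<Omega>" using K_sub by auto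
  obtain E where E: "1 \<le> E"
    "\<And>n w x S. w \<in> words m n \<Longrightarrow> x \<in> \<Omega> \<Longrightarrow> compact S \<Longrightarrow> S \<subseteq> \<Omega> \<Longrightarrow>
       word_weight J \<phi> w x ^ CARD('n) * measure lebesgue S \<le> E * measure lebesgue (word_comp \<phi> w ` S)"
    using word_measure_distortion by metis
  obtain x0 where "x0 \<in> K" using K_ne by auto
  then have x0: "x0 \<in> \<Omega>" using K_sub by auto
  have null: "negligible overlap" using negligible_subset[OF exceptional_null[OF K] overlap_subset_exceptional] .
  have "measure lebesgue (\<phi> j ` ?Y) = 0"
    by (rule negligible_imp_measure0[OF negligible_subset[OF null]]) auto
  moreover have "J j x0 ^ CARD('n) * measure lebesgue ?Y \<le> E * measure lebesgue (\<phi> j ` ?Y)"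
    using E(2)[of "[j]" 1 x0 ?Y] j x0 cY YO by (simp add: words_def)
  ultimately have "J j x0 ^ CARD('n) * measure lebesgue ?Y \<le> 0" by simp
  moreover have "0 < J j x0 ^ CARD('n)" using jacobian_pos[OF j x0] by simp
  ultimately have "measure lebesgue ?Y = 0"
    using measure_nonneg[of lebesgue ?Y] by (auto simp: mult_le_0_iff)
  then show ?thesis using negligible_iff_measure0[OF lmeasurable_compact[OF cY]] by simp
qed

end

section \<open>Gibbs measures as stationary measures\<close>

lemma holder_on_continuous:
  assumes "holder_on a S f" "0 < a"
  shows "continuous_on S f"
proof -
  obtain C where C: "\<And>x y. x \<in> S \<Longrightarrow> y \<in> S \<Longrightarrow> \<bar>f x - f y\<bar> \<le> C * dist x y powr a"
    using assms(1) unfolding holder_on_def by metis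
  show ?thesis
    unfolding continuous_on_def
  proof
    fix x assume x: "x \<in> S"
    have "((\<lambda>y. C * dist y x powr a) \<longlongrightarrow> C * 0) (at x within S)"
    proof (rule tendsto_mult[OF tendsto_const tendsto_zero_powrI[OF _ tendsto_const _ assms(2)]])
      show "((\<lambda>y. dist y x) \<longlongrightarrow> 0) (at x within S)"
        by (rule tendsto_eq_rhs[OF tendsto_dist[OF tendsto_ident_at tendsto_const]]) simp
    qed simp
    then have lim: "((\<lambda>y. C * dist y x powr a) \<longlongrightarrow> 0) (at x within S)" by simp
    have "((\<lambda>y. f y - f x) \<longlongrightarrow> 0) (at x within S)"
    proof (rule Lim_null_comparison[OF _ lim])
      show "\<forall>\<^sub>F y in at x within S. norm (f y - f x) \<le> C * dist y x powr a"
        unfolding eventually_at_filter using C[OF _ x] by (intro always_eventually) auto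
    qed
    then show "(f \<longlongrightarrow> f x) (at x within S)" by (simp add: LIM_zero_iff)
  qed
qed

lemma log_holder_on_compact:
  assumes f: "holder_on a S f" "0 < a" and K: "compact K" "K \<subseteq> S" and pos: "\<And>x. x \<in> K \<Longrightarrow> 0 < f x"
  obtains H where "0 \<le> H" "\<And>x y. x \<in> K \<Longrightarrow> y \<in> K \<Longrightarrow> f x \<le> f y * exp (H * dist x y powr a)"
proof (cases "K = {}")
  case False
  obtain C where C: "\<And>x y. x \<in> S \<Longrightarrow> y \<in> S \<Longrightarrow> \<bar>f x - f y\<bar> \<le> C * dist x y powr a"
    using f(1) unfolding holder_on_def by metis
  have "continuous_on K f" by (rule continuous_on_subset[OF holder_on_continuous[OF f] K(2)])
  then obtain x0 where x0: "x0 \<in> K" "\<And>x. x \<in> K \<Longrightarrow> f x0 \<le> f x"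
    using continuous_attains_inf[OF K(1) False] by blast
  define H where "H = max C 0 / f x0"
  have p: "0 < f x0" by (rule pos[OF x0(1)])
  have "f x \<le> f y * exp (H * dist x y powr a)" if x: "x \<in> K" and y: "y \<in> K" for x y
  proof -
    have "\<bar>f x - f y\<bar> \<le> C * dist x y powr a" using C x y K(2) by auto
    also have "\<dots> \<le> (H * f x0) * dist x y powr a" using p by (intro mult_right_mono) (auto simp: H_def)
    also have "\<dots> \<le> (H * f y) * dist x y powr a"
      using x0(2)[OF y] p by (intro mult_right_mono mult_left_mono) (auto simp: H_def)
    finally have "f x \<le> f y * (1 + H * dist x y powr a)" by (simp add: algebra_simps abs_le_iff)
    also have "\<dots> \<le> f y * exp (H * dist x y powr a)"
      using pos[OF y] by (intro mult_left_mono) (auto simp: exp_ge_add_one_self)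
    finally show ?thesis .
  qed
  moreover have "0 \<le> H" using p by (simp add: H_def)
  ultimately show thesis by (rule that[rotated])
qed (use that[of 0] in auto)

text \<open>
  A positive continuous eigenfunction of a transfer operator with log-Hoelder weights is
  log-Hoelder: iterating the eigenvalue equation expresses \<open>u x / u y\<close> through ratios of products of
  weights, which are controlled by bounded distortion, and values of \<open>u\<close> at points whose distance
  tends to zero.
\<close>

lemma eigenfunction_distortion:
  fixes q :: "nat \<Rightarrow> 'a::metric_space \<Rightarrow> real" and u :: "'a \<Rightarrow> real"
  assumes K: "compact K" and inv: "\<And>j x. j \<in> {1..m} \<Longrightarrow> x \<in> K \<Longrightarrow> \<phi> j x \<in> K"
    and contr: "\<And>j x y. j \<in> {1..m} \<Longrightarrow> x \<in> K \<Longrightarrow> y \<in> K \<Longrightarrow> dist (\<phi> j x) (\<phi> j y) \<le> \<rho> * dist x y"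
    and \<rho>: "0 < \<rho>" "\<rho> < 1" and a: "0 < a" and H: "0 \<le> H"
    and q0: "\<And>j x. j \<in> {1..m} \<Longrightarrow> x \<in> K \<Longrightarrow> 0 < q j x"
    and q: "\<And>j x y. j \<in> {1..m} \<Longrightarrow> x \<in> K \<Longrightarrow> y \<in> K \<Longrightarrow> q j x \<le> q j y * exp (H * dist x y powr a)"
    and u: "continuous_on K u" "\<And>x. x \<in> K \<Longrightarrow> 0 < u x" "\<And>x. x \<in> K \<Longrightarrow> branch_op m \<phi> q u x = u x"
    and x: "x \<in> K" and y: "y \<in> K"
  shows "u x \<le> u y * exp (H / (1 - \<rho> powr a) * dist x y powr a)"
proof -
  define A where "A = H / (1 - \<rho> powr a)"
  have \<beta>: "0 \<le> \<rho> powr a" "\<rho> powr a < 1" using \<rho> a powr_less_mono2[of a \<rho> 1] by auto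
  have cin: "word_comp \<phi> w z \<in> K" if "w \<in> words m n" "z \<in> K" for w n z
    by (rule word_comp_in[where S=K and m=m, OF inv that])
  have dist_w: "word_weight q \<phi> w x \<le> word_weight q \<phi> w y * exp (A * dist x y powr a)" if "w \<in> words m n" for w n
    unfolding A_def
  proof (rule bounded_distortion[where S=K and m=m and n=n and \<delta>="\<lambda>x y. dist x y powr a"])
    show "dist (\<phi> j x) (\<phi> j y) powr a \<le> \<rho> powr a * dist x y powr a" if "j \<in> {1..m}" "x \<in> K" "y \<in> K" for j x y
      using powr_mono2[OF less_imp_le[OF a] zero_le_dist contr[OF that]] \<rho> by (simp add: powr_mult)
  qed (use inv \<beta> H q0 q that x y in auto)
  have it: "(branch_op m \<phi> q ^^ n) u z = u z" if "z \<in> K" for n z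
    using that
  proof (induction n arbitrary: z)
    case (Suc n)
    have "(branch_op m \<phi> q ^^ Suc n) u z = (branch_op m \<phi> q ^^ n) (branch_op m \<phi> q u) z"
      by (simp add: funpow_swap1)
    also have "\<dots> = (branch_op m \<phi> q ^^ n) u z"
      unfolding branch_op_funpow by (intro sum.cong refl) (use u(3) cin Suc.prems in auto)
    finally show ?case using Suc by simp
  qed simp
  have wpos: "0 < word_weight q \<phi> w z" if "w \<in> words m n" "z \<in> K" for w n z
    by (rule word_weight_pos[where S=K and m=m, OF inv q0 that])
  obtain z0 where z0: "z0 \<in> K" "\<And>z. z \<in> K \<Longrightarrow> u z0 \<le> u z"
    using continuous_attains_inf[OF K _ u(1)] x by blast
  have p: "0 < u z0" by (rule u(2)[OF z0(1)])
  have le: "u x \<le> exp (A * dist x y powr a) * (u y * (1 + e / u z0))" if e: "0 < e" for e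
  proof -
    have "uniformly_continuous_on K u" by (rule compact_uniformly_continuous[OF u(1) K])
    then obtain d where d: "0 < d" "\<And>s t. s \<in> K \<Longrightarrow> t \<in> K \<Longrightarrow> dist s t < d \<Longrightarrow> dist (u s) (u t) < e"
      unfolding uniformly_continuous_on_def using e by metis
    have "(\<lambda>n. \<rho> ^ n * dist x y) \<longlonglongrightarrow> 0" using \<rho> by (intro tendsto_mult_left_zero LIMSEQ_realpow_zero) auto
    from order_tendstoD(2)[OF this d(1)] obtain n where n: "\<rho> ^ n * dist x y < d"
      by (auto simp: eventually_sequentially)
    have close: "u (word_comp \<phi> w x) \<le> u (word_comp \<phi> w y) + e" if w: "w \<in> words m n" for w
    proof -
      have "dist (word_comp \<phi> w x) (word_comp \<phi> w y) \<le> \<rho> ^ n * dist x y"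
        by (rule word_comp_contraction[where S=K and m=m and \<delta>=dist, OF inv contr _ w x y]) (use \<rho> in auto)
      then have "dist (u (word_comp \<phi> w x)) (u (word_comp \<phi> w y)) < e"
        using d(2)[OF cin[OF w x] cin[OF w y]] n by linarith
      then show ?thesis by (simp add: dist_real_def abs_less_iff)
    qed
    have "u x = (\<Sum>w\<in>words m n. word_weight q \<phi> w x * u (word_comp \<phi> w x))"
      using it[OF x, of n] by (simp add: branch_op_funpow)
    also have "\<dots> \<le> (\<Sum>w\<in>words m n. (word_weight q \<phi> w y * exp (A * dist x y powr a)) * (u (word_comp \<phi> w y) + e))"
      using close dist_w wpos[OF _ x] wpos[OF _ y] u(2)[OF cin[OF _ x]]
      by (intro sum_mono mult_mono) (auto simp: less_imp_le)
    also have "\<dots> = exp (A * dist x y powr a) * ((\<Sum>w\<in>words m n. word_weight q \<phi> w y * u (word_comp \<phi> w y))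
        + e * (\<Sum>w\<in>words m n. word_weight q \<phi> w y))"
      by (simp add: sum_distrib_left sum_distrib_right sum.distrib algebra_simps)
    also have "(\<Sum>w\<in>words m n. word_weight q \<phi> w y * u (word_comp \<phi> w y)) = u y"
      using it[OF y, of n] by (simp add: branch_op_funpow)
    also have "(\<Sum>w\<in>words m n. word_weight q \<phi> w y) \<le> u y / u z0"
    proof -
      have "(\<Sum>w\<in>words m n. word_weight q \<phi> w y) * u z0 \<le> (\<Sum>w\<in>words m n. word_weight q \<phi> w y * u (word_comp \<phi> w y))"
        unfolding sum_distrib_right
        using z0(2)[OF cin[OF _ y]] wpos[OF _ y] by (intro sum_mono mult_left_mono) (auto simp: less_imp_le)
      also have "\<dots> = u y" using it[OF y, of n] by (simp add: branch_op_funpow)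
      finally show ?thesis using p by (simp add: field_simps)
    qed
    finally show ?thesis using e by (simp add: field_simps)
  qed
  have "((\<lambda>e. exp (A * dist x y powr a) * (u y * (1 + e / u z0))) \<longlongrightarrow> exp (A * dist x y powr a) * (u y * (1 + 0 / u z0))) (at_right 0)"
    by (intro tendsto_intros) (use p in auto)
  then have "u x \<le> exp (A * dist x y powr a) * (u y * (1 + 0 / u z0))"
  proof (rule tendsto_lowerbound)
    show "\<forall>\<^sub>F e in at_right 0. u x \<le> exp (A * dist x y powr a) * (u y * (1 + e / u z0))"
      using eventually_at_right_less[of 0] by eventually_elim (rule le)
  qed simp
  then show ?thesis by (simp add: A_def mult.commute)
qed

text \<open>
  Continuous functions of the distance to a closed set decrease to its indicator, and closed sets form
  an intersection-stable generator of the Borel sets.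
\<close>

lemma finite_borel_measure_eqI:
  fixes M N :: "'a::metric_space measure"
  assumes fin: "finite_measure M" "finite_measure N" and sets: "sets M = sets borel" "sets N = sets borel"
    and eq: "\<And>f :: 'a \<Rightarrow> real. continuous_on UNIV f \<Longrightarrow> (\<And>x. 0 \<le> f x \<and> f x \<le> 1) \<Longrightarrow> (\<integral>x. f x \<partial>M) = (\<integral>x. f x \<partial>N)"
  shows "M = N"
proof (rule measure_eqI_generator_eq[where E="Collect closed" and \<Omega>=UNIV and A="\<lambda>_. UNIV"])
  show "Int_stable (Collect (closed :: 'a set \<Rightarrow> bool))" by (auto simp: Int_stable_def)
  show "sets M = sigma_sets UNIV (Collect closed)" "sets N = sigma_sets UNIV (Collect closed)"
    unfolding sets by (simp_all add: borel_eq_closed)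
  show "emeasure M UNIV \<noteq> \<infinity>" using finite_measure.emeasure_finite[OF fin(1)] by simp
  fix S :: "'a set" assume "S \<in> Collect closed"
  then have S: "closed S" by simp
  show "emeasure M S = emeasure N S"
  proof (cases "S = {}")
    case False
    define F where "F k x = max 0 (1 - real k * infdist x S)" for k :: nat and x
    have cont: "continuous_on UNIV (F k)" for k unfolding F_def by (intro continuous_intros)
    have bd: "0 \<le> F k x \<and> F k x \<le> 1" for k x by (simp add: F_def infdist_nonneg)
    have lim: "(\<lambda>k. F k x) \<longlonglongrightarrow> indicator S x" for x
    proof (cases "x \<in> S")
      case True
      then show ?thesis by (simp add: F_def)
    next
      case xS: False
      then have "0 < infdist x S"
        using in_closed_iff_infdist_zero[OF S False] infdist_nonneg[of x S] by (metis less_eq_real_def)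
      then obtain k0 :: nat where k0: "1 < real k0 * infdist x S" using reals_Archimedean3 by blast
      have "F k x = 0" if "k0 \<le> k" for k
      proof -
        have "real k0 * infdist x S \<le> real k * infdist x S" using that by (intro mult_right_mono infdist_nonneg) auto
        then show ?thesis using k0 by (simp add: F_def)
      qed
      then have "eventually (\<lambda>k. F k x = 0) sequentially" by (auto simp: eventually_sequentially)
      then show ?thesis using xS by (simp add: tendsto_eventually)
    qed
    have conv: "(\<lambda>k. \<integral>x. F k x \<partial>\<nu>) \<longlonglongrightarrow> measure \<nu> S" if \<nu>: "finite_measure \<nu>" "sets \<nu> = sets borel" for \<nu>
    proof -
      interpret finite_measure \<nu> by fact
      have [measurable_cong]: "sets \<nu> = sets borel" by fact
      have sp: "space \<nu> = UNIV" using sets_eq_imp_space_eq[OF \<nu>(2)] by simp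
      have m: "F k \<in> borel_measurable \<nu>" for k
        using borel_measurable_continuous_onI[OF cont[of k]] measurable_cong_sets[OF \<nu>(2) refl, of borel] by auto
      have "S \<in> sets \<nu>" using S \<nu>(2) by simp
      then have i: "(indicator S :: 'a \<Rightarrow> real) \<in> borel_measurable \<nu>" by simp
      have "(\<lambda>k. \<integral>x. F k x \<partial>\<nu>) \<longlonglongrightarrow> (\<integral>x. indicator S x \<partial>\<nu>)"
        by (rule integral_dominated_convergence[where w="\<lambda>_. 1"]) (use m i lim bd in auto)
      then show ?thesis using \<open>S \<in> sets \<nu>\<close> by (simp add: sp)
    qed
    have "measure M S = measure N S"
      by (rule LIMSEQ_unique[OF conv[OF fin(1) sets(1)]]) (use conv[OF fin(2) sets(2)] eq[OF cont bd] in simp)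
    then show ?thesis using fin by (simp add: finite_measure.emeasure_eq_measure)
  qed simp
qed auto

text \<open>
  Both sides are integrals of \<open>F\<close>: against \<open>R\<close> times \<open>\<nu>\<close>, and against the image under
  \<open>(j, x) \<mapsto> \<phi> j x\<close> of a weighted product measure on \<open>{1..m} \<times> K\<close>. The dual eigenvalue equation says
  that these two finite Borel measures agree on continuous functions.
\<close>

lemma stationary_gibbs:
  fixes K :: "'a::{metric_space, second_countable_topology} set" and m :: nat
  assumes K: "compact K" and sets_\<nu>: "sets \<nu> = sets (restrict_space borel K)" and \<nu>K: "emeasure \<nu> K = 1"
    and inv: "\<And>j x. j \<in> {1..m} \<Longrightarrow> x \<in> K \<Longrightarrow> \<phi> j x \<in> K"
    and \<phi>: "\<And>j. j \<in> {1..m} \<Longrightarrow> continuous_on K (\<phi> j)"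
    and G: "\<And>j. j \<in> {1..m} \<Longrightarrow> continuous_on K (G j)" "\<And>j x. j \<in> {1..m} \<Longrightarrow> x \<in> K \<Longrightarrow> 0 < G j x"
    and dual: "\<And>f :: 'a \<Rightarrow> real. continuous_on K f \<Longrightarrow> (\<integral>x. (\<Sum>j=1..m. G j x * f (\<phi> j x)) \<partial>\<nu>) = R * (\<integral>x. f x \<partial>\<nu>)"
    and R: "0 < R" and F: "F \<in> borel_measurable borel"
  shows "ennreal R * (\<integral>\<^sup>+x. F x \<partial>\<nu>) = (\<Sum>j=1..m. \<integral>\<^sup>+x. ennreal (G j x) * F (\<phi> j x) \<partial>\<nu>)"
proof -
  have sp: "space \<nu> = K" using sets_eq_imp_space_eq[OF sets_\<nu>] by (simp add: space_restrict_space)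
  interpret \<nu>: finite_measure \<nu> by standard (simp add: sp \<nu>K)
  have rm: "f \<in> borel_measurable \<nu>" if "continuous_on K f" for f :: "'a \<Rightarrow> 'a"
    using borel_measurable_continuous_on_restrict[OF that] measurable_cong_sets[OF sets_\<nu> refl, of borel] by auto
  have rmr: "f \<in> borel_measurable \<nu>" if "continuous_on K f" for f :: "'a \<Rightarrow> real"
    using borel_measurable_continuous_on_restrict[OF that] measurable_cong_sets[OF sets_\<nu> refl, of borel] by auto
  have idm: "(\<lambda>x. x) \<in> measurable \<nu> borel" by (rule rm) (rule continuous_on_id)
  have \<phi>m: "\<phi> j \<in> measurable \<nu> borel" if "j \<in> {1..m}" for j by (rule rm[OF \<phi>[OF that]])
  have Gm: "G j \<in> borel_measurable \<nu>" if "j \<in> {1..m}" for j by (rule rmr[OF G(1)[OF that]])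
  let ?P = "count_space {1..m} \<Otimes>\<^sub>M \<nu>"
  have gP: "(\<lambda>z. ennreal (G (fst z) (snd z))) \<in> borel_measurable ?P"
    by (rule measurable_pair_measure_countable1[OF countable_finite[OF finite_atLeastAtMost]]) (use Gm in auto)
  have \<phi>P: "(\<lambda>z. \<phi> (fst z) (snd z)) \<in> measurable ?P borel"
    by (rule measurable_pair_measure_countable1[OF countable_finite[OF finite_atLeastAtMost]]) (use \<phi>m in auto)
  define M1 where "M1 = distr (density ?P (\<lambda>z. ennreal (G (fst z) (snd z)))) borel (\<lambda>z. \<phi> (fst z) (snd z))"
  define M2 where "M2 = distr (density \<nu> (\<lambda>_. ennreal R)) borel (\<lambda>x. x)"
  have nn1: "(\<integral>\<^sup>+x. f x \<partial>M1) = (\<Sum>j=1..m. \<integral>\<^sup>+x. ennreal (G j x) * f (\<phi> j x) \<partial>\<nu>)"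
    if f: "f \<in> borel_measurable borel" for f :: "'a \<Rightarrow> ennreal"
  proof -
    have fP: "(\<lambda>z. f (\<phi> (fst z) (snd z))) \<in> borel_measurable ?P" by (rule measurable_compose[OF \<phi>P f])
    have "(\<integral>\<^sup>+x. f x \<partial>M1) = (\<integral>\<^sup>+z. f (\<phi> (fst z) (snd z)) \<partial>density ?P (\<lambda>z. ennreal (G (fst z) (snd z))))"
      unfolding M1_def by (rule nn_integral_distr) (use \<phi>P f in auto)
    also have "\<dots> = (\<integral>\<^sup>+z. ennreal (G (fst z) (snd z)) * f (\<phi> (fst z) (snd z)) \<partial>?P)"
      by (rule nn_integral_density[OF gP fP])
    also have "\<dots> = (\<integral>\<^sup>+j. \<integral>\<^sup>+x. ennreal (G j x) * f (\<phi> j x) \<partial>\<nu> \<partial>count_space {1..m})"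
      using \<nu>.nn_integral_fst[of "\<lambda>z. ennreal (G (fst z) (snd z)) * f (\<phi> (fst z) (snd z))" "count_space {1..m}"] gP fP
      by (simp add: borel_measurable_times_ennreal)
    also have "\<dots> = (\<Sum>j=1..m. \<integral>\<^sup>+x. ennreal (G j x) * f (\<phi> j x) \<partial>\<nu>)"
      by (rule nn_integral_count_space_finite) simp
    finally show ?thesis .
  qed
  have nn2: "(\<integral>\<^sup>+x. f x \<partial>M2) = ennreal R * (\<integral>\<^sup>+x. f x \<partial>\<nu>)" if f: "f \<in> borel_measurable borel" for f :: "'a \<Rightarrow> ennreal"
  proof -
    have f\<nu>: "f \<in> borel_measurable \<nu>" using measurable_compose[OF idm f] by simp
    have "(\<integral>\<^sup>+x. f x \<partial>M2) = (\<integral>\<^sup>+x. f x \<partial>density \<nu> (\<lambda>_. ennreal R))"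
      unfolding M2_def by (rule nn_integral_distr) (use idm f in auto)
    also have "\<dots> = (\<integral>\<^sup>+x. ennreal R * f x \<partial>\<nu>)" by (rule nn_integral_density) (use f\<nu> in auto)
    also have "\<dots> = ennreal R * (\<integral>\<^sup>+x. f x \<partial>\<nu>)" by (rule nn_integral_cmult) (rule f\<nu>)
    finally show ?thesis .
  qed
  have Gb: "\<exists>B. \<forall>x\<in>K. G j x \<le> B" if "j \<in> {1..m}" for j
    using compact_imp_bounded[OF compact_continuous_image[OF G(1)[OF that] K]]
    by (auto simp: bounded_iff) (meson abs_le_D1)
  have intG: "integrable \<nu> (\<lambda>x. G j x * f (\<phi> j x))"
    if j: "j \<in> {1..m}" and f: "f \<in> borel_measurable borel" "\<And>x. 0 \<le> f x \<and> f x \<le> 1" for j and f :: "'a \<Rightarrow> real"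
  proof -
    obtain B where B: "\<And>x. x \<in> K \<Longrightarrow> G j x \<le> B" using Gb[OF j] by blast
    show ?thesis
    proof (rule \<nu>.integrable_const_bound[where B="B * 1"])
      show "AE x in \<nu>. norm (G j x * f (\<phi> j x)) \<le> B * 1"
      proof (rule AE_I2)
        fix x assume "x \<in> space \<nu>"
        then have x: "x \<in> K" by (simp add: sp)
        show "norm (G j x * f (\<phi> j x)) \<le> B * 1"
          unfolding norm_mult using B[OF x] G(2)[OF j x] f(2)[of "\<phi> j x"] by (intro mult_mono) auto
      qed
      show "(\<lambda>x. G j x * f (\<phi> j x)) \<in> borel_measurable \<nu>"
        using Gm[OF j] measurable_compose[OF \<phi>m[OF j] f(1)] by (rule borel_measurable_times)
    qed
  qed
  have e1: "(\<integral>\<^sup>+x. ennreal (f x) \<partial>M1) = ennreal (\<integral>x. (\<Sum>j=1..m. G j x * f (\<phi> j x)) \<partial>\<nu>)"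
    if f: "f \<in> borel_measurable borel" "\<And>x. 0 \<le> f x \<and> f x \<le> 1" for f :: "'a \<Rightarrow> real"
  proof -
    have "(\<integral>\<^sup>+x. ennreal (f x) \<partial>M1) = (\<Sum>j=1..m. \<integral>\<^sup>+x. ennreal (G j x) * ennreal (f (\<phi> j x)) \<partial>\<nu>)"
      by (rule nn1) (use f in measurable)
    also have "\<dots> = (\<Sum>j=1..m. ennreal (\<integral>x. G j x * f (\<phi> j x) \<partial>\<nu>))"
    proof (rule sum.cong[OF refl])
      fix j assume j: "j \<in> {1..m}"
      have "(\<integral>\<^sup>+x. ennreal (G j x) * ennreal (f (\<phi> j x)) \<partial>\<nu>) = (\<integral>\<^sup>+x. ennreal (G j x * f (\<phi> j x)) \<partial>\<nu>)"
        using f(2) G(2)[OF j] by (intro nn_integral_cong) (auto simp: sp ennreal_mult less_imp_le)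
      also have "\<dots> = ennreal (\<integral>x. G j x * f (\<phi> j x) \<partial>\<nu>)"
        using f(2) G(2)[OF j] by (intro nn_integral_eq_integral intG[OF j f] AE_I2) (auto simp: sp less_imp_le)
      finally show "(\<integral>\<^sup>+x. ennreal (G j x) * ennreal (f (\<phi> j x)) \<partial>\<nu>) = ennreal (\<integral>x. G j x * f (\<phi> j x) \<partial>\<nu>)" .
    qed
    also have "\<dots> = ennreal (\<Sum>j=1..m. \<integral>x. G j x * f (\<phi> j x) \<partial>\<nu>)"
      using f(2) G(2) by (intro sum_ennreal Bochner_Integration.integral_nonneg) (auto simp: sp less_imp_le)
    also have "(\<Sum>j=1..m. \<integral>x. G j x * f (\<phi> j x) \<partial>\<nu>) = (\<integral>x. (\<Sum>j=1..m. G j x * f (\<phi> j x)) \<partial>\<nu>)"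
      by (rule Bochner_Integration.integral_sum[symmetric]) (rule intG[OF _ f])
    finally show ?thesis .
  qed
  have e2: "(\<integral>\<^sup>+x. ennreal (f x) \<partial>M2) = ennreal (R * (\<integral>x. f x \<partial>\<nu>))"
    if f: "f \<in> borel_measurable borel" "\<And>x. 0 \<le> f x \<and> f x \<le> 1" for f :: "'a \<Rightarrow> real"
  proof -
    have f\<nu>: "f \<in> borel_measurable \<nu>" using measurable_compose[OF idm f(1)] by simp
    have "integrable \<nu> f" by (rule \<nu>.integrable_const_bound[where B=1]) (use f f\<nu> in auto)
    then have "(\<integral>\<^sup>+x. ennreal (f x) \<partial>\<nu>) = ennreal (\<integral>x. f x \<partial>\<nu>)"
      using f(2) by (intro nn_integral_eq_integral) auto
    then show ?thesis using nn2[of "\<lambda>x. ennreal (f x)"] f R by (simp add: ennreal_mult'')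
  qed
  have s1: "sets M1 = sets borel" "space M1 = UNIV" and s2: "sets M2 = sets borel" "space M2 = UNIV"
    by (auto simp: M1_def M2_def)
  have one: "emeasure M UNIV = (\<integral>\<^sup>+x. ennreal 1 \<partial>M)" if "space M = UNIV" for M :: "'a measure"
    using that by (simp add: nn_integral_const)
  have "M1 = M2"
  proof (rule finite_borel_measure_eqI)
    show "finite_measure M1"
    proof
      show "emeasure M1 (space M1) \<noteq> \<infinity>" using one[OF s1(2)] e1[of "\<lambda>_. 1"] by (simp add: s1)
    qed
    show "finite_measure M2"
    proof
      show "emeasure M2 (space M2) \<noteq> \<infinity>" using one[OF s2(2)] e2[of "\<lambda>_. 1"] by (simp add: s2)
    qed
    fix f :: "'a \<Rightarrow> real" assume c: "continuous_on UNIV f" and f: "\<And>x. 0 \<le> f x \<and> f x \<le> 1"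
    have fb: "f \<in> borel_measurable borel" by (rule borel_measurable_continuous_onI[OF c])
    have "(\<integral>\<^sup>+x. ennreal (f x) \<partial>M1) = (\<integral>\<^sup>+x. ennreal (f x) \<partial>M2)"
      using e1[OF fb f] e2[OF fb f] dual[OF continuous_on_subset[OF c subset_UNIV]] by simp
    moreover have "f \<in> borel_measurable M1" "f \<in> borel_measurable M2"
      using fb by (simp_all add: M1_def M2_def)
    ultimately show "(\<integral>x. f x \<partial>M1) = (\<integral>x. f x \<partial>M2)"
      using f by (simp add: integral_eq_nn_integral)
  qed (rule s1 s2)+
  then show ?thesis using nn1[OF F] nn2[OF F] by simp
qed

lemma emeasure_density_indicator:
  fixes K E :: "'a::euclidean_space set"
  assumes "K \<in> sets borel" "E \<in> sets borel"
  shows "emeasure (density lborel (indicator K)) E = emeasure lborel (K \<inter> E)"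
  using assms by (subst emeasure_density) (auto simp flip: indicator_inter_arith)

context conformal_attractor
begin

lemma phi_continuous: "j \<in> {1..m} \<Longrightarrow> continuous_on K (\<phi> j)"
  using continuous_on_subset[OF cmp_continuous[of "[j]" 1] K_sub] by (simp add: words_def)

text \<open>
  Normalising the transfer operator by its eigenfunction turns a Gibbs measure into the stationary
  measure of a Markov chain that jumps from \<open>x\<close> to \<open>\<phi> j x\<close> with log-Hoelder probability.
\<close>

lemma gibbs_normalised_weights:
  assumes "gibbs_measure \<Omega> m \<phi> K \<mu>"
  obtains p a H where "0 < a" "0 \<le> H"
    "\<And>j x. j \<in> {1..m} \<Longrightarrow> x \<in> K \<Longrightarrow> 0 < p j x" "\<And>x. x \<in> K \<Longrightarrow> (\<Sum>j=1..m. p j x) = (1::real)"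
    "\<And>j. j \<in> {1..m} \<Longrightarrow> continuous_on K (p j)"
    "\<And>j x y. j \<in> {1..m} \<Longrightarrow> x \<in> K \<Longrightarrow> y \<in> K \<Longrightarrow> p j x \<le> p j y * exp (H * dist x y powr a)"
    "prob_space \<mu>" "sets \<mu> = sets borel" "emeasure \<mu> (UNIV - K) = 0"
    "\<And>F. F \<in> borel_measurable borel \<Longrightarrow> (\<integral>\<^sup>+x. F x \<partial>\<mu>)
       = (\<Sum>j=1..m. \<integral>\<^sup>+x. ennreal (indicator K x * p j x) * F (indicator K x *\<^sub>R \<phi> j x) \<partial>\<mu>)"
proof -
  from assms obtain a g R u \<nu> where a: "0 < a"
    and g: "\<And>j x. j \<in> {1..m} \<Longrightarrow> x \<in> \<phi> j ` \<Omega> \<Longrightarrow> 0 < g j x" "\<And>j. j \<in> {1..m} \<Longrightarrow> holder_on a (\<phi> j ` \<Omega>) (g j)"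
    and u: "continuous_on K u" "\<And>x. x \<in> K \<Longrightarrow> 0 < u x"
    and \<nu>: "sets \<nu> = sets (restrict_space borel K)" "emeasure \<nu> K = 1"
    and Lu: "\<And>x. x \<in> K \<Longrightarrow> transfer_operator m \<phi> g u x = R * u x"
    and dual: "\<And>f :: real^'n \<Rightarrow> real. continuous_on K f \<Longrightarrow> (\<integral>x. transfer_operator m \<phi> g f x \<partial>\<nu>) = R * (\<integral>x. f x \<partial>\<nu>)"
    and u1: "(\<integral>x. u x \<partial>\<nu>) = 1" and \<mu>: "\<mu> = distr (density \<nu> (\<lambda>x. ennreal (u x))) borel (\<lambda>x. x)"
    unfolding gibbs_measure_def by metis
  define G where "G j x = g j (\<phi> j x)" for j x
  have Gpos: "0 < G j x" if "j \<in> {1..m}" "x \<in> K" for j x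
    unfolding G_def by (rule g(1)[OF that(1)]) (use that(2) K_sub in auto)
  have Gcont: "continuous_on K (G j)" if j: "j \<in> {1..m}" for j
    unfolding G_def
  proof (rule continuous_on_compose2[OF holder_on_continuous[OF g(2)[OF j] a] phi_continuous[OF j]])
    show "\<phi> j ` K \<subseteq> \<phi> j ` \<Omega>" using K_sub by auto
  qed
  have tr: "transfer_operator m \<phi> g f x = (\<Sum>j=1..m. G j x * f (\<phi> j x))" for f :: "real^'n \<Rightarrow> real" and x
    by (simp add: transfer_operator_def G_def)
  obtain x0 where x0: "x0 \<in> K" using K_ne by auto
  have R: "0 < R"
  proof -
    have "0 < (\<Sum>j=1..m. G j x0 * u (\<phi> j x0))"
      using m_ge_2 Gpos[OF _ x0] u(2)[OF phi_K[OF _ x0]] by (intro sum_pos) auto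
    then have "0 < R * u x0" using Lu[OF x0] by (simp add: tr)
    then show ?thesis using u(2)[OF x0] by (simp add: zero_less_mult_iff)
  qed
  obtain \<rho> where \<rho>: "0 < \<rho>" "\<rho> < 1"
    "\<And>j x y. j \<in> {1..m} \<Longrightarrow> x \<in> \<Omega> \<Longrightarrow> y \<in> \<Omega> \<Longrightarrow> dist (\<phi> j x) (\<phi> j y) \<le> \<rho> * dist x y"
    using uniform_contraction by metis
  have con: "dist (\<phi> j x) (\<phi> j y) \<le> \<rho> * dist x y" if "j \<in> {1..m}" "x \<in> K" "y \<in> K" for j x y
    using \<rho>(3)[OF that(1)] that K_sub by auto
  have shrink: "dist (\<phi> j x) (\<phi> j y) powr a \<le> dist x y powr a" if "j \<in> {1..m}" "x \<in> K" "y \<in> K" for j x y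
  proof (rule powr_mono2)
    show "dist (\<phi> j x) (\<phi> j y) \<le> dist x y"
      using con[OF that] mult_right_mono[of \<rho> 1 "dist x y"] \<rho> by simp
  qed (use a in auto)
  have "\<exists>H\<ge>0. \<forall>x\<in>\<phi> j ` K. \<forall>y\<in>\<phi> j ` K. g j x \<le> g j y * exp (H * dist x y powr a)" if j: "j \<in> {1..m}" for j
  proof -
    have "\<phi> j ` K \<subseteq> \<phi> j ` \<Omega>" using K_sub by auto
    then show ?thesis
      using log_holder_on_compact[OF g(2)[OF j] a phi_compact[OF j compact_K K_sub]] g(1)[OF j] by (metis subsetD)
  qed
  then obtain Hj where Hj: "\<And>j. j \<in> {1..m} \<Longrightarrow> 0 \<le> Hj j"
    "\<And>j x y. j \<in> {1..m} \<Longrightarrow> x \<in> \<phi> j ` K \<Longrightarrow> y \<in> \<phi> j ` K \<Longrightarrow> g j x \<le> g j y * exp (Hj j * dist x y powr a)" by metis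
  define Hg where "Hg = Max (insert 0 (Hj ` {1..m}))"
  have Hg0: "0 \<le> Hg" unfolding Hg_def by (intro Max_ge) auto
  have Hgj: "Hj j \<le> Hg" if "j \<in> {1..m}" for j unfolding Hg_def using that by (intro Max_ge) auto
  have Gdist: "G j x \<le> G j y * exp (Hg * dist x y powr a)" if j: "j \<in> {1..m}" and x: "x \<in> K" and y: "y \<in> K" for j x y
  proof -
    have "G j x \<le> G j y * exp (Hj j * dist (\<phi> j x) (\<phi> j y) powr a)"
      unfolding G_def by (rule Hj(2)[OF j]) (use x y in auto)
    also have "\<dots> \<le> G j y * exp (Hg * dist x y powr a)"
      using Gpos[OF j y] Hgj[OF j] Hg0 shrink[OF j x y] by (intro mult_left_mono) (auto intro!: mult_mono)
    finally show ?thesis .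
  qed
  define Hu where "Hu = Hg / (1 - \<rho> powr a)"
  have "\<rho> powr a < 1" using powr_less_mono2[of a \<rho> 1] a \<rho> by simp
  then have Hu0: "0 \<le> Hu" using Hg0 by (simp add: Hu_def)
  have udist: "u x \<le> u y * exp (Hu * dist x y powr a)" if "x \<in> K" "y \<in> K" for x y
    unfolding Hu_def
  proof (rule eigenfunction_distortion[where m=m and \<phi>=\<phi> and q="\<lambda>j x. G j x / R" and K=K, OF compact_K phi_K con \<rho>(1,2) a Hg0])
    show "branch_op m \<phi> (\<lambda>j x. G j x / R) u x = u x" if "x \<in> K" for x
      using Lu[OF that] R by (simp add: branch_op_def tr field_simps flip: sum_divide_distrib)
    show "G j x / R \<le> G j y / R * exp (Hg * dist x y powr a)" if "j \<in> {1..m}" "x \<in> K" "y \<in> K" for j x y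
      using Gdist[OF that] R by (simp add: divide_right_mono)
  qed (use Gpos R u that in auto)
  define p where "p j x = G j x * u (\<phi> j x) / (R * u x)" for j x
  have ppos: "0 < p j x" if "j \<in> {1..m}" "x \<in> K" for j x
    using Gpos[OF that] u(2)[OF phi_K[OF that]] u(2)[OF that(2)] R by (simp add: p_def)
  have pcont: "continuous_on K (p j)" if j: "j \<in> {1..m}" for j
    unfolding p_def
    using continuous_on_compose2[OF u(1) phi_continuous[OF j]] phi_K[OF j] Gcont[OF j] u R
    by (intro continuous_intros) (auto simp: less_imp_neq[THEN not_sym])
  have psum: "(\<Sum>j=1..m. p j x) = 1" if "x \<in> K" for x
    using Lu[OF that] R u(2)[OF that] by (simp add: p_def tr flip: sum_divide_distrib)
  define H where "H = Hg + 2 * Hu"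
  have pdist: "p j x \<le> p j y * exp (H * dist x y powr a)" if j: "j \<in> {1..m}" and x: "x \<in> K" and y: "y \<in> K" for j x y
  proof -
    let ?e = "dist x y powr a"
    have ux: "u (\<phi> j x) \<le> u (\<phi> j y) * exp (Hu * ?e)"
    proof -
      have "u (\<phi> j x) \<le> u (\<phi> j y) * exp (Hu * dist (\<phi> j x) (\<phi> j y) powr a)" by (rule udist[OF phi_K[OF j x] phi_K[OF j y]])
      also have "\<dots> \<le> u (\<phi> j y) * exp (Hu * ?e)"
        using u(2)[OF phi_K[OF j y]] Hu0 shrink[OF j x y] by (intro mult_left_mono) (auto intro!: mult_left_mono)
      finally show ?thesis .
    qed
    have uy: "1 / (R * u x) \<le> 1 / (R * u y) * exp (Hu * ?e)"
    proof -
      have "u y \<le> u x * exp (Hu * ?e)" using udist[OF y x] by (simp add: dist_commute)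
      then show ?thesis using u(2)[OF x] u(2)[OF y] R by (simp add: field_simps)
    qed
    have "p j x = G j x * u (\<phi> j x) * (1 / (R * u x))" by (simp add: p_def)
    also have "\<dots> \<le> (G j y * exp (Hg * ?e)) * (u (\<phi> j y) * exp (Hu * ?e)) * (1 / (R * u y) * exp (Hu * ?e))"
      using Gdist[OF j x y] ux uy Gpos[OF j x] Gpos[OF j y] u(2)[OF phi_K[OF j x]] u(2)[OF phi_K[OF j y]] u(2)[OF x] u(2)[OF y] R
      by (intro mult_mono) auto
    also have "\<dots> = p j y * exp (H * ?e)"
    proof -
      have "exp (H * ?e) = exp (Hg * ?e) * exp (Hu * ?e) * exp (Hu * ?e)"
        by (simp add: H_def algebra_simps flip: exp_add)
      then show ?thesis by (simp add: p_def)
    qed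
    finally show ?thesis .
  qed
  have sp: "space \<nu> = K" using sets_eq_imp_space_eq[OF \<nu>(1)] by (simp add: space_restrict_space)
  have rm: "f \<in> borel_measurable \<nu>" if "continuous_on K f" for f :: "real^'n \<Rightarrow> real"
    using borel_measurable_continuous_on_restrict[OF that] measurable_cong_sets[OF \<nu>(1) refl, of borel] by auto
  have idm: "(\<lambda>x. x) \<in> measurable \<nu> borel"
    using borel_measurable_continuous_on_restrict[OF continuous_on_id, of K] measurable_cong_sets[OF \<nu>(1) refl, of borel] by auto
  have um: "u \<in> borel_measurable \<nu>" by (rule rm[OF u(1)])
  have Kb: "K \<in> sets borel" using compact_K by (rule borel_compact)
  have nn\<mu>: "(\<integral>\<^sup>+x. F x \<partial>\<mu>) = (\<integral>\<^sup>+x. ennreal (u x) * F x \<partial>\<nu>)" if F: "F \<in> borel_measurable borel" for F :: "real^'n \<Rightarrow> ennreal"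
  proof -
    have F\<nu>: "F \<in> borel_measurable \<nu>" using measurable_compose[OF idm F] by simp
    have "(\<integral>\<^sup>+x. F x \<partial>\<mu>) = (\<integral>\<^sup>+x. F x \<partial>density \<nu> (\<lambda>x. ennreal (u x)))"
      unfolding \<mu> by (rule nn_integral_distr) (use idm F in auto)
    also have "\<dots> = (\<integral>\<^sup>+x. ennreal (u x) * F x \<partial>\<nu>)" by (rule nn_integral_density) (use um F\<nu> in auto)
    finally show ?thesis .
  qed
  have s\<mu>: "sets \<mu> = sets borel" "space \<mu> = UNIV" by (auto simp: \<mu>)
  have prob: "prob_space \<mu>"
  proof
    have "integrable \<nu> u" using u1 by (metis not_integrable_integral_eq zero_neq_one)
    then have "(\<integral>\<^sup>+x. ennreal (u x) \<partial>\<nu>) = ennreal 1"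
      unfolding u1[symmetric] by (rule nn_integral_eq_integral) (use u(2) sp in \<open>auto simp: less_imp_le\<close>)
    then show "emeasure \<mu> (space \<mu>) = 1" using nn\<mu>[of "\<lambda>_. 1"] by (simp add: s\<mu>)
  qed
  have null: "emeasure \<mu> (UNIV - K) = 0"
  proof -
    have "emeasure \<mu> (UNIV - K) = (\<integral>\<^sup>+x. indicator (UNIV - K) x \<partial>\<mu>)" using Kb s\<mu> by simp
    also have "\<dots> = (\<integral>\<^sup>+x. ennreal (u x) * indicator (UNIV - K) x \<partial>\<nu>)" by (rule nn\<mu>) (use Kb in auto)
    also have "\<dots> = (\<integral>\<^sup>+x. 0 \<partial>\<nu>)" by (rule nn_integral_cong) (simp add: sp)
    finally show ?thesis by simp
  qed
  have stat: "(\<integral>\<^sup>+x. F x \<partial>\<mu>) = (\<Sum>j=1..m. \<integral>\<^sup>+x. ennreal (indicator K x * p j x) * F (indicator K x *\<^sub>R \<phi> j x) \<partial>\<mu>)"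
    if F: "F \<in> borel_measurable borel" for F :: "real^'n \<Rightarrow> ennreal"
  proof -
    have uK: "(\<lambda>x. indicator K x *\<^sub>R u x) \<in> borel_measurable borel"
      using Kb u(1) by (rule borel_measurable_continuous_on_indicator)
    have Um: "(\<lambda>x. ennreal (indicator K x *\<^sub>R u x) * F x) \<in> borel_measurable borel"
      by (intro borel_measurable_times_ennreal measurable_compose[OF uK measurable_ennreal] F)
    have "ennreal R * (\<integral>\<^sup>+x. F x \<partial>\<mu>) = ennreal R * (\<integral>\<^sup>+x. ennreal (indicator K x *\<^sub>R u x) * F x \<partial>\<nu>)"
      unfolding nn\<mu>[OF F] by (intro arg_cong[where f="(*) (ennreal R)"] nn_integral_cong) (simp add: sp)
    also have "\<dots> = (\<Sum>j=1..m. \<integral>\<^sup>+x. ennreal (G j x) * (ennreal (indicator K (\<phi> j x) *\<^sub>R u (\<phi> j x)) * F (\<phi> j x)) \<partial>\<nu>)"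
      by (rule stationary_gibbs[where K=K and \<phi>=\<phi> and G=G and F="\<lambda>x. ennreal (indicator K x *\<^sub>R u x) * F x",
            OF compact_K \<nu> phi_K phi_continuous Gcont Gpos _ R Um])
         (use dual tr in auto)
    also have "\<dots> = (\<Sum>j=1..m. ennreal R * (\<integral>\<^sup>+x. ennreal (indicator K x * p j x) * F (indicator K x *\<^sub>R \<phi> j x) \<partial>\<mu>))"
    proof (rule sum.cong[OF refl])
      fix j assume j: "j \<in> {1..m}"
      have pK: "(\<lambda>x. indicator K x *\<^sub>R p j x) \<in> borel_measurable borel"
        using Kb pcont[OF j] by (rule borel_measurable_continuous_on_indicator)
      have phK: "(\<lambda>x. indicator K x *\<^sub>R \<phi> j x) \<in> borel_measurable borel"
        using Kb phi_continuous[OF j] by (rule borel_measurable_continuous_on_indicator)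
      have pF: "(\<lambda>x. ennreal (indicator K x * p j x) * F (indicator K x *\<^sub>R \<phi> j x)) \<in> borel_measurable borel"
        using measurable_compose[OF pK measurable_ennreal] measurable_compose[OF phK F]
        by (simp add: borel_measurable_times_ennreal)
      have pF\<nu>: "(\<lambda>x. ennreal (u x) * (ennreal (indicator K x * p j x) * F (indicator K x *\<^sub>R \<phi> j x))) \<in> borel_measurable \<nu>"
        using measurable_compose[OF um measurable_ennreal] measurable_compose[OF idm pF] by (rule borel_measurable_times_ennreal)
      have "ennreal R * (\<integral>\<^sup>+x. ennreal (indicator K x * p j x) * F (indicator K x *\<^sub>R \<phi> j x) \<partial>\<mu>)
          = (\<integral>\<^sup>+x. ennreal R * (ennreal (u x) * (ennreal (indicator K x * p j x) * F (indicator K x *\<^sub>R \<phi> j x))) \<partial>\<nu>)"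
        unfolding nn\<mu>[OF pF] by (rule nn_integral_cmult[symmetric, OF pF\<nu>])
      also have "\<dots> = (\<integral>\<^sup>+x. ennreal (G j x) * (ennreal (indicator K (\<phi> j x) *\<^sub>R u (\<phi> j x)) * F (\<phi> j x)) \<partial>\<nu>)"
      proof (rule nn_integral_cong)
        fix x assume "x \<in> space \<nu>"
        then have x: "x \<in> K" by (simp add: sp)
        have "R * (u x * p j x) = G j x * u (\<phi> j x)" using R u(2)[OF x] by (simp add: p_def)
        then have "ennreal R * (ennreal (u x) * ennreal (p j x)) = ennreal (G j x) * ennreal (u (\<phi> j x))"
          using R u(2)[OF x] ppos[OF j x] Gpos[OF j x] u(2)[OF phi_K[OF j x]]
          by (simp add: less_imp_le flip: ennreal_mult)
        then show "ennreal R * (ennreal (u x) * (ennreal (indicator K x * p j x) * F (indicator K x *\<^sub>R \<phi> j x)))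
           = ennreal (G j x) * (ennreal (indicator K (\<phi> j x) *\<^sub>R u (\<phi> j x)) * F (\<phi> j x))"
          using x phi_K[OF j x] by (simp flip: mult.assoc)
      qed
      finally show "(\<integral>\<^sup>+x. ennreal (G j x) * (ennreal (indicator K (\<phi> j x) *\<^sub>R u (\<phi> j x)) * F (\<phi> j x)) \<partial>\<nu>)
          = ennreal R * (\<integral>\<^sup>+x. ennreal (indicator K x * p j x) * F (indicator K x *\<^sub>R \<phi> j x) \<partial>\<mu>)" by simp
    qed
    also have "\<dots> = ennreal R * (\<Sum>j=1..m. \<integral>\<^sup>+x. ennreal (indicator K x * p j x) * F (indicator K x *\<^sub>R \<phi> j x) \<partial>\<mu>)"
      by (simp add: sum_distrib_left)
    finally show ?thesis using R by (simp add: ennreal_mult_cancel_left)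
  qed
  have "0 \<le> H" using Hg0 Hu0 by (simp add: H_def)
  then show thesis using that[of a H p] a ppos psum pcont pdist prob s\<mu>(1) null stat by blast
qed

text \<open>
  The general theorem for chains is applied with the normalised weights, extended by 0 outside \<open>K\<close> to
  obtain Borel functions, and with \<open>inverse_branch\<close> in place of the induced map. The two maps have the
  same orbits almost everywhere, because \<open>\<mu>\<close>-almost every orbit avoids the null set \<open>exceptional\<close>.
\<close>

theorem gibbs_return_count_error:
  assumes gibbs: "gibbs_measure \<Omega> m \<phi> K \<mu>"
    and abs_cont: "0 \<le> C0" "\<And>E. E \<in> sets borel \<Longrightarrow> emeasure \<mu> E \<le> ennreal C0 * emeasure lborel (K \<inter> E)"
    and r: "\<And>n. 0 \<le> r n" "\<And>n. r n \<le> R" and e: "\<epsilon> > 0"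
  shows "AE x in \<mu>. \<exists>C\<ge>0. \<forall>N.
      \<bar>\<Sum>n<N. indicator (ball x (r n)) ((induced_map m \<phi> K ^^ n) x) - measure \<mu> (ball x (r n))\<bar>
        \<le> C * (sqrt (1 + (\<Sum>n<N. r n ^ CARD('n))) * ln (2 + (\<Sum>n<N. r n ^ CARD('n))) powr (3/2 + \<epsilon>))"
proof -
  obtain p a H where a: "0 < a" and H: "0 \<le> H"
    and ppos: "\<And>j x. j \<in> {1..m} \<Longrightarrow> x \<in> K \<Longrightarrow> 0 < p j x" and psum: "\<And>x. x \<in> K \<Longrightarrow> (\<Sum>j=1..m. p j x) = (1::real)"
    and pcont: "\<And>j. j \<in> {1..m} \<Longrightarrow> continuous_on K (p j)"
    and pdist: "\<And>j x y. j \<in> {1..m} \<Longrightarrow> x \<in> K \<Longrightarrow> y \<in> K \<Longrightarrow> p j x \<le> p j y * exp (H * dist x y powr a)"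
    and prob: "prob_space \<mu>" and s\<mu>: "sets \<mu> = sets borel" and null: "emeasure \<mu> (UNIV - K) = 0"
    and stat: "\<And>F. F \<in> borel_measurable borel \<Longrightarrow> (\<integral>\<^sup>+x. F x \<partial>\<mu>)
       = (\<Sum>j=1..m. \<integral>\<^sup>+x. ennreal (indicator K x * p j x) * F (indicator K x *\<^sub>R \<phi> j x) \<partial>\<mu>)"
    by (rule gibbs_normalised_weights[OF gibbs]) (rule that)
  interpret \<mu>: prob_space \<mu> by (rule prob)
  have sp: "space \<mu> = UNIV" using sets_eq_imp_space_eq[OF s\<mu>] by simp
  have Kb: "K \<in> sets borel" using compact_K by (rule borel_compact)
  have AEK: "AE x in \<mu>. x \<in> K"
    using null Kb s\<mu> by (intro AE_I[where N="UNIV - K"]) auto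
  define p' where "p' j x = indicator K x * p j x" for j x
  define \<phi>' where "\<phi>' j x = indicator K x *\<^sub>R \<phi> j x" for j x
  have p'K: "p' j x = p j x" "\<phi>' j x = \<phi> j x" if "x \<in> K" for j x using that by (auto simp: p'_def \<phi>'_def)
  have p'm: "p' j \<in> borel_measurable borel" if "j \<in> {1..m}" for j
    using borel_measurable_continuous_on_indicator[OF Kb pcont[OF that]] by (simp add: p'_def[abs_def])
  have \<phi>'m: "\<phi>' j \<in> borel_measurable borel" if "j \<in> {1..m}" for j
    using borel_measurable_continuous_on_indicator[OF Kb phi_continuous[OF that]] by (simp add: \<phi>'_def[abs_def])
  have p1: "p' j x \<le> 1" "0 \<le> p' j x" if j: "j \<in> {1..m}" for j x
  proof -
    show "0 \<le> p' j x" using ppos[OF j] by (auto simp: p'_def indicator_def less_imp_le)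
    have "p j x \<le> (\<Sum>j=1..m. p j x)" if "x \<in> K"
      using j ppos[OF _ that] by (intro member_le_sum) (auto simp: less_imp_le)
    then show "p' j x \<le> 1" using psum[of x] by (auto simp: p'_def indicator_def)
  qed
  have bint: "integrable \<mu> F" if "F \<in> borel_measurable borel" "\<And>x. x \<in> K \<Longrightarrow> \<bar>F x\<bar> \<le> B" for F :: "real^'n \<Rightarrow> real" and B
    using that AEK s\<mu> measurable_cong_sets[OF s\<mu> refl, of borel]
    by (intro \<mu>.integrable_const_bound[where B=B]) (auto elim!: eventually_mono)
  have stat0: "integrable \<mu> (\<lambda>x. p' j x * F (\<phi>' j x))"
    if F: "F \<in> borel_measurable borel" "\<And>x. x \<in> K \<Longrightarrow> \<bar>F x\<bar> \<le> B" and j: "j \<in> {1..m}" for F :: "real^'n \<Rightarrow> real" and B j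
  proof (rule bint[of _ "1 * B"])
    show "(\<lambda>x. p' j x * F (\<phi>' j x)) \<in> borel_measurable borel"
      by (intro borel_measurable_times p'm j measurable_compose[OF \<phi>'m[OF j] F(1)])
    fix x assume x: "x \<in> K"
    show "\<bar>p' j x * F (\<phi>' j x)\<bar> \<le> 1 * B"
      unfolding abs_mult using p1[OF j, of x] F(2)[OF phi_K[OF j x]] p'K(2)[OF x] by (intro mult_mono) auto
  qed
  have stat1: "(\<integral>x. F x \<partial>\<mu>) = (\<Sum>j=1..m. \<integral>x. p' j x * F (\<phi>' j x) \<partial>\<mu>)"
    if F: "F \<in> borel_measurable borel" "\<And>x. x \<in> K \<Longrightarrow> \<bar>F x\<bar> \<le> B" "\<And>x. 0 \<le> F x" for F :: "real^'n \<Rightarrow> real" and B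
  proof -
    have "ennreal (\<integral>x. F x \<partial>\<mu>) = (\<integral>\<^sup>+x. ennreal (F x) \<partial>\<mu>)"
      by (rule nn_integral_eq_integral[symmetric]) (use bint[OF F(1,2)] F(3) in auto)
    also have "\<dots> = (\<Sum>j=1..m. \<integral>\<^sup>+x. ennreal (p' j x) * ennreal (F (\<phi>' j x)) \<partial>\<mu>)"
      unfolding p'_def \<phi>'_def by (rule stat) (use F(1) in measurable)
    also have "\<dots> = (\<Sum>j=1..m. ennreal (\<integral>x. p' j x * F (\<phi>' j x) \<partial>\<mu>))"
    proof (rule sum.cong[OF refl])
      fix j assume j: "j \<in> {1..m}"
      have "(\<integral>\<^sup>+x. ennreal (p' j x) * ennreal (F (\<phi>' j x)) \<partial>\<mu>) = (\<integral>\<^sup>+x. ennreal (p' j x * F (\<phi>' j x)) \<partial>\<mu>)"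
        using p1[OF j] F(3) by (intro nn_integral_cong) (simp add: ennreal_mult)
      also have "\<dots> = ennreal (\<integral>x. p' j x * F (\<phi>' j x) \<partial>\<mu>)"
        by (rule nn_integral_eq_integral[OF stat0[OF F(1,2) j]]) (use p1[OF j] F(3) in auto)
      finally show "(\<integral>\<^sup>+x. ennreal (p' j x) * ennreal (F (\<phi>' j x)) \<partial>\<mu>) = ennreal (\<integral>x. p' j x * F (\<phi>' j x) \<partial>\<mu>)" .
    qed
    also have "\<dots> = ennreal (\<Sum>j=1..m. \<integral>x. p' j x * F (\<phi>' j x) \<partial>\<mu>)"
      using p1 F(3) by (intro sum_ennreal Bochner_Integration.integral_nonneg mult_nonneg_nonneg) auto
    finally show ?thesis
      using p1 F(3) by (subst (asm) ennreal_inj) (auto intro!: sum_nonneg Bochner_Integration.integral_nonneg)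
  qed
  have stat2: "(\<integral>x. F x \<partial>\<mu>) = (\<Sum>j=1..m. \<integral>x. p' j x * F (\<phi>' j x) \<partial>\<mu>)"
    if F: "F \<in> borel_measurable borel" "\<And>x. x \<in> K \<Longrightarrow> \<bar>F x\<bar> \<le> B" for F :: "real^'n \<Rightarrow> real" and B
  proof -
    define F1 where "F1 x = max 0 (F x)" for x
    define F2 where "F2 x = max 0 (- F x)" for x
    have m: "F1 \<in> borel_measurable borel" "F2 \<in> borel_measurable borel"
      unfolding F1_def[abs_def] F2_def[abs_def] using F(1) by auto
    have b: "\<bar>F1 x\<bar> \<le> B" "\<bar>F2 x\<bar> \<le> B" if "x \<in> K" for x using F(2)[OF that] by (auto simp: F1_def F2_def)
    have n: "0 \<le> F1 x" "0 \<le> F2 x" "F x = F1 x - F2 x" for x by (auto simp: F1_def F2_def)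
    have "(\<integral>x. F x \<partial>\<mu>) = (\<integral>x. F1 x \<partial>\<mu>) - (\<integral>x. F2 x \<partial>\<mu>)"
      unfolding n(3) by (rule Bochner_Integration.integral_diff) (rule bint[OF m(1) b(1)] bint[OF m(2) b(2)]; assumption)+
    also have "\<dots> = (\<Sum>j=1..m. (\<integral>x. p' j x * F1 (\<phi>' j x) \<partial>\<mu>) - (\<integral>x. p' j x * F2 (\<phi>' j x) \<partial>\<mu>))"
      using stat1[OF m(1) b(1) n(1)] stat1[OF m(2) b(2) n(2)] by (simp add: sum_subtractf)
    also have "\<dots> = (\<Sum>j=1..m. \<integral>x. p' j x * F (\<phi>' j x) \<partial>\<mu>)"
    proof (rule sum.cong[OF refl])
      fix j assume j: "j \<in> {1..m}"
      show "(\<integral>x. p' j x * F1 (\<phi>' j x) \<partial>\<mu>) - (\<integral>x. p' j x * F2 (\<phi>' j x) \<partial>\<mu>) = (\<integral>x. p' j x * F (\<phi>' j x) \<partial>\<mu>)"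
        unfolding n(3) right_diff_distrib
        by (rule Bochner_Integration.integral_diff[symmetric]) (rule stat0[OF m(1) b(1) j] stat0[OF m(2) b(2) j]; assumption)+
    qed
    finally show ?thesis .
  qed
  have ac: "AE x in \<mu>. x \<notin> S" if "negligible S" for S
  proof -
    have "S \<in> null_sets lebesgue" using that by (simp add: negligible_iff_null_sets)
    then obtain N where N: "N \<in> null_sets lborel" "S \<subseteq> N" by (auto simp: null_sets_completion_iff2)
    have "emeasure lborel (K \<inter> N) = 0" using N Kb by (metis emeasure_eq_0 inf_le2 null_setsD1 null_setsD2)
    then have "emeasure \<mu> N \<le> 0" using abs_cont(2)[of N] N by (auto simp: null_sets_def)
    then show ?thesis using N s\<mu> by (intro AE_I[where N=N]) (auto simp: null_sets_def)
  qed
  have Kpos: "0 < measure lebesgue K"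
  proof -
    have "emeasure lborel K \<noteq> 0"
    proof
      assume "emeasure lborel K = 0"
      then have "emeasure \<mu> UNIV \<le> 0" using abs_cont(2)[of UNIV] by simp
      then show False using \<mu>.emeasure_space_1 by (simp add: sp)
    qed
    then have "measure lborel K \<noteq> 0"
      using emeasure_bounded_finite[OF compact_imp_bounded[OF compact_K]] by (auto simp: measure_def enn2real_eq_0_iff)
    then show ?thesis using Kb by (simp add: zero_less_measure_iff)
  qed
  obtain \<rho> where \<rho>: "0 < \<rho>" "\<rho> < 1"
    "\<And>j x y. j \<in> {1..m} \<Longrightarrow> x \<in> \<Omega> \<Longrightarrow> y \<in> \<Omega> \<Longrightarrow> dist (\<phi> j x) (\<phi> j y) \<le> \<rho> * dist x y"
    using uniform_contraction by metis
  have con: "dist (\<phi>' j x) (\<phi>' j y) \<le> \<rho> * dist x y" if "j \<in> {1..m}" "x \<in> K" "y \<in> K" for j x y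
    using \<rho>(3)[OF that(1)] that K_sub by (auto simp: p'K)
  obtain B where B: "\<And>x y. x \<in> K \<Longrightarrow> y \<in> K \<Longrightarrow> dist x y \<le> B"
    using compact_imp_bounded[OF compact_K] by (metis bounded_two_points)
  define D where "D = max B 1"
  have D: "0 < D" "\<And>x y. x \<in> K \<Longrightarrow> y \<in> K \<Longrightarrow> dist x y \<le> D" using B by (auto simp: D_def intro: max.coboundedI1)
  define V where "V = measure lborel (ball (0::real^'n) 1)"
  have ballV: "measure lborel (ball x s) = V * s ^ CARD('n)" if "0 \<le> s" for x :: "real^'n" and s
    using content_ball_conv_unit_ball[OF that, of x] by (simp add: V_def mult.commute)
  have shell: "measure \<mu> (ball x r) - measure \<mu> (ball x s) \<le> (C0 * V) * (r ^ CARD('n) - s ^ CARD('n))"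
    if "0 \<le> s" "s \<le> r" for x r s
  proof -
    have sub: "ball x s \<subseteq> ball x r" using that by (intro subset_ball)
    have fin: "emeasure lborel (ball x q) \<noteq> \<infinity>" for q using emeasure_bounded_finite[of "ball x q"] by auto
    have "measure lborel (ball x r - ball x s) = measure lborel (ball x r) - measure lborel (ball x s)"
      by (rule measure_Diff[OF fin]) (use sub in auto)
    then have L: "measure lborel (ball x r - ball x s) = V * (r ^ CARD('n) - s ^ CARD('n))"
      using that by (simp add: ballV right_diff_distrib)
    have finD: "emeasure lborel (ball x r - ball x s) = ennreal (measure lborel (ball x r - ball x s))"
    proof (rule emeasure_eq_ennreal_measure)
      have "emeasure lborel (ball x r - ball x s) \<le> emeasure lborel (ball x r)" by (rule emeasure_mono) auto
      then show "emeasure lborel (ball x r - ball x s) \<noteq> top" using fin[of r] by (auto simp: top_unique)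
    qed
    have "measure \<mu> (ball x r) - measure \<mu> (ball x s) = measure \<mu> (ball x r - ball x s)"
      by (rule \<mu>.finite_measure_Diff[symmetric]) (use sub s\<mu> in auto)
    also have "ennreal \<dots> = emeasure \<mu> (ball x r - ball x s)" by (simp add: \<mu>.emeasure_eq_measure)
    also have "\<dots> \<le> ennreal C0 * emeasure lborel (K \<inter> (ball x r - ball x s))" by (rule abs_cont) simp
    also have "\<dots> \<le> ennreal C0 * emeasure lborel (ball x r - ball x s)" by (intro mult_left_mono emeasure_mono) auto
    also have "\<dots> = ennreal (C0 * (V * (r ^ CARD('n) - s ^ CARD('n))))" by (simp add: finD L ennreal_mult' abs_cont(1))
    finally show ?thesis
      using that abs_cont(1) by (subst (asm) ennreal_le_iff) (auto simp: V_def mult.assoc power_mono)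
  qed
  interpret C: measured_chain m \<phi>' p' K "\<lambda>x y. dist x y powr a" "\<rho> powr a" H "D powr a" \<mu> inverse_branch \<rho> D "C0 * V" "CARD('n)"
  proof
    show "K \<noteq> {}" by (rule K_ne)
    show "\<phi>' j x \<in> K" if "j \<in> {1..m}" "x \<in> K" for j x using phi_K[OF that] by (simp add: p'K[OF that(2)])
    show "dist (\<phi>' j x) (\<phi>' j y) powr a \<le> \<rho> powr a * dist x y powr a" if "j \<in> {1..m}" "x \<in> K" "y \<in> K" for j x y
      using dist_powr_contraction[OF con[OF that] \<rho>(1) a] .
    show "dist x y powr a \<le> D powr a" if "x \<in> K" "y \<in> K" for x y using D(2)[OF that] a by (intro powr_mono2) auto
    show "\<rho> powr a < 1" using powr_less_mono2[of a \<rho> 1] a \<rho> by simp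
    show "0 < p' j x" if "j \<in> {1..m}" "x \<in> K" for j x using ppos[OF that] by (simp add: p'K[OF that(2)])
    show "(\<Sum>j=1..m. p' j x) = 1" if "x \<in> K" for x using psum[OF that] by (simp add: p'K[OF that])
    show "p' j x \<le> p' j y * exp (H * dist x y powr a)" if "j \<in> {1..m}" "x \<in> K" "y \<in> K" for j x y
      using pdist[OF that] that by (simp add: p'K)
    show "(\<integral>x. F x \<partial>\<mu>) = (\<Sum>j=1..m. \<integral>x. p' j x * F (\<phi>' j x) \<partial>\<mu>)"
      if "F \<in> borel_measurable borel" "\<And>x. x \<in> K \<Longrightarrow> \<bar>F x\<bar> \<le> B" for F :: "real^'n \<Rightarrow> real" and B by (rule stat2[OF that])
    show "AE x in \<mu>. inverse_branch (\<phi>' j x) = x" if j: "j \<in> {1..m}" for j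
      using AEK ac[OF preimage_overlap_null[OF Kpos j]]
    proof eventually_elim
      case (elim x)
      then show ?case using inverse_branch_eq[OF j, of x] by (simp add: p'K)
    qed
    show "inverse_branch \<in> borel_measurable borel" by (rule inverse_branch_borel)
    show "measure \<mu> (ball x r) - measure \<mu> (ball x s) \<le> C0 * V * (r ^ CARD('n) - s ^ CARD('n))"
      if "0 \<le> s" "s \<le> r" for x r s by (rule shell[OF that])
  qed (use \<rho> H s\<mu> AEK p'm \<phi>'m con D in auto)
  have good: "AE x in \<mu>. x \<in> K \<and> x \<notin> exceptional"
    using AEK ac[OF exceptional_null[OF Kpos]] by eventually_elim simp
  have "AE x in \<mu>. \<forall>n. (inverse_branch ^^ n) x \<in> K \<and> (inverse_branch ^^ n) x \<notin> exceptional"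
    unfolding AE_all_countable using C.AE_T_preimage[OF good] by blast
  moreover have "AE x in \<mu>. \<exists>C\<ge>0. \<forall>N. \<bar>\<Sum>n<N. C.hit n (r n) x - C.ball_mass (r n) x\<bar>
     \<le> C * (sqrt (1 + (\<Sum>n<N. r n ^ CARD('n))) * ln (2 + (\<Sum>n<N. r n ^ CARD('n))) powr (3/2 + \<epsilon>))"
    by (rule C.return_count_error[OF r e])
  ultimately show ?thesis
  proof eventually_elim
    case (elim x)
    have "(induced_map m \<phi> K ^^ n) x = (inverse_branch ^^ n) x" for n
      by (induction n) (use elim(1) induced_map_eq_inverse_branch in auto)
    with elim(2) show ?case by (simp add: C.hit_def C.ball_mass_def)
  qed
qed

end

section \<open>Asymptotics of the return count\<close>

lemma weighted_average_null:
  fixes e w :: "nat \<Rightarrow> real"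
  assumes e: "e \<longlonglongrightarrow> 0" and w: "\<And>n. 0 \<le> w n" and W: "filterlim (\<lambda>N. \<Sum>n=1..N. w n) at_top sequentially"
  shows "(\<lambda>N. (\<Sum>n=1..N. e n * w n) / (\<Sum>n=1..N. w n)) \<longlonglongrightarrow> 0"
proof (rule LIMSEQ_I)
  fix \<delta> :: real assume \<delta>: "0 < \<delta>"
  obtain n0 where n0: "\<And>n. n0 \<le> n \<Longrightarrow> \<bar>e n\<bar> < \<delta> / 2"
    using LIMSEQ_D[OF e, of "\<delta> / 2"] \<delta> by auto
  define A where "A = (\<Sum>n=1..n0. \<bar>e n\<bar> * w n)"
  have A0: "0 \<le> A" unfolding A_def using w by (intro sum_nonneg) auto
  have "eventually (\<lambda>N. 2 * A / \<delta> + 1 \<le> (\<Sum>n=1..N. w n)) sequentially"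
    using W by (simp add: filterlim_at_top)
  then obtain n1 where n1: "\<And>N. n1 \<le> N \<Longrightarrow> 2 * A / \<delta> + 1 \<le> (\<Sum>n=1..N. w n)"
    by (auto simp: eventually_sequentially)
  have "norm ((\<Sum>n=1..N. e n * w n) / (\<Sum>n=1..N. w n) - 0) < \<delta>" if N: "max n0 n1 \<le> N" for N
  proof -
    let ?W = "\<Sum>n=1..N. w n"
    have Wbig: "2 * A / \<delta> + 1 \<le> ?W" using n1 N by simp
    have "0 \<le> 2 * A / \<delta>" using A0 \<delta> by simp
    then have W0: "0 < ?W" using Wbig by linarith
    have "\<bar>\<Sum>n=1..N. e n * w n\<bar> \<le> (\<Sum>n=1..N. \<bar>e n\<bar> * w n)"
      using sum_abs[of "\<lambda>n. e n * w n" "{1..N}"] w by (simp add: abs_mult)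
    also have "\<dots> \<le> (\<Sum>n=1..N. (if n \<le> n0 then \<bar>e n\<bar> * w n else 0) + \<delta> / 2 * w n)"
    proof (rule sum_mono)
      fix n
      show "\<bar>e n\<bar> * w n \<le> (if n \<le> n0 then \<bar>e n\<bar> * w n else 0) + \<delta> / 2 * w n"
      proof (cases "n \<le> n0")
        case False
        then have "\<bar>e n\<bar> \<le> \<delta> / 2" using n0[of n] by simp
        then have "\<bar>e n\<bar> * w n \<le> \<delta> / 2 * w n" using w by (rule mult_right_mono)
        then show ?thesis using False by simp
      qed (use w[of n] \<delta> in simp)
    qed
    also have "\<dots> = A + \<delta> / 2 * ?W"
    proof -
      have "(\<Sum>n=1..N. if n \<le> n0 then \<bar>e n\<bar> * w n else 0) = A"
        unfolding A_def using N by (intro sum.mono_neutral_cong_right) auto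
      then show ?thesis by (simp add: sum.distrib sum_distrib_left)
    qed
    also have "A < \<delta> / 2 * ?W"
    proof -
      have "2 * A / \<delta> < ?W" using Wbig by linarith
      then show ?thesis using \<delta> by (simp add: field_simps)
    qed
    finally have "\<bar>\<Sum>n=1..N. e n * w n\<bar> < \<delta> * ?W" by simp
    then show ?thesis using W0 by (simp add: abs_divide pos_divide_less_eq)
  qed
  then show "\<exists>n0. \<forall>N\<ge>n0. norm ((\<Sum>n=1..N. e n * w n) / (\<Sum>n=1..N. w n) - 0) < \<delta>" by blast
qed

lemma AE_density_bounded:
  fixes K :: "'a::euclidean_space set" and h :: "'a \<Rightarrow> real"
  assumes K: "K \<in> sets borel" "emeasure lborel K < \<infinity>" and h: "h \<in> borel_measurable borel" "\<And>x. 0 \<le> h x" and C: "0 \<le> C"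
    and le: "\<And>E. E \<in> sets borel \<Longrightarrow>
      emeasure (density (density lborel (indicator K)) (\<lambda>x. ennreal (h x))) E \<le> ennreal C * emeasure lborel (K \<inter> E)"
  shows "AE x in lborel. x \<in> K \<longrightarrow> h x \<le> C"
proof -
  note [measurable] = K(1) h(1)
  define A where "A = {x \<in> K. C < h x}"
  have Am [measurable]: "A \<in> sets borel" unfolding A_def by measurable
  have "emeasure (density (density lborel (indicator K)) (\<lambda>x. ennreal (h x))) A
      = (\<integral>\<^sup>+x. ennreal (h x) * indicator A x \<partial>density lborel (indicator K))"
    by (subst emeasure_density) auto
  also have "\<dots> = (\<integral>\<^sup>+x. indicator K x * (ennreal (h x) * indicator A x) \<partial>lborel)"
    by (subst nn_integral_density) auto
  also have "\<dots> = (\<integral>\<^sup>+x. ennreal (h x) * indicator A x \<partial>lborel)"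
    by (rule nn_integral_cong) (auto simp: A_def indicator_def)
  finally have 1: "(\<integral>\<^sup>+x. ennreal (h x) * indicator A x \<partial>lborel) \<le> ennreal C * emeasure lborel (K \<inter> A)"
    using le[OF Am] by simp
  have KA: "K \<inter> A = A" by (auto simp: A_def)
  have 2: "(\<integral>\<^sup>+x. ennreal C * indicator A x \<partial>lborel) = ennreal C * emeasure lborel A"
    by (rule nn_integral_cmult_indicator) simp
  have "emeasure lborel A \<le> emeasure lborel K" by (rule emeasure_mono) (auto simp: A_def)
  then have fin: "ennreal C * emeasure lborel A \<noteq> \<infinity>" using K(2) by (auto simp: ennreal_mult_eq_top_iff top_unique)
  have "(\<integral>\<^sup>+x. ennreal (h x - C) * indicator A x \<partial>lborel) = (\<integral>\<^sup>+x. ennreal (h x) * indicator A x - ennreal C * indicator A x \<partial>lborel)"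
    using C by (intro nn_integral_cong) (auto simp: indicator_def ennreal_minus)
  also have "\<dots> = (\<integral>\<^sup>+x. ennreal (h x) * indicator A x \<partial>lborel) - (\<integral>\<^sup>+x. ennreal C * indicator A x \<partial>lborel)"
    by (rule nn_integral_diff) (use fin 2 in \<open>auto simp: A_def indicator_def intro!: ennreal_leI\<close>)
  also have "\<dots> = 0" unfolding 2
  proof (rule diff_eq_0_ennreal)
    show "(\<integral>\<^sup>+x. ennreal (h x) * indicator A x \<partial>lborel) \<le> ennreal C * emeasure lborel A" using 1 unfolding KA .
    also have "\<dots> < top" using fin by (simp add: less_top)
    finally show "(\<integral>\<^sup>+x. ennreal (h x) * indicator A x \<partial>lborel) < top" .
  qed
  finally have "AE x in lborel. ennreal (h x - C) * indicator A x = 0"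
    by (subst (asm) nn_integral_0_iff_AE) auto
  then show ?thesis
  proof eventually_elim
    case (elim x)
    then show ?case by (cases "x \<in> A") (auto simp: A_def ennreal_eq_0_iff)
  qed
qed

text \<open>
  A bound in terms of the sum of \<open>\<psi> n ^ d\<close> is stronger than one in terms of the sum of
  \<open>\<psi> n powr ((1 - \<eta>) * d)\<close>, because \<open>\<psi>\<close> is bounded; the additive constants are absorbed once the latter
  sum is positive.
\<close>

lemma error_term_comparison:
  fixes S :: "nat \<Rightarrow> real"
  assumes b: "\<And>N. \<bar>S N\<bar> \<le> C * (sqrt (1 + Psi_sum d \<psi> 0 N) * ln (2 + Psi_sum d \<psi> 0 N) powr e)" and C: "0 \<le> C" and e: "0 \<le> e"
    and \<psi>: "\<And>x. 0 \<le> \<psi> x" "\<And>n. 1 \<le> n \<Longrightarrow> \<psi> (real n) \<le> R" and \<eta>: "0 < \<eta>"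
    and S0: "\<And>N. (\<And>n. n \<in> {1..N} \<Longrightarrow> \<psi> (real n) = 0) \<Longrightarrow> S N = 0"
  shows "\<exists>C'. \<forall>N. \<bar>S N\<bar> \<le> C' * (Psi_sum d \<psi> \<eta> N powr (1/2) * ln (Psi_sum d \<psi> \<eta> N + 1) powr e)"
proof (cases "\<exists>n\<ge>1. \<psi> (real n) \<noteq> 0")
  case False
  then have "S N = 0" for N by (intro S0) auto
  then show ?thesis by (intro exI[of _ 0]) simp
next
  case True
  define n0 where "n0 = (LEAST n. 1 \<le> n \<and> \<psi> (real n) \<noteq> 0)"
  have n0: "1 \<le> n0" "\<psi> (real n0) \<noteq> 0" using LeastI_ex[of "\<lambda>n. 1 \<le> n \<and> \<psi> (real n) \<noteq> 0"] True by (auto simp: n0_def)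
  have below: "\<psi> (real n) = 0" if "1 \<le> n" "n < n0" for n
    using not_less_Least[of n "\<lambda>n. 1 \<le> n \<and> \<psi> (real n) \<noteq> 0"] that by (auto simp: n0_def)
  let ?P = "Psi_sum d \<psi> 0" and ?Q = "Psi_sum d \<psi> \<eta>"
  have P0: "0 \<le> ?P N" for N unfolding Psi_sum_def by (intro sum_nonneg) auto
  define q where "q = \<psi> (real n0) powr ((1 - \<eta>) * real d)"
  have q: "0 < q" using n0 by (simp add: q_def)
  have Qq: "q \<le> ?Q N" if "n0 \<le> N" for N
    unfolding Psi_sum_def q_def by (rule member_le_sum) (use that n0 in auto)
  have R0: "0 \<le> R" using \<psi>(1)[of 1] \<psi>(2)[of 1] by simp
  define M where "M = max 1 (R powr (\<eta> * real d))"
  have M1: "1 \<le> M" by (simp add: M_def)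
  have PQ: "?P N \<le> M * ?Q N" for N
    unfolding Psi_sum_def sum_distrib_left
  proof (rule sum_mono)
    fix n assume n: "n \<in> {1..N}"
    have "\<psi> (real n) powr ((1 - 0) * real d) = \<psi> (real n) powr (\<eta> * real d) * \<psi> (real n) powr ((1 - \<eta>) * real d)"
      by (simp add: algebra_simps flip: powr_add)
    also have "\<dots> \<le> M * \<psi> (real n) powr ((1 - \<eta>) * real d)"
    proof (rule mult_right_mono)
      have "\<psi> (real n) powr (\<eta> * real d) \<le> R powr (\<eta> * real d)"
        using \<psi> n \<eta> by (intro powr_mono2) auto
      then show "\<psi> (real n) powr (\<eta> * real d) \<le> M" by (simp add: M_def)
    qed simp
    finally show "\<psi> (real n) powr ((1 - 0) * real d) \<le> M * \<psi> (real n) powr ((1 - \<eta>) * real d)" .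
  qed
  define M' where "M' = 1 / q + M"
  define L where "L = ln (2 * M) / ln (1 + q) + 1"
  have l0: "0 < ln (1 + q)" using q by simp
  have L0: "0 \<le> L" using M1 l0 by (simp add: L_def)
  have "\<bar>S N\<bar> \<le> (C * (sqrt M' * L powr e)) * (?Q N powr (1/2) * ln (?Q N + 1) powr e)" for N
  proof (cases "n0 \<le> N")
    case True
    note Q = Qq[OF True]
    have Q0: "0 < ?Q N" using q Q by linarith
    have "1 + ?P N \<le> M' * ?Q N"
    proof -
      have "1 \<le> 1 / q * ?Q N" using q Q by (simp add: field_simps)
      then show ?thesis using PQ[of N] by (simp add: M'_def distrib_right)
    qed
    then have 1: "sqrt (1 + ?P N) \<le> sqrt M' * sqrt (?Q N)" by (simp flip: real_sqrt_mult)
    have 2: "ln (2 + ?P N) \<le> L * ln (?Q N + 1)"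
    proof -
      have "2 + ?P N \<le> (2 * M) * (?Q N + 1)"
      proof -
        have "0 \<le> M * ?Q N" using M1 Q0 by simp
        then show ?thesis using PQ[of N] M1 by (simp add: algebra_simps)
      qed
      then have "ln (2 + ?P N) \<le> ln ((2 * M) * (?Q N + 1))" using P0[of N] by (intro ln_mono) auto
      also have "\<dots> = ln (2 * M) + ln (?Q N + 1)" using M1 Q0 by (intro ln_mult_pos) auto
      also have "\<dots> \<le> L * ln (?Q N + 1)"
      proof -
        have "ln (1 + q) \<le> ln (?Q N + 1)" using q Q by simp
        then have "ln (2 * M) * ln (1 + q) \<le> ln (2 * M) * ln (?Q N + 1)" using M1 by (intro mult_left_mono) auto
        then have "ln (2 * M) \<le> ln (2 * M) / ln (1 + q) * ln (?Q N + 1)" using l0 by (simp add: field_simps)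
        then show ?thesis by (simp add: L_def distrib_right)
      qed
      finally show ?thesis .
    qed
    have "\<bar>S N\<bar> \<le> C * ((sqrt M' * sqrt (?Q N)) * (L * ln (?Q N + 1)) powr e)"
      by (rule order_trans[OF b[of N]], intro mult_left_mono mult_mono powr_mono2 1 2)
         (use P0[of N] e C Q0 M1 q in \<open>auto simp: M'_def\<close>)
    also have "\<dots> = (C * (sqrt M' * L powr e)) * (?Q N powr (1/2) * ln (?Q N + 1) powr e)"
      using Q0 by (simp add: powr_mult powr_half_sqrt)
    finally show ?thesis .
  next
    case False
    then have "S N = 0" using below by (intro S0) auto
    then show ?thesis using C M1 q by (simp add: M'_def)
  qed
  then show ?thesis by blast
qed

theorem corollary1p4:
  fixes \<phi> :: "nat \<Rightarrow> real^'d \<Rightarrow> real^'d" and m :: nat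
    and K :: "(real^'d) set" and \<mu> :: "(real^'d) measure" and T :: "real^'d \<Rightarrow> real^'d"
    and h :: "real^'d \<Rightarrow> real" and \<psi> :: "real \<Rightarrow> real"
    and err :: "nat \<Rightarrow> real^'d \<Rightarrow> real" and c :: real
  assumes "self_conformal_system m \<phi> K \<mu> T"
    and "hausdorff_dim K = ereal (real CARD('d))"
    and "equivalent_measures \<mu> (density lborel (indicator K))"
    and "h \<in> borel_measurable borel" and "\<And>x. 0 \<le> h x"
    and "\<mu> = density (density lborel (indicator K)) (\<lambda>x. ennreal (h x))"
    and "\<And>x. 0 \<le> \<psi> x" and "(\<psi> \<longlongrightarrow> 0) at_top"
    and "c = measure lborel (ball (0::real^'d) 1)"
    and "\<And>n x. 1 \<le> n \<Longrightarrow> \<psi> (real n) \<noteq> 0 \<Longrightarrow>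
           measure \<mu> (ball x (\<psi> (real n))) = (h x + err n x) * c * \<psi> (real n) ^ CARD('d)"
    and "\<And>n x. 1 \<le> n \<Longrightarrow> \<psi> (real n) = 0 \<Longrightarrow> err n x = 0"
  shows "(AE x in \<mu>. (\<lambda>n. err n x) \<longlonglongrightarrow> 0) \<and>
    (\<forall>\<eta>>0. \<forall>\<epsilon>>0. AE x in \<mu>. \<exists>C. \<forall>N.
       \<bar>recurrence_count T \<psi> N x
          - (c * h x * Psi_sum CARD('d) \<psi> 0 N
             + c * (\<Sum>n=1..N. err n x * \<psi> (real n) ^ CARD('d)))\<bar>
         \<le> C * (Psi_sum CARD('d) \<psi> \<eta> N powr (1/2)
                * ln (Psi_sum CARD('d) \<psi> \<eta> N + 1) powr (3/2 + \<epsilon>))) \<and>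
    (filterlim (\<lambda>N. \<Sum>n=1..N. \<psi> (real n) ^ CARD('d)) at_top sequentially \<longrightarrow>
       (AE x in \<mu>. (\<lambda>N. recurrence_count T \<psi> N x / Psi_sum CARD('d) \<psi> 0 N) \<longlonglongrightarrow> c * h x))"
proof -
  let ?d = "CARD('d)"
  note h = assms(4,5) and \<mu>h = assms(6) and \<psi>0 = assms(7) and c = assms(9)
  obtain \<alpha> \<Omega> where sys: "conformal_ifs \<alpha> \<Omega> m \<phi>" "open_set_condition \<Omega> m \<phi>" "attractor \<Omega> m \<phi> K"
    "gibbs_measure \<Omega> m \<phi> K \<mu>" and T: "T = induced_map m \<phi> K"
    using assms(1) unfolding self_conformal_system_def by blast
  interpret conformal_attractor \<alpha> \<Omega> m \<phi> K by unfold_locales (fact sys)+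
  have Kb: "K \<in> sets borel" using compact_K by (rule borel_compact)
  have Kfin: "emeasure lborel K < \<infinity>" by (rule emeasure_bounded_finite[OF compact_imp_bounded[OF compact_K]])
  have d1: "1 \<le> ?d" by simp
  obtain C0 where C0: "1 \<le> C0" "\<And>E. E \<in> sets borel \<Longrightarrow> emeasure \<mu> E \<le> ennreal C0 * emeasure (density lborel (indicator K)) E"
    using assms(3) unfolding equivalent_measures_def by blast
  have ac: "emeasure \<mu> E \<le> ennreal C0 * emeasure lborel (K \<inter> E)" if "E \<in> sets borel" for E
    using C0(2)[OF that] emeasure_density_indicator[OF Kb that] by simp
  have c0: "0 < c" unfolding c by simp
  have ballc: "measure lborel (ball x s) = c * s ^ ?d" if "0 \<le> s" for x :: "real^'d" and s
    using content_ball_conv_unit_ball[OF that, of x] by (simp add: c mult.commute)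
  define r where "r n = (if n = 0 then 0 else \<psi> (real n))" for n :: nat
  have r0: "0 \<le> r n" for n using \<psi>0 by (simp add: r_def)
  have \<psi>lim: "(\<lambda>n. \<psi> (real n)) \<longlonglongrightarrow> 0"
    by (rule filterlim_compose[OF assms(8) filterlim_real_sequentially])
  then have "Bseq (\<lambda>n. \<psi> (real n))" by (intro convergent_imp_Bseq convergentI)
  then obtain R where R: "\<And>n. \<bar>\<psi> (real n)\<bar> \<le> R" unfolding Bseq_def by auto
  have R0: "0 \<le> R" using R[of 0] by linarith
  have rR: "r n \<le> R" for n using R[of n] R0 by (simp add: r_def abs_le_iff)
  have shift: "(\<Sum>n<Suc N. f n) = (\<Sum>n=1..N. f n)" if "f 0 = 0" for f :: "nat \<Rightarrow> real" and N
    by (induction N) (use that in auto)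
  have Psi0: "Psi_sum ?d \<psi> 0 N = (\<Sum>n=1..N. \<psi> (real n) ^ ?d)" for N
    unfolding Psi_sum_def using \<psi>0 d1 by (intro sum.cong refl) (simp add: powr_realpow')
  have rsum: "(\<Sum>n<Suc N. r n ^ ?d) = Psi_sum ?d \<psi> 0 N" for N
    by (subst shift) (auto simp: r_def Psi0 power_0_left intro!: sum.cong)
  define S where "S N x = (\<Sum>n=1..N. indicator (ball x (\<psi> (real n))) ((T ^^ n) x) - measure \<mu> (ball x (\<psi> (real n))))" for N x
  have rS: "(\<Sum>n<Suc N. indicator (ball x (r n)) ((T ^^ n) x) - measure \<mu> (ball x (r n))) = S N x" for N x
    by (subst shift) (auto simp: r_def S_def intro!: sum.cong)
  have bm: "measure \<mu> (ball x (\<psi> (real n))) = (h x + err n x) * c * \<psi> (real n) ^ ?d" if "1 \<le> n" for n x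
  proof (cases "\<psi> (real n) = 0")
    case True
    then show ?thesis using assms(11)[OF that True] d1 by (simp add: power_0_left)
  qed (rule assms(10)[OF that])
  have S_eq: "S N x = recurrence_count T \<psi> N x - (c * h x * Psi_sum ?d \<psi> 0 N + c * (\<Sum>n=1..N. err n x * \<psi> (real n) ^ ?d))" for N x
  proof -
    have "(\<Sum>n=1..N. measure \<mu> (ball x (\<psi> (real n)))) = (\<Sum>n=1..N. c * h x * \<psi> (real n) ^ ?d + c * (err n x * \<psi> (real n) ^ ?d))"
      by (intro sum.cong refl) (simp add: bm algebra_simps)
    then show ?thesis
      by (simp add: S_def recurrence_count_def Psi0 sum_subtractf sum.distrib sum_distrib_left)
  qed
  have bound: "AE x in \<mu>. \<exists>C\<ge>0. \<forall>N. \<bar>S N x\<bar> \<le> C * (sqrt (1 + Psi_sum ?d \<psi> 0 N) * ln (2 + Psi_sum ?d \<psi> 0 N) powr (3/2 + \<epsilon>))"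
    if \<epsilon>: "0 < \<epsilon>" for \<epsilon>
  proof -
    have "AE x in \<mu>. \<exists>C\<ge>0. \<forall>N.
      \<bar>\<Sum>n<N. indicator (ball x (r n)) ((T ^^ n) x) - measure \<mu> (ball x (r n))\<bar>
        \<le> C * (sqrt (1 + (\<Sum>n<N. r n ^ ?d)) * ln (2 + (\<Sum>n<N. r n ^ ?d)) powr (3/2 + \<epsilon>))"
      unfolding T by (rule gibbs_return_count_error[OF sys(4) _ ac r0 rR \<epsilon>]) (use C0(1) in auto)
    then show ?thesis
    proof eventually_elim
      case (elim x)
      then obtain C where C: "0 \<le> C" "\<And>N. \<bar>\<Sum>n<N. indicator (ball x (r n)) ((T ^^ n) x) - measure \<mu> (ball x (r n))\<bar>
        \<le> C * (sqrt (1 + (\<Sum>n<N. r n ^ ?d)) * ln (2 + (\<Sum>n<N. r n ^ ?d)) powr (3/2 + \<epsilon>))" by blast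
      show ?case using C(1) C(2)[of "Suc N" for N] unfolding rS rsum by blast
    qed
  qed
  have err0: "AE x in \<mu>. (\<lambda>n. err n x) \<longlonglongrightarrow> 0"
  proof -
    define f where "f x = (indicator K x * min (h x) C0 :: real)" for x
    have fm: "f \<in> borel_measurable borel" unfolding f_def[abs_def] using Kb h(1) by measurable
    have f0: "0 \<le> f x" "f x \<le> C0" for x using h(2)[of x] C0(1) by (auto simp: f_def indicator_def)
    have hC: "AE x in lborel. x \<in> K \<longrightarrow> h x \<le> C0"
    proof (rule AE_density_bounded[OF Kb Kfin h])
      show "0 \<le> C0" using C0(1) by simp
      show "emeasure (density (density lborel (indicator K)) (\<lambda>x. ennreal (h x))) E \<le> ennreal C0 * emeasure lborel (K \<inter> E)"
        if "E \<in> sets borel" for E using ac[OF that] unfolding \<mu>h .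
    qed
    have \<mu>f: "\<mu> = density lborel (\<lambda>x. ennreal (f x))"
    proof -
      have "\<mu> = density lborel (\<lambda>x. indicator K x * ennreal (h x))"
        unfolding \<mu>h using Kb h(1) by (intro density_density_eq) auto
      also have "\<dots> = density lborel (\<lambda>x. ennreal (f x))"
      proof (rule density_cong)
        show "AE x in lborel. indicator K x * ennreal (h x) = ennreal (f x)"
          using hC by eventually_elim (auto simp: f_def indicator_def)
      qed (use Kb h(1) fm in auto)
      finally show ?thesis .
    qed
    have fm2: "(\<lambda>x. ennreal (f x)) \<in> borel_measurable lborel" using fm by simp
    have AE\<mu>: "(AE x in \<mu>. Q x) \<longleftrightarrow> (AE x in lborel. 0 < ennreal (f x) \<longrightarrow> Q x)" for Q
      by (subst \<mu>f) (rule AE_density[OF fm2])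
    have A1: "AE x in \<mu>. f x = h x"
      unfolding AE\<mu> using hC by eventually_elim (auto simp: f_def indicator_def)
    have A2: "AE x in \<mu>. ((\<lambda>s. measure \<mu> (ball x s) / measure lborel (ball x s)) \<longlongrightarrow> f x) (at_right 0)"
    proof -
      have "AE x in lborel. ((\<lambda>s. measure \<mu> (ball x s) / measure lborel (ball x s)) \<longlongrightarrow> f x) (at_right 0)"
        unfolding \<mu>f by (rule lebesgue_differentiation_balls[OF fm f0])
      then show ?thesis unfolding AE\<mu> by eventually_elim simp
    qed
    from A1 A2 show ?thesis
    proof eventually_elim
      case (elim x)
      show ?case
      proof (rule LIMSEQ_I)
        fix e :: real assume e: "0 < e"
        have "\<forall>\<^sub>F s in at_right 0. dist (measure \<mu> (ball x s) / measure lborel (ball x s)) (f x) < e"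
          using elim(2) e by (rule tendstoD)
        then obtain \<delta> where \<delta>: "0 < \<delta>" "\<And>s. 0 < s \<Longrightarrow> s < \<delta> \<Longrightarrow> \<bar>measure \<mu> (ball x s) / measure lborel (ball x s) - h x\<bar> < e"
          unfolding eventually_at_right_field using elim(1) by (auto simp: dist_real_def)
        obtain n0 where n0: "\<And>n. n0 \<le> n \<Longrightarrow> \<bar>\<psi> (real n)\<bar> < \<delta>" using LIMSEQ_D[OF \<psi>lim \<delta>(1)] by auto
        have "norm (err n x - 0) < e" if n: "max 1 n0 \<le> n" for n
        proof (cases "\<psi> (real n) = 0")
          case True
          then show ?thesis using assms(11)[of n x] n e by simp
        next
          case False
          then have p: "0 < \<psi> (real n)" "\<psi> (real n) < \<delta>" using \<psi>0[of "real n"] n0[of n] n by auto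
          have "measure \<mu> (ball x (\<psi> (real n))) / measure lborel (ball x (\<psi> (real n))) = h x + err n x"
            using bm[of n x] n p(1) c0 by (simp add: ballc)
          then show ?thesis using \<delta>(2)[OF p] by simp
        qed
        then show "\<exists>n0. \<forall>n\<ge>n0. norm (err n x - 0) < e" by blast
      qed
    qed
  qed
  have part1: "AE x in \<mu>. \<exists>C. \<forall>N. \<bar>S N x\<bar> \<le> C * (Psi_sum ?d \<psi> \<eta> N powr (1/2) * ln (Psi_sum ?d \<psi> \<eta> N + 1) powr (3/2 + \<epsilon>))"
    if \<eta>: "0 < \<eta>" and \<epsilon>: "0 < \<epsilon>" for \<eta> \<epsilon>
    using bound[OF \<epsilon>]
  proof eventually_elim
    case (elim x)
    then obtain C where C: "0 \<le> C" "\<And>N. \<bar>S N x\<bar> \<le> C * (sqrt (1 + Psi_sum ?d \<psi> 0 N) * ln (2 + Psi_sum ?d \<psi> 0 N) powr (3/2 + \<epsilon>))" by blast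
    show ?case
    proof (rule error_term_comparison[OF C(2,1) _ \<psi>0 _ \<eta>])
      show "\<psi> (real n) \<le> R" for n using R[of n] by (simp add: abs_le_iff)
      show "S N x = 0" if "\<And>n. n \<in> {1..N} \<Longrightarrow> \<psi> (real n) = 0" for N unfolding S_def using that by (intro sum.neutral) simp
    qed (use \<epsilon> in simp)
  qed
  have part2: "AE x in \<mu>. (\<lambda>N. recurrence_count T \<psi> N x / Psi_sum ?d \<psi> 0 N) \<longlonglongrightarrow> c * h x"
    if W: "filterlim (\<lambda>N. \<Sum>n=1..N. \<psi> (real n) ^ ?d) at_top sequentially"
    using bound[OF zero_less_one] err0
  proof eventually_elim
    case (elim x)
    then obtain C where C: "0 \<le> C" "\<And>N. \<bar>S N x\<bar> \<le> C * (sqrt (1 + Psi_sum ?d \<psi> 0 N) * ln (2 + Psi_sum ?d \<psi> 0 N) powr (3/2 + 1))" by blast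
    have W': "filterlim (Psi_sum ?d \<psi> 0) at_top sequentially" 
    proof -
      have "Psi_sum ?d \<psi> 0 = (\<lambda>N. \<Sum>n=1..N. \<psi> (real n) ^ ?d)" by (rule ext) (rule Psi0)
      then show ?thesis using W by (simp only:)
    qed
    have ev: "eventually (\<lambda>N. 0 < Psi_sum ?d \<psi> 0 N) sequentially" using W' by (simp add: filterlim_at_top_dense)
    have "((\<lambda>t::real. C * (sqrt (1 + t) * ln (2 + t) powr (3/2 + 1)) / t) \<longlongrightarrow> 0) at_top" by real_asymp
    from filterlim_compose[OF this W']
    have lim: "(\<lambda>N. C * (sqrt (1 + Psi_sum ?d \<psi> 0 N) * ln (2 + Psi_sum ?d \<psi> 0 N) powr (3/2 + 1)) / Psi_sum ?d \<psi> 0 N) \<longlonglongrightarrow> 0" .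
    have l1: "(\<lambda>N. S N x / Psi_sum ?d \<psi> 0 N) \<longlonglongrightarrow> 0"
    proof (rule Lim_null_comparison[OF _ lim])
      show "\<forall>\<^sub>F N in sequentially. norm (S N x / Psi_sum ?d \<psi> 0 N)
          \<le> C * (sqrt (1 + Psi_sum ?d \<psi> 0 N) * ln (2 + Psi_sum ?d \<psi> 0 N) powr (3/2 + 1)) / Psi_sum ?d \<psi> 0 N"
        using ev
      proof eventually_elim
        case (elim N)
        then show ?case using divide_right_mono[OF C(2)[of N], of "Psi_sum ?d \<psi> 0 N"] by (simp add: abs_divide)
      qed
    qed
    have l2: "(\<lambda>N. (\<Sum>n=1..N. err n x * \<psi> (real n) ^ ?d) / Psi_sum ?d \<psi> 0 N) \<longlonglongrightarrow> 0"
      unfolding Psi0 by (rule weighted_average_null[OF elim(2) _ W]) (use \<psi>0 in simp)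
    have "(\<lambda>N. S N x / Psi_sum ?d \<psi> 0 N + (c * h x + c * ((\<Sum>n=1..N. err n x * \<psi> (real n) ^ ?d) / Psi_sum ?d \<psi> 0 N)))
        \<longlonglongrightarrow> 0 + (c * h x + c * 0)"
      by (intro tendsto_intros l1 l2)
    then have "(\<lambda>N. S N x / Psi_sum ?d \<psi> 0 N + (c * h x + c * ((\<Sum>n=1..N. err n x * \<psi> (real n) ^ ?d) / Psi_sum ?d \<psi> 0 N)))
        \<longlonglongrightarrow> c * h x" by simp
    then show ?case
    proof (rule Lim_transform_eventually)
      show "\<forall>\<^sub>F N in sequentially. S N x / Psi_sum ?d \<psi> 0 N + (c * h x + c * ((\<Sum>n=1..N. err n x * \<psi> (real n) ^ ?d) / Psi_sum ?d \<psi> 0 N))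
          = recurrence_count T \<psi> N x / Psi_sum ?d \<psi> 0 N"
        using ev by eventually_elim (simp add: S_eq field_simps)
    qed
  qed
  show ?thesis using err0 part1 part2 unfolding S_eq by blast
qed

end
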